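(* Let $k$ be a field. Let $n\ge2$ be an integer, let $d_1,\dots,d_n\ge1$ be integers, and let $E(V_1,\dots,V_n)$ be a monomial expression in $n$ variables defined over $k$ (i.e. over $\mathrm{Spec}(k)$), homogeneous of non-zero degree (its degree $(a_1,\dots,a_n)\in\mathbb Z^n$ is not $(0,\dots,0)$). For $i=1,\dots,n$, take $V_i:=k^{d_i}$ to be the standard representation of $\mathbf{GL}_{d_i}$, and consider $E(V_1,\dots,V_n)$ as a representation of the algebraic $k$-group $\mathbf G:=\mathbf{GL}_{d_1}\times\cdots\times\mathbf{GL}_{d_n}$ in the natural way. Then, for all $i\ge0$, the group $$H^i(\mathbf G,E(V_1,\dots,V_n))$$ vanishes.
   Context: $H^i(\mathbf G,-)$ is Hochschild (rational) cohomology of the affine algebraic group $\mathbf G$, defined via the Hochschild complex. Monomial expressions over a scheme $S$. Standard monomial functors of degree $n\ge1$ over $S$ are the endofunctors of quasi-coherent $\mathcal O_S$-modules $M\mapsto\mathrm{Sym}^n(M)$, $M\mapsto\Gamma^n(M)$ (divided power), $M\mapsto\Lambda^n(M)$, and, if $n=p^r$ for a prime $p$ and $S$ is an $\mathbb F_p$-scheme, the $r$-th absolute Frobenius twist $M\mapsto M^{(r)}=(\mathrm{frob}^r)^*(M)$. A monomial expression in $m\ge1$ variables is an association sending an $m$-tuple of vector bundles $(V_1,\dots,V_m)$ over $S$ to a vector bundle $\Theta(V_1,\dots,V_m)$ over $S$, obtained inductively by the rules: (1) for $m=1$, standard monomial functors are monomial expressions; (2) $V\mapsto V^\vee$ is a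 monomial expression; (3) if $\Theta$ is one in $m$ variables, so is $(V_1,\dots,V_{m+1})\mapsto\Theta(V_1,\dots,V_m)\otimes V_{m+1}$; (4) if $\Theta,\Theta'$ are ones in $m$, $m'$ variables, so is the substitution of $\Theta'(V_1,\dots,V_{m'})$ for the first variable of $\Theta$, giving one in $m+m'-1$ variables; (5) if $\Theta$ is one in $m+1$ variables, so is $(V_1,\dots,V_m)\mapsto\Theta(V_1,V_1,V_2,\dots,V_m)$; (6) permuting variables. The degree of $\Theta$ is the $m$-tuple $(a_1,\dots,a_m)\in\mathbb Z^m$ such that $\Theta(V_1\otimes L_1,\dots,V_m\otimes L_m)=\Theta(V_1,\dots,V_m)\otimes\bigotimes_iL_i^{\otimes a_i}$ for all line bundles $L_i$. Monomial expressions are covariant with respect to isomorphisms, which gives the action of $\mathbf G$. *)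

theory Defs
  imports
    "HOL-Algebra.Algebra"
    "HOL-Combinatorics.Permutations"
    "Jordan_Normal_Form.Matrix"
begin

section \<open>Algebras over the base field\<close>

text \<open>
  Affine group schemes over \<open>K\<close> and their modules are treated as functors on commutative
  \<open>K\<close>-algebras (the locale \<^locale>\<open>algebra\<close> of the library).  HOL cannot quantify over types
  inside a formula, so the algebras are taken with carriers inside the one type \<open>'k list\<close>, where
  \<open>'k\<close> is the type of the elements of \<open>K\<close>.  This type is infinite and contains a copy of \<open>'k\<close>;
  hence every \<open>K\<close>-algebra of at most countable dimension, in particular every finitely generated
  one, has an isomorphic copy among them.  Since the coordinate rings \<open>K[G\<^sup>i]\<close> of an algebraic
  group \<open>G\<close> are of this kind, by Yoneda's lemma the natural transformations from \<open>G\<^sup>i\<close> to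
  \<open>A \<mapsto> V \<otimes> A\<close> on this category are exactly the elements of \<open>V \<otimes> K[G\<^sup>i] = V \<otimes> K[G]\<^bsup>\<otimes>i\<^esup>\<close>.
\<close>

type_synonym 'k alg = "('k, 'k list) module"

definition algebra_hom ::
    "('k, 'b) ring_scheme \<Rightarrow> 'k alg \<Rightarrow> 'k alg \<Rightarrow> ('k list \<Rightarrow> 'k list) set" where
  "algebra_hom K A B = {h \<in> Ring.ring_hom A B.
     \<forall>c \<in> carrier K. \<forall>x \<in> carrier A. h (c \<odot>\<^bsub>A\<^esub> x) = c \<odot>\<^bsub>B\<^esub> h x}"

section \<open>Matrices over a commutative ring given by a carrier set\<close>

definition matrix_monoid :: "('a, 'b) ring_scheme \<Rightarrow> nat \<Rightarrow> 'a mat monoid" where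
  "matrix_monoid A d =
    \<lparr>carrier = {g \<in> carrier_mat d d. elements_mat g \<subseteq> carrier A},
     monoid.mult = (\<lambda>g h. mat d d (\<lambda>(i, j). \<Oplus>\<^bsub>A\<^esub>l\<in>{..<d}. g $$ (i, l) \<otimes>\<^bsub>A\<^esub> h $$ (l, j))),
     one = mat d d (\<lambda>(i, j). if i = j then \<one>\<^bsub>A\<^esub> else \<zero>\<^bsub>A\<^esub>)\<rparr>"

definition GL :: "('a, 'b) ring_scheme \<Rightarrow> nat \<Rightarrow> 'a mat monoid" where
  "GL A d = units_of (matrix_monoid A d)"

definition free_module :: "('a, 'b) ring_scheme \<Rightarrow> nat \<Rightarrow> 'a vec set" where
  "free_module A d = {v \<in> carrier_vec d. \<forall>i<d. v $ i \<in> carrier A}"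

definition apply_mat :: "('a, 'b) ring_scheme \<Rightarrow> 'a mat \<Rightarrow> 'a vec \<Rightarrow> 'a vec" where
  "apply_mat A g v = vec (dim_row g) (\<lambda>i. \<Oplus>\<^bsub>A\<^esub>j\<in>{..<dim_col g}. g $$ (i, j) \<otimes>\<^bsub>A\<^esub> v $ j)"

section \<open>Monomial expressions\<close>

text \<open>
  A vector bundle is represented by a free module \<open>A\<^sup>d\<close> with its standard basis, and an isomorphism
  by an element of \<open>GL\<^sub>d(A)\<close>.  Over a field this is every vector bundle up to isomorphism; the
  \<open>K\<close>-algebras \<open>A\<close> serve to record the compatibility of the constructions with base change.  An
  association on \<open>m\<close>-tuples of vector bundles consists of the rank of its value on
  \<open>(A\<^bsup>d\<^sub>1\<^esup>, \<dots>, A\<^bsup>d\<^sub>m\<^esup>)\<close>, which does not depend on \<open>A\<close>, and of its effect on isomorphisms, i.e. the matrix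
  of the isomorphism induced by \<open>(g\<^sub>1, \<dots>, g\<^sub>m)\<close>.
\<close>

record 'k vb_functor =
  vb_rank :: "nat list \<Rightarrow> nat"
  vb_iso :: "'k alg \<Rightarrow> 'k list mat list \<Rightarrow> 'k list mat"

text \<open>
  The basis vectors \<open>e\<^sub>s = e\<^bsub>s\<^sub>1\<^esub> \<otimes> \<dots> \<otimes> e\<^bsub>s\<^sub>n\<^esub>\<close> of \<open>(A\<^sup>N)\<^bsup>\<otimes>n\<^esup>\<close> are indexed by the sequences \<open>s\<close> of length
  \<open>n\<close> in \<open>{0..<N}\<close>.
\<close>

definition index_seqs :: "nat \<Rightarrow> nat \<Rightarrow> nat list set" where
  "index_seqs n N = {s. length s = n \<and> set s \<subseteq> {..<N}}"

text \<open>The coefficient of \<open>e\<^sub>s\<close> in \<open>g\<^bsup>\<otimes>n\<^esup> e\<^sub>t = g e\<^bsub>t\<^sub>1\<^esub> \<otimes> \<dots> \<otimes> g e\<^bsub>t\<^sub>n\<^esub>\<close>:\<close>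

definition tensor_power_entry ::
    "('a, 'b) ring_scheme \<Rightarrow> nat \<Rightarrow> 'a mat \<Rightarrow> nat list \<Rightarrow> nat list \<Rightarrow> 'a" where
  "tensor_power_entry A n g s t = (\<Otimes>\<^bsub>A\<^esub>l\<in>{..<n}. g $$ (s ! l, t ! l))"

definition incr_seqs :: "nat \<Rightarrow> nat \<Rightarrow> nat list list" where
  "incr_seqs n N = filter sorted (List.n_lists n [0..<N])"

definition strict_incr_seqs :: "nat \<Rightarrow> nat \<Rightarrow> nat list list" where
  "strict_incr_seqs n N = filter (sorted_wrt (<)) (List.n_lists n [0..<N])"

text \<open>
  \<open>Sym\<^sup>n(A\<^sup>N)\<close> is the module of coinvariants of the symmetric group on \<open>(A\<^sup>N)\<^bsup>\<otimes>n\<^esup>\<close>.  Its basis is given by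
  the monomials \<open>e\<^bsub>I\<^sub>1\<^esub> \<cdots> e\<^bsub>I\<^sub>n\<^esub>\<close>, \<open>I\<close> weakly increasing, and \<open>e\<^sub>s\<close> maps to the monomial of index
  \<open>sort s\<close>.  The matrix below expands \<open>(g e\<^bsub>J\<^sub>1\<^esub>) \<cdots> (g e\<^bsub>J\<^sub>n\<^esub>)\<close>.
\<close>

definition sym_mat :: "('a, 'b) ring_scheme \<Rightarrow> nat \<Rightarrow> 'a mat \<Rightarrow> 'a mat" where
  "sym_mat A n g =
    (let N = dim_row g; b = incr_seqs n N in
     mat (length b) (length b) (\<lambda>(p, q).
       \<Oplus>\<^bsub>A\<^esub>s\<in>{s \<in> index_seqs n N. sort s = b ! p}. tensor_power_entry A n g s (b ! q)))"

text \<open>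
  On free modules \<open>\<Gamma>\<^sup>n(A\<^sup>N)\<close> is the module of invariants of the symmetric group on \<open>(A\<^sup>N)\<^bsup>\<otimes>n\<^esup>\<close>, where
  the product of divided powers \<open>\<gamma>\<^bsub>c\<^sub>1\<^esub>(e\<^sub>1) \<cdots> \<gamma>\<^bsub>c\<^sub>N\<^esub>(e\<^sub>N)\<close> is the sum of all \<open>e\<^sub>s\<close> in which each \<open>j\<close> occurs
  \<open>c\<^sub>j\<close> times.  Such an orbit sum is indexed by the weakly increasing member of its orbit, and the
  coordinate of an invariant tensor at \<open>I\<close> is its coefficient at \<open>e\<^sub>I\<close>.
\<close>

definition divided_power_mat :: "('a, 'b) ring_scheme \<Rightarrow> nat \<Rightarrow> 'a mat \<Rightarrow> 'a mat" where
  "divided_power_mat A n g =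
    (let N = dim_row g; b = incr_seqs n N in
     mat (length b) (length b) (\<lambda>(p, q).
       \<Oplus>\<^bsub>A\<^esub>s\<in>{s \<in> index_seqs n N. sort s = b ! q}. tensor_power_entry A n g (b ! p) s))"

text \<open>
  \<open>\<Lambda>\<^sup>n(A\<^sup>N)\<close> has the basis \<open>e\<^bsub>I\<^sub>1\<^esub> \<and> \<dots> \<and> e\<^bsub>I\<^sub>n\<^esub>\<close>, \<open>I\<close> strictly increasing; the coefficients of
  \<open>g e\<^bsub>J\<^sub>1\<^esub> \<and> \<dots> \<and> g e\<^bsub>J\<^sub>n\<^esub>\<close> are the minors of \<open>g\<close>.
\<close>

definition ext_mat :: "('a, 'b) ring_scheme \<Rightarrow> nat \<Rightarrow> 'a mat \<Rightarrow> 'a mat" where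
  "ext_mat A n g =
    (let b = strict_incr_seqs n (dim_row g) in
     mat (length b) (length b) (\<lambda>(p, q).
       \<Oplus>\<^bsub>A\<^esub>\<pi>\<in>{\<pi>. \<pi> permutes {..<n}}.
         [sign \<pi>] \<cdot>\<^bsub>A\<^esub> tensor_power_entry A n g (permute_list \<pi> (b ! p)) (b ! q)))"

definition tensor_mat :: "('a, 'b) ring_scheme \<Rightarrow> 'a mat \<Rightarrow> 'a mat \<Rightarrow> 'a mat" where
  "tensor_mat A g h = mat (dim_row g * dim_row h) (dim_col g * dim_col h)
    (\<lambda>(i, j). g $$ (i div dim_row h, j div dim_col h) \<otimes>\<^bsub>A\<^esub> h $$ (i mod dim_row h, j mod dim_col h))"

definition sym_functor :: "nat \<Rightarrow> 'k vb_functor" where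
  "sym_functor n = \<lparr>vb_rank = (\<lambda>ds. length (incr_seqs n (hd ds))),
                    vb_iso = (\<lambda>A gs. sym_mat A n (hd gs))\<rparr>"

definition divided_power_functor :: "nat \<Rightarrow> 'k vb_functor" where
  "divided_power_functor n = \<lparr>vb_rank = (\<lambda>ds. length (incr_seqs n (hd ds))),
                              vb_iso = (\<lambda>A gs. divided_power_mat A n (hd gs))\<rparr>"

definition ext_functor :: "nat \<Rightarrow> 'k vb_functor" where
  "ext_functor n = \<lparr>vb_rank = (\<lambda>ds. length (strict_incr_seqs n (hd ds))),
                    vb_iso = (\<lambda>A gs. ext_mat A n (hd gs))\<rparr>"

text \<open>The pullback along the \<open>q\<close>-power map, for \<open>q\<close> a power of the characteristic.\<close>

definition frobenius_functor :: "nat \<Rightarrow> 'k vb_functor" where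
  "frobenius_functor q = \<lparr>vb_rank = hd,
                          vb_iso = (\<lambda>A gs. map_mat (\<lambda>x. x [^]\<^bsub>A\<^esub> q) (hd gs))\<rparr>"

text \<open>An isomorphism \<open>g\<close> acts on the dual by the inverse of its transpose.\<close>

definition dual_functor :: "'k vb_functor" where
  "dual_functor = \<lparr>vb_rank = hd,
                   vb_iso = (\<lambda>A gs. transpose_mat (inv\<^bsub>GL A (dim_row (hd gs))\<^esub> (hd gs)))\<rparr>"

definition tensor_functor :: "'k vb_functor \<Rightarrow> 'k vb_functor" where
  "tensor_functor E = \<lparr>vb_rank = (\<lambda>ds. vb_rank E (butlast ds) * last ds),
                       vb_iso = (\<lambda>A gs. tensor_mat A (vb_iso E A (butlast gs)) (last gs))\<rparr>"

text \<open>Substitution of \<open>F\<close>, which has \<open>m'\<close> variables, for the first variable of \<open>E\<close>.\<close>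

definition subst_functor :: "nat \<Rightarrow> 'k vb_functor \<Rightarrow> 'k vb_functor \<Rightarrow> 'k vb_functor" where
  "subst_functor m' E F =
    \<lparr>vb_rank = (\<lambda>ds. vb_rank E (vb_rank F (take m' ds) # drop m' ds)),
     vb_iso = (\<lambda>A gs. vb_iso E A (vb_iso F A (take m' gs) # drop m' gs))\<rparr>"

definition diagonal_functor :: "'k vb_functor \<Rightarrow> 'k vb_functor" where
  "diagonal_functor E = \<lparr>vb_rank = (\<lambda>ds. vb_rank E (hd ds # ds)),
                         vb_iso = (\<lambda>A gs. vb_iso E A (hd gs # gs))\<rparr>"

definition permute_functor :: "(nat \<Rightarrow> nat) \<Rightarrow> 'k vb_functor \<Rightarrow> 'k vb_functor" where
  "permute_functor \<pi> E = \<lparr>vb_rank = (\<lambda>ds. vb_rank E (permute_list \<pi> ds)),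
                          vb_iso = (\<lambda>A gs. vb_iso E A (permute_list \<pi> gs))\<rparr>"

inductive monomial_expression :: "('k, 'b) ring_scheme \<Rightarrow> nat \<Rightarrow> 'k vb_functor \<Rightarrow> bool"
  for K :: "('k, 'b) ring_scheme" where
  sym: "n \<ge> 1 \<Longrightarrow> monomial_expression K 1 (sym_functor n)"
| divided_power: "n \<ge> 1 \<Longrightarrow> monomial_expression K 1 (divided_power_functor n)"
| ext: "n \<ge> 1 \<Longrightarrow> monomial_expression K 1 (ext_functor n)"
| frobenius: "Factorial_Ring.prime (p :: nat) \<Longrightarrow> [p] \<cdot>\<^bsub>K\<^esub> \<one>\<^bsub>K\<^esub> = \<zero>\<^bsub>K\<^esub> \<Longrightarrow>
    monomial_expression K 1 (frobenius_functor (p ^ r))"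
| dual: "monomial_expression K 1 dual_functor"
| tensor: "monomial_expression K m E \<Longrightarrow> monomial_expression K (m + 1) (tensor_functor E)"
| subst: "monomial_expression K m E \<Longrightarrow> monomial_expression K m' F \<Longrightarrow>
    monomial_expression K (m + m' - 1) (subst_functor m' E F)"
| diagonal: "monomial_expression K (m + 1) E \<Longrightarrow> m \<ge> 1 \<Longrightarrow>
    monomial_expression K m (diagonal_functor E)"
| permute: "monomial_expression K m E \<Longrightarrow> \<pi> permutes {..<m} \<Longrightarrow>
    monomial_expression K m (permute_functor \<pi> E)"

text \<open>
  \<open>E(V\<^sub>1 \<otimes> L\<^sub>1, \<dots>, V\<^sub>m \<otimes> L\<^sub>m) = E(V\<^sub>1, \<dots>, V\<^sub>m) \<otimes> L\<^sub>1\<^bsup>\<otimes>a\<^sub>1\<^esup> \<otimes> \<dots> \<otimes> L\<^sub>m\<^bsup>\<otimes>a\<^sub>m\<^esup>\<close> for line bundles \<open>L\<^sub>i\<close>.  On the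
  objects \<open>V\<^sub>i = A\<^bsup>d\<^sub>i\<^esup>\<close>, \<open>L\<^sub>i = A\<close> both sides are the same free module; the identification being
  natural means that the isomorphisms \<open>g\<^sub>i\<close> of \<open>V\<^sub>i\<close> and \<open>l\<^sub>i\<close> of \<open>L\<^sub>i\<close> induce the same map on both
  sides.  An automorphism \<open>l \<in> GL\<^sub>1(A)\<close> of \<open>L\<close> acts on \<open>L\<^bsup>\<otimes>a\<^esup>\<close>, \<open>a \<in> \<int>\<close>, as \<open>l\<^sup>a\<close>, and tensor products
  of line bundles correspond to products in \<open>GL\<^sub>1(A)\<close>.
\<close>

definition has_degree ::
    "('k, 'b) ring_scheme \<Rightarrow> nat \<Rightarrow> 'k vb_functor \<Rightarrow> (nat \<Rightarrow> int) \<Rightarrow> bool" where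
  "has_degree K m E a \<longleftrightarrow>
    (\<forall>(A :: 'k alg) ds gs ls. algebra K A \<longrightarrow> length ds = m \<longrightarrow> length gs = m \<longrightarrow> length ls = m \<longrightarrow>
       (\<forall>j<m. gs ! j \<in> carrier (GL A (ds ! j)) \<and> ls ! j \<in> carrier (GL A 1)) \<longrightarrow>
       vb_iso E A (map2 (tensor_mat A) gs ls) =
       tensor_mat A (vb_iso E A gs) (\<Otimes>\<^bsub>GL A 1\<^esub>j\<in>{..<m}. (ls ! j) [^]\<^bsub>GL A 1\<^esub> (a j)))"

section \<open>Hochschild cohomology\<close>

record ('k, 'g) group_functor =
  points :: "'k alg \<Rightarrow> 'g monoid"
  base_change :: "('k list \<Rightarrow> 'k list) \<Rightarrow> 'g \<Rightarrow> 'g"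

text \<open>A representation on \<open>V = K\<^sup>d\<close>: the group \<open>G(A)\<close> acts \<open>A\<close>-linearly on \<open>V \<otimes> A = A\<^sup>d\<close>.\<close>

record ('k, 'g) group_rep =
  rep_dim :: nat
  rep_mat :: "'k alg \<Rightarrow> 'g \<Rightarrow> 'k list mat"

definition group_tuples ::
    "('k, 'b) ring_scheme \<Rightarrow> ('k, 'g) group_functor \<Rightarrow> nat \<Rightarrow> ('k alg \<times> 'g list) set" where
  "group_tuples K G i =
    {(A, gs). algebra K A \<and> length gs = i \<and> set gs \<subseteq> carrier (points G A)}"

text \<open>The \<open>i\<close>-cochains are the morphisms of functors from \<open>G\<^sup>i\<close> to \<open>A \<mapsto> V \<otimes> A\<close>.\<close>

definition cochains ::
    "('k, 'b) ring_scheme \<Rightarrow> ('k, 'g) group_functor \<Rightarrow> ('k, 'g) group_rep \<Rightarrow> nat \<Rightarrow>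
     ('k alg \<times> 'g list \<Rightarrow> 'k list vec) set" where
  "cochains K G V i =
    {f \<in> (\<Pi>\<^sub>E x\<in>group_tuples K G i. free_module (fst x) (rep_dim V)).
      \<forall>A B h gs. (A, gs) \<in> group_tuples K G i \<longrightarrow> algebra K B \<longrightarrow> h \<in> algebra_hom K A B \<longrightarrow>
        f (B, map (base_change G h) gs) = map_vec h (f (A, gs))}"

definition cochain_group ::
    "('k, 'b) ring_scheme \<Rightarrow> ('k, 'g) group_functor \<Rightarrow> ('k, 'g) group_rep \<Rightarrow> nat \<Rightarrow>
     ('k alg \<times> 'g list \<Rightarrow> 'k list vec) monoid" where
  "cochain_group K G V i =
    \<lparr>carrier = cochains K G V i,
     monoid.mult = (\<lambda>f f'. \<lambda>x\<in>group_tuples K G i.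
       vec (rep_dim V) (\<lambda>p. f x $ p \<oplus>\<^bsub>fst x\<^esub> f' x $ p)),
     one = (\<lambda>x\<in>group_tuples K G i. vec (rep_dim V) (\<lambda>p. \<zero>\<^bsub>fst x\<^esub>))\<rparr>"

definition merge_at :: "('g, 'c) monoid_scheme \<Rightarrow> nat \<Rightarrow> 'g list \<Rightarrow> 'g list" where
  "merge_at H j gs = take j gs @ (gs ! j \<otimes>\<^bsub>H\<^esub> gs ! Suc j) # drop (j + 2) gs"

text \<open>
  \<open>(\<partial>f)(g\<^sub>1, \<dots>, g\<^bsub>i+1\<^esub>) = g\<^sub>1 f(g\<^sub>2, \<dots>, g\<^bsub>i+1\<^esub>) + \<Sum>\<^bsub>1\<le>j\<le>i\<^esub> (-1)\<^sup>j f(\<dots>, g\<^sub>j g\<^bsub>j+1\<^esub>, \<dots>) + (-1)\<^bsup>i+1\<^esup> f(g\<^sub>1, \<dots>, g\<^sub>i)\<close>;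
  in the code the index \<open>j\<close> starts from \<open>0\<close>.
\<close>

definition coboundary ::
    "('k, 'b) ring_scheme \<Rightarrow> ('k, 'g) group_functor \<Rightarrow> ('k, 'g) group_rep \<Rightarrow> nat \<Rightarrow>
     ('k alg \<times> 'g list \<Rightarrow> 'k list vec) \<Rightarrow> ('k alg \<times> 'g list \<Rightarrow> 'k list vec)" where
  "coboundary K G V i f =
    (\<lambda>(A, gs)\<in>group_tuples K G (Suc i). vec (rep_dim V) (\<lambda>p.
       apply_mat A (rep_mat V A (hd gs)) (f (A, tl gs)) $ p
       \<oplus>\<^bsub>A\<^esub> (\<Oplus>\<^bsub>A\<^esub>j\<in>{..<i}. [((- 1 :: int) ^ Suc j)] \<cdot>\<^bsub>A\<^esub> (f (A, merge_at (points G A) j gs) $ p))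
       \<oplus>\<^bsub>A\<^esub> [((- 1 :: int) ^ Suc i)] \<cdot>\<^bsub>A\<^esub> (f (A, butlast gs) $ p)))"

definition cocycles ::
    "('k, 'b) ring_scheme \<Rightarrow> ('k, 'g) group_functor \<Rightarrow> ('k, 'g) group_rep \<Rightarrow> nat \<Rightarrow>
     ('k alg \<times> 'g list \<Rightarrow> 'k list vec) set" where
  "cocycles K G V i =
    kernel (cochain_group K G V i) (cochain_group K G V (Suc i)) (coboundary K G V i)"

definition coboundaries ::
    "('k, 'b) ring_scheme \<Rightarrow> ('k, 'g) group_functor \<Rightarrow> ('k, 'g) group_rep \<Rightarrow> nat \<Rightarrow>
     ('k alg \<times> 'g list \<Rightarrow> 'k list vec) set" where
  "coboundaries K G V i =
    (case i of 0 \<Rightarrow> {\<one>\<^bsub>cochain_group K G V 0\<^esub>}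
     | Suc j \<Rightarrow> coboundary K G V j ` cochains K G V j)"

definition hochschild_cohomology ::
    "('k, 'b) ring_scheme \<Rightarrow> ('k, 'g) group_functor \<Rightarrow> ('k, 'g) group_rep \<Rightarrow> nat \<Rightarrow>
     ('k alg \<times> 'g list \<Rightarrow> 'k list vec) set monoid" where
  "hochschild_cohomology K G V i =
    (cochain_group K G V i)\<lparr>carrier := cocycles K G V i\<rparr> Mod coboundaries K G V i"

section \<open>Products of general linear groups\<close>

definition GL_product :: "nat \<Rightarrow> (nat \<Rightarrow> nat) \<Rightarrow> ('k, nat \<Rightarrow> 'k list mat) group_functor" where
  "GL_product n d =
    \<lparr>points = (\<lambda>A. product_group {..<n} (\<lambda>j. GL A (d j))),
     base_change = (\<lambda>h g. \<lambda>j\<in>{..<n}. map_mat h (g j))\<rparr>"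

definition monomial_rep ::
    "nat \<Rightarrow> (nat \<Rightarrow> nat) \<Rightarrow> 'k vb_functor \<Rightarrow> ('k, nat \<Rightarrow> 'k list mat) group_rep" where
  "monomial_rep n d E =
    \<lparr>rep_dim = vb_rank E (map d [0..<n]),
     rep_mat = (\<lambda>A g. vb_iso E A (map g [0..<n]))\<rparr>"

end

theory Submission
  imports Defs
begin

text \<open>
  A central copy of the multiplicative group acts on the representation through a nonzero weight, and
  a central element cannot act nontrivially on the cohomology of a group.

  In detail, let \<open>z\<close> be a central element of a group acting on \<open>M\<close>, and for a cochain \<open>f\<close> let \<open>s\<^sub>z f\<close> be
  the alternating sum of the values of \<open>f\<close> with \<open>z\<close> inserted at all places.  Then
  \<open>s\<^sub>z \<partial> + \<partial> s\<^sub>z = z - 1\<close> (\<open>insert_sum_homotopy\<close>), so that \<open>z f - f = \<partial> s\<^sub>z f\<close> if \<open>f\<close> is a cocycle.  Now fix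
  \<open>j\<close> with \<open>a\<^sub>j \<noteq> 0\<close>.  Given a cocycle \<open>f\<close> of the group functor and an algebra \<open>A\<close>, apply this over the
  group algebra \<open>A[x]/(x\<^sup>N - 1)\<close>, \<open>N = \<bar>a\<^sub>j\<bar> + 1\<close>, to the central element \<open>z\<close> given by the scalar \<open>x\<close> (or
  \<open>x\<^bsup>-1\<^esup>\<close> if \<open>a\<^sub>j < 0\<close>) in the \<open>j\<close>-th general linear group.  By homogeneity \<open>z\<close> acts as
  multiplication by \<open>x\<^bsup>\<bar>a\<^sub>j\<bar>\<^esup>\<close>, which is different from \<open>1\<close> by the choice of \<open>N\<close>.  Hence, on tuples of
  elements of \<open>G(A)\<close>, where \<open>f\<close> has values in \<open>A\<^sup>D\<close>, the constant coefficient of \<open>z f - f\<close> is \<open>-f\<close>.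
  Taking constant coefficients is \<open>A\<close>-linear and therefore commutes with \<open>\<partial>\<close> on these tuples, so \<open>f\<close>
  is the coboundary of minus the constant coefficient of \<open>s\<^sub>z f\<close> (\<open>bar_cob_homotopy_at\<close>), which again is
  natural in \<open>A\<close>.  In degree \<open>0\<close> the same computation gives \<open>f = 0\<close>.  The generic element of the
  multiplicative group, that is the Laurent polynomial ring, would do as well; the finite cyclic group
  makes for simpler coefficient sums.

  Two things have to be supplied.  The group algebra has to be found among the algebras with
  carriers in \<open>'k list\<close>; this is done by coding lists of lists as lists.  And \<open>E(V\<^sub>1, \<dots>, V\<^sub>n)\<close> has to be
  a representation of \<open>G\<close> in the first place, which is needed both for \<open>\<partial>\<^sup>2 = 0\<close> and for the
  naturality of coboundaries.  This is \<open>monomial_expression_functorial\<close>, an induction on monomial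
  expressions.  The matrices of symmetric, divided and exterior powers are multiplicative because
  tensor powers are: products of matrix entries are summed over all index sequences, and these
  sums are regrouped along the orbits of the symmetric group.
\<close>

notation matrix_monoid (\<open>Mat\<close>)

(* Ideal products share their notation with the integer multiples [k] \<cdot> x. *)
no_notation ideal_prod (infixl \<open>\<cdot>\<index>\<close> 80)

section \<open>Finite sums in abelian monoids\<close>

context abelian_monoid
begin

lemma finsum_commute:
  assumes "finite S" "finite T" "\<And>s t. s \<in> S \<Longrightarrow> t \<in> T \<Longrightarrow> f s t \<in> carrier G"
  shows "(\<Oplus>s\<in>S. \<Oplus>t\<in>T. f s t) = (\<Oplus>t\<in>T. \<Oplus>s\<in>S. f s t)"
  using assms(1,3)
proof (induction S rule: finite_induct)
  case (insert x S)
  have "(\<Oplus>s\<in>insert x S. \<Oplus>t\<in>T. f s t) = (\<Oplus>t\<in>T. f x t) \<oplus> (\<Oplus>t\<in>T. \<Oplus>s\<in>S. f s t)"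
    using insert by (subst finsum_insert) (auto intro!: finsum_closed)
  also have "\<dots> = (\<Oplus>t\<in>T. f x t \<oplus> (\<Oplus>s\<in>S. f s t))"
    using insert by (subst finsum_addf) (auto intro!: finsum_closed)
  also have "\<dots> = (\<Oplus>t\<in>T. \<Oplus>s\<in>insert x S. f s t)"
    using insert by (intro finsum_cong') (auto intro!: finsum_closed)
  finally show ?case .
qed simp

lemma finsum_fibres:
  assumes "finite S" "finite T" "p ` S \<subseteq> T" "\<And>s. s \<in> S \<Longrightarrow> f s \<in> carrier G"
  shows "(\<Oplus>t\<in>T. \<Oplus>s\<in>{s \<in> S. p s = t}. f s) = (\<Oplus>s\<in>S. f s)"
proof -
  have "S = (\<Union>t\<in>T. {s \<in> S. p s = t})"
    using assms(3) by auto
  moreover have "finsum G f (\<Union>t\<in>T. {s \<in> S. p s = t}) = (\<Oplus>t\<in>T. \<Oplus>s\<in>{s \<in> S. p s = t}. f s)"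
    using assms by (intro add.finprod_UN_disjoint) (auto simp: pairwise_def disjnt_def)
  ultimately show ?thesis
    by simp
qed

lemma finsum_cartesian:
  assumes "finite S" "finite T" "\<And>s t. s \<in> S \<Longrightarrow> t \<in> T \<Longrightarrow> f s t \<in> carrier G"
  shows "(\<Oplus>x\<in>S \<times> T. f (fst x) (snd x)) = (\<Oplus>s\<in>S. \<Oplus>t\<in>T. f s t)"
proof -
  have "(\<Oplus>x\<in>S \<times> T. f (fst x) (snd x)) = (\<Oplus>s\<in>S. \<Oplus>x\<in>{x \<in> S \<times> T. fst x = s}. f (fst x) (snd x))"
    using assms by (intro finsum_fibres[symmetric]) auto
  also have "\<dots> = (\<Oplus>s\<in>S. \<Oplus>t\<in>T. f s t)"
  proof (intro finsum_cong' refl)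
    fix s assume s: "s \<in> S"
    have "{x \<in> S \<times> T. fst x = s} = Pair s ` T"
      using s by auto
    thus "(\<Oplus>x\<in>{x \<in> S \<times> T. fst x = s}. f (fst x) (snd x)) = (\<Oplus>t\<in>T. f s t)"
      using s assms by (simp, subst finsum_reindex) (auto simp: inj_on_def)
  qed (use assms in \<open>auto intro!: finsum_closed\<close>)
  finally show ?thesis .
qed

lemma finsum_reindex_bij:
  assumes "bij_betw p S T" "\<And>t. t \<in> T \<Longrightarrow> f t \<in> carrier G"
  shows "(\<Oplus>s\<in>S. f (p s)) = (\<Oplus>t\<in>T. f t)"
  using assms finsum_reindex[of f p S] by (auto simp: bij_betw_def)

lemma finsum_delta:
  assumes "finite S" "i \<in> S" "f i \<in> carrier G"
  shows "(\<Oplus>s\<in>S. if s = i then f s else \<zero>) = f i"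
  using assms finsum_insert[of "S - {i}" i "\<lambda>s. if s = i then f s else \<zero>"]
    add.finprod_one_eqI[of "S - {i}" "\<lambda>s. if s = i then f s else \<zero>"]
  by (simp add: insert_absorb)

lemma finsum_eq_single:
  assumes "finite S" "i \<in> S" "f i \<in> carrier G" "\<And>s. s \<in> S \<Longrightarrow> s \<noteq> i \<Longrightarrow> f s = \<zero>"
  shows "(\<Oplus>s\<in>S. f s) = f i"
proof -
  have "(\<Oplus>s\<in>S. f s) = (\<Oplus>s\<in>S. if s = i then f s else \<zero>)"
    using assms by (intro finsum_cong') auto
  thus ?thesis
    using finsum_delta[of S i f, OF assms(1-3)] by simp
qed

end

section \<open>Monoids of matrices and the general linear group\<close>

lemma elements_mat_subset_iff:
  "elements_mat g \<subseteq> S \<longleftrightarrow> (\<forall>i<dim_row g. \<forall>j<dim_col g. g $$ (i, j) \<in> S)"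
  by (auto simp: elements_mat_def) (metis UN_I atLeast0LessThan image_eqI lessThan_iff subset_iff)

lemma carrier_matrix_monoid_iff:
  "g \<in> carrier (Mat A d) \<longleftrightarrow>
    dim_row g = d \<and> dim_col g = d \<and> (\<forall>i<d. \<forall>j<d. g $$ (i, j) \<in> carrier A)"
  by (auto simp: matrix_monoid_def elements_mat_subset_iff)

lemma dim_matrix_monoid_mult [simp]:
  "dim_row (g \<otimes>\<^bsub>Mat A d\<^esub> h) = d" "dim_col (g \<otimes>\<^bsub>Mat A d\<^esub> h) = d"
  by (simp_all add: matrix_monoid_def)

lemma index_matrix_monoid_mult:
  "i < d \<Longrightarrow> j < d \<Longrightarrow>
    (g \<otimes>\<^bsub>Mat A d\<^esub> h) $$ (i, j) = (\<Oplus>\<^bsub>A\<^esub>l\<in>{..<d}. g $$ (i, l) \<otimes>\<^bsub>A\<^esub> h $$ (l, j))"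
  by (simp add: matrix_monoid_def)

lemma dim_matrix_monoid_one [simp]:
  "dim_row \<one>\<^bsub>Mat A d\<^esub> = d" "dim_col \<one>\<^bsub>Mat A d\<^esub> = d"
  by (simp_all add: matrix_monoid_def)

lemma index_matrix_monoid_one:
  "i < d \<Longrightarrow> j < d \<Longrightarrow> \<one>\<^bsub>Mat A d\<^esub> $$ (i, j) = (if i = j then \<one>\<^bsub>A\<^esub> else \<zero>\<^bsub>A\<^esub>)"
  by (simp add: matrix_monoid_def)

context cring
begin

lemma matrix_monoid_mult_closed:
  assumes "g \<in> carrier (Mat R d)" "h \<in> carrier (Mat R d)"
  shows "g \<otimes>\<^bsub>Mat R d\<^esub> h \<in> carrier (Mat R d)"
  using assms by (auto simp: carrier_matrix_monoid_iff index_matrix_monoid_mult intro!: finsum_closed)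

lemma matrix_monoid_monoid: "Group.monoid (Mat R d)"
proof (rule monoidI)
  fix f g h
  assume f: "f \<in> carrier (Mat R d)" and g: "g \<in> carrier (Mat R d)"
    and h: "h \<in> carrier (Mat R d)"
  note fgh = f[unfolded carrier_matrix_monoid_iff] g[unfolded carrier_matrix_monoid_iff]
    h[unfolded carrier_matrix_monoid_iff]
  let ?m = "Mat R d"
  show "f \<otimes>\<^bsub>?m\<^esub> g \<otimes>\<^bsub>?m\<^esub> h = f \<otimes>\<^bsub>?m\<^esub> (g \<otimes>\<^bsub>?m\<^esub> h)"
  proof (rule eq_matI)
    fix i j assume "i < dim_row (f \<otimes>\<^bsub>?m\<^esub> (g \<otimes>\<^bsub>?m\<^esub> h))" "j < dim_col (f \<otimes>\<^bsub>?m\<^esub> (g \<otimes>\<^bsub>?m\<^esub> h))"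
    hence ij: "i < d" "j < d" by auto
    have "(f \<otimes>\<^bsub>?m\<^esub> g \<otimes>\<^bsub>?m\<^esub> h) $$ (i, j)
        = (\<Oplus>l\<in>{..<d}. \<Oplus>k\<in>{..<d}. f $$ (i, k) \<otimes> g $$ (k, l) \<otimes> h $$ (l, j))"
      using ij fgh by (simp add: index_matrix_monoid_mult cong: finsum_cong)
        (intro finsum_cong' refl, auto simp: finsum_ldistr Pi_def)
    also have "\<dots> = (\<Oplus>k\<in>{..<d}. \<Oplus>l\<in>{..<d}. f $$ (i, k) \<otimes> g $$ (k, l) \<otimes> h $$ (l, j))"
      using ij fgh by (intro finsum_commute) auto
    also have "\<dots> = (f \<otimes>\<^bsub>?m\<^esub> (g \<otimes>\<^bsub>?m\<^esub> h)) $$ (i, j)"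
      using ij fgh by (simp add: index_matrix_monoid_mult cong: finsum_cong)
        (intro finsum_cong' refl, auto simp: finsum_rdistr Pi_def m_assoc intro!: finsum_cong')
    finally show "(f \<otimes>\<^bsub>?m\<^esub> g \<otimes>\<^bsub>?m\<^esub> h) $$ (i, j) = (f \<otimes>\<^bsub>?m\<^esub> (g \<otimes>\<^bsub>?m\<^esub> h)) $$ (i, j)" .
  qed auto
next
  fix g assume g: "g \<in> carrier (Mat R d)"
  note g' = g[unfolded carrier_matrix_monoid_iff]
  let ?m = "Mat R d"
  show "\<one>\<^bsub>?m\<^esub> \<otimes>\<^bsub>?m\<^esub> g = g"
  proof (rule eq_matI)
    fix i j assume "i < dim_row g" "j < dim_col g"
    hence ij: "i < d" "j < d" using g' by auto
    have "(\<one>\<^bsub>?m\<^esub> \<otimes>\<^bsub>?m\<^esub> g) $$ (i, j) = \<one>\<^bsub>?m\<^esub> $$ (i, i) \<otimes> g $$ (i, j)"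
      unfolding index_matrix_monoid_mult[OF ij]
      using ij g' by (intro finsum_eq_single) (auto simp: index_matrix_monoid_one)
    thus "(\<one>\<^bsub>?m\<^esub> \<otimes>\<^bsub>?m\<^esub> g) $$ (i, j) = g $$ (i, j)"
      using ij g' by (simp add: index_matrix_monoid_one)
  qed (use g' in auto)
  show "g \<otimes>\<^bsub>?m\<^esub> \<one>\<^bsub>?m\<^esub> = g"
  proof (rule eq_matI)
    fix i j assume "i < dim_row g" "j < dim_col g"
    hence ij: "i < d" "j < d" using g' by auto
    have "(g \<otimes>\<^bsub>?m\<^esub> \<one>\<^bsub>?m\<^esub>) $$ (i, j) = g $$ (i, j) \<otimes> \<one>\<^bsub>?m\<^esub> $$ (j, j)"
      unfolding index_matrix_monoid_mult[OF ij]
      using ij g' by (intro finsum_eq_single) (auto simp: index_matrix_monoid_one)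
    thus "(g \<otimes>\<^bsub>?m\<^esub> \<one>\<^bsub>?m\<^esub>) $$ (i, j) = g $$ (i, j)"
      using ij g' by (simp add: index_matrix_monoid_one)
  qed (use g' in auto)
qed (auto simp: carrier_matrix_monoid_iff index_matrix_monoid_mult index_matrix_monoid_one intro!: finsum_closed)

lemma GL_group: "Group.group (GL R d)"
  unfolding GL_def by (rule Group.monoid.units_group[OF matrix_monoid_monoid])

lemma matrix_monoid_one_closed: "\<one>\<^bsub>Mat R d\<^esub> \<in> carrier (Mat R d)"
  by (auto simp: carrier_matrix_monoid_iff index_matrix_monoid_one)

lemma transpose_mat_closed:
  "g \<in> carrier (Mat R d) \<Longrightarrow> transpose_mat g \<in> carrier (Mat R d)"
  by (auto simp: carrier_matrix_monoid_iff)

lemma transpose_mat_one: "transpose_mat \<one>\<^bsub>Mat R d\<^esub> = \<one>\<^bsub>Mat R d\<^esub>"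
  by (rule eq_matI) (auto simp: index_matrix_monoid_one)

lemma transpose_mat_mult:
  assumes "g \<in> carrier (Mat R d)" "h \<in> carrier (Mat R d)"
  shows "transpose_mat (g \<otimes>\<^bsub>Mat R d\<^esub> h)
    = transpose_mat h \<otimes>\<^bsub>Mat R d\<^esub> transpose_mat g"
proof (rule eq_matI)
  note gh = assms[unfolded carrier_matrix_monoid_iff]
  fix i j
  assume "i < dim_row (transpose_mat h \<otimes>\<^bsub>Mat R d\<^esub> transpose_mat g)"
    "j < dim_col (transpose_mat h \<otimes>\<^bsub>Mat R d\<^esub> transpose_mat g)"
  hence ij: "i < d" "j < d" by auto
  show "transpose_mat (g \<otimes>\<^bsub>Mat R d\<^esub> h) $$ (i, j)
    = (transpose_mat h \<otimes>\<^bsub>Mat R d\<^esub> transpose_mat g) $$ (i, j)"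
    using ij gh by (simp add: index_matrix_monoid_mult) (intro finsum_cong' refl, auto simp: m_comm)
qed auto

end

lemma GL_mult: "(\<otimes>\<^bsub>GL A d\<^esub>) = (\<otimes>\<^bsub>Mat A d\<^esub>)"
  and GL_one: "\<one>\<^bsub>GL A d\<^esub> = \<one>\<^bsub>Mat A d\<^esub>"
  and carrier_GL: "carrier (GL A d) = Units (Mat A d)"
  by (simp_all add: GL_def units_of_def)

lemma GL_subset_matrix_monoid: "g \<in> carrier (GL A d) \<Longrightarrow> g \<in> carrier (Mat A d)"
  by (auto simp: carrier_GL Units_def)

lemma dim_GL: "g \<in> carrier (GL A d) \<Longrightarrow> dim_row g = d" "g \<in> carrier (GL A d) \<Longrightarrow> dim_col g = d"
  by (auto dest!: GL_subset_matrix_monoid simp: carrier_matrix_monoid_iff)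

lemma index_GL_closed:
  "g \<in> carrier (GL A d) \<Longrightarrow> i < d \<Longrightarrow> j < d \<Longrightarrow> g $$ (i, j) \<in> carrier A"
  by (auto dest!: GL_subset_matrix_monoid simp: carrier_matrix_monoid_iff)

text \<open>
  By this, homomorphisms between general linear groups may be obtained from computations with
  arbitrary square matrices.
\<close>

lemma monoid_hom_Units:
  assumes "\<phi> \<in> hom M N" "\<phi> \<one>\<^bsub>M\<^esub> = \<one>\<^bsub>N\<^esub>" "g \<in> Units M"
  shows "\<phi> g \<in> Units N"
  using assms unfolding Units_def hom_def by (clarsimp simp: Pi_iff) (metis)

lemma hom_units_of:
  assumes "\<phi> \<in> hom M N" "\<phi> \<one>\<^bsub>M\<^esub> = \<one>\<^bsub>N\<^esub>"
  shows "\<phi> \<in> hom (units_of M) (units_of N)"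
  using assms monoid_hom_Units[OF assms]
  by (auto simp: hom_def units_of_def Units_def)

section \<open>Base change of matrices\<close>

context ring_hom_cring
begin

lemma map_mat_hom_matrix_monoid:
  "map_mat h \<in> hom (Mat R d) (Mat S d)"
proof (rule homI)
  fix g g' assume g: "g \<in> carrier (Mat R d)" "g' \<in> carrier (Mat R d)"
  note g' = g[unfolded carrier_matrix_monoid_iff]
  show "map_mat h (g \<otimes>\<^bsub>Mat R d\<^esub> g') = map_mat h g \<otimes>\<^bsub>Mat S d\<^esub> map_mat h g'"
  proof (rule eq_matI)
    fix i j
    assume "i < dim_row (map_mat h g \<otimes>\<^bsub>Mat S d\<^esub> map_mat h g')"
      "j < dim_col (map_mat h g \<otimes>\<^bsub>Mat S d\<^esub> map_mat h g')"
    hence ij: "i < d" "j < d" by auto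
    show "map_mat h (g \<otimes>\<^bsub>Mat R d\<^esub> g') $$ (i, j)
      = (map_mat h g \<otimes>\<^bsub>Mat S d\<^esub> map_mat h g') $$ (i, j)"
      using ij g' by (simp add: index_matrix_monoid_mult Pi_def) (intro S.finsum_cong' refl, auto)
  qed auto
qed (auto simp: carrier_matrix_monoid_iff)

lemma map_mat_matrix_monoid_one:
  "map_mat h \<one>\<^bsub>Mat R d\<^esub> = \<one>\<^bsub>Mat S d\<^esub>"
  by (rule eq_matI) (auto simp: index_matrix_monoid_one)

lemma map_mat_hom_GL: "map_mat h \<in> hom (GL R d) (GL S d)"
  unfolding GL_def
  by (rule hom_units_of[OF map_mat_hom_matrix_monoid map_mat_matrix_monoid_one])

lemma map_mat_GL_inv:
  assumes "g \<in> carrier (GL R d)"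
  shows "map_mat h (inv\<^bsub>GL R d\<^esub> g) = inv\<^bsub>GL S d\<^esub> (map_mat h g)"
proof -
  interpret group_hom "GL R d" "GL S d" "map_mat h"
    by (intro group_hom.intro group_hom_axioms.intro R.GL_group S.GL_group map_mat_hom_GL)
  show ?thesis
    using assms by simp
qed

end

section \<open>Matrices with respect to a list of basis elements\<close>

definition basis_mat :: "'b list \<Rightarrow> ('b \<Rightarrow> 'b \<Rightarrow> 'a) \<Rightarrow> 'a mat" where
  "basis_mat b F = mat (length b) (length b) (\<lambda>(p, q). F (b ! p) (b ! q))"

lemma dim_basis_mat [simp]: "dim_row (basis_mat b F) = length b" "dim_col (basis_mat b F) = length b"
  by (simp_all add: basis_mat_def)

lemma index_basis_mat [simp]:
  "p < length b \<Longrightarrow> q < length b \<Longrightarrow> basis_mat b F $$ (p, q) = F (b ! p) (b ! q)"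
  by (simp add: basis_mat_def)

lemma basis_mat_cong:
  "(\<And>x y. x \<in> set b \<Longrightarrow> y \<in> set b \<Longrightarrow> F x y = G x y) \<Longrightarrow> basis_mat b F = basis_mat b G"
  by (intro eq_matI) auto

lemma transpose_basis_mat: "transpose_mat (basis_mat b F) = basis_mat b (\<lambda>x y. F y x)"
  by (intro eq_matI) auto

lemma map_basis_mat: "map_mat h (basis_mat b F) = basis_mat b (\<lambda>x y. h (F x y))"
  by (intro eq_matI) auto

context cring
begin

lemma basis_mat_closed:
  assumes "\<And>x y. x \<in> set b \<Longrightarrow> y \<in> set b \<Longrightarrow> F x y \<in> carrier R"
  shows "basis_mat b F \<in> carrier (Mat R (length b))"
  using assms by (simp add: carrier_matrix_monoid_iff)

lemma basis_mat_mult: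
  assumes "distinct b"
    and F: "\<And>x y. x \<in> set b \<Longrightarrow> y \<in> set b \<Longrightarrow> F x y \<in> carrier R"
    and G: "\<And>x y. x \<in> set b \<Longrightarrow> y \<in> set b \<Longrightarrow> G x y \<in> carrier R"
  shows "basis_mat b F \<otimes>\<^bsub>Mat R (length b)\<^esub> basis_mat b G
    = basis_mat b (\<lambda>x z. \<Oplus>y\<in>set b. F x y \<otimes> G y z)"
proof (rule eq_matI)
  fix p q
  assume "p < dim_row (basis_mat b (\<lambda>x z. \<Oplus>y\<in>set b. F x y \<otimes> G y z))"
    "q < dim_col (basis_mat b (\<lambda>x z. \<Oplus>y\<in>set b. F x y \<otimes> G y z))"
  hence pq: "p < length b" "q < length b" by auto
  have "(basis_mat b F \<otimes>\<^bsub>Mat R (length b)\<^esub> basis_mat b G) $$ (p, q)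
      = (\<Oplus>r\<in>{..<length b}. F (b ! p) (b ! r) \<otimes> G (b ! r) (b ! q))"
    unfolding index_matrix_monoid_mult[OF pq] using pq F G by (intro finsum_cong') auto
  also have "\<dots> = (\<Oplus>y\<in>set b. F (b ! p) y \<otimes> G y (b ! q))"
    using pq F G assms(1) by (intro finsum_reindex_bij bij_betw_nth) auto
  finally show "(basis_mat b F \<otimes>\<^bsub>Mat R (length b)\<^esub> basis_mat b G) $$ (p, q)
      = basis_mat b (\<lambda>x z. \<Oplus>y\<in>set b. F x y \<otimes> G y z) $$ (p, q)"
    using pq by simp
qed auto

lemma basis_mat_one:
  assumes "distinct b"
  shows "basis_mat b (\<lambda>x y. if x = y then \<one> else \<zero>) = \<one>\<^bsub>Mat R (length b)\<^esub>"
  using assms by (intro eq_matI) (auto simp: index_matrix_monoid_one nth_eq_iff_index_eq)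

end

section \<open>Tensor powers of a matrix\<close>

lemma finite_index_seqs: "finite (index_seqs n N)"
  using finite_lists_length_eq[of "{..<N}" n] by (simp add: index_seqs_def conj_commute)

lemma index_seqs_0: "index_seqs 0 N = {[]}"
  by (auto simp: index_seqs_def)

lemma Cons_in_index_seqs_iff: "a # s \<in> index_seqs (Suc n) N \<longleftrightarrow> a < N \<and> s \<in> index_seqs n N"
  by (auto simp: index_seqs_def)

lemma index_seqs_Suc:
  "bij_betw (\<lambda>x. fst x # snd x) ({..<N} \<times> index_seqs n N) (index_seqs (Suc n) N)"
  unfolding bij_betw_def inj_on_def
  by (auto simp: image_iff index_seqs_def length_Suc_conv)

lemma nth_index_seqs: "s \<in> index_seqs n N \<Longrightarrow> l < n \<Longrightarrow> s ! l < N"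
  by (auto simp: index_seqs_def subset_iff)

lemma length_index_seqs: "s \<in> index_seqs n N \<Longrightarrow> length s = n"
  by (simp add: index_seqs_def)

lemma permute_list_in_index_seqs_iff:
  assumes "\<pi> permutes {..<n}"
  shows "permute_list \<pi> s \<in> index_seqs n N \<longleftrightarrow> s \<in> index_seqs n N"
  using assms by (auto simp: index_seqs_def)

lemma bij_betw_permute_list:
  assumes "\<pi> permutes {..<n}"
  shows "bij_betw (permute_list \<pi>) (index_seqs n N) (index_seqs n N)"
proof (rule bij_betw_byWitness[where f' = "permute_list (inv_into UNIV \<pi>)"])
  have inv: "inv_into UNIV \<pi> permutes {..<n}"
    using assms by (rule permutes_inv)
  show "\<forall>s\<in>index_seqs n N. permute_list (inv_into UNIV \<pi>) (permute_list \<pi> s) = s"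
    using inv assms by (auto simp: length_index_seqs permutes_inv_o simp flip: permute_list_compose)
  show "\<forall>s\<in>index_seqs n N. permute_list \<pi> (permute_list (inv_into UNIV \<pi>) s) = s"
    using inv assms by (auto simp: length_index_seqs permutes_inv_o simp flip: permute_list_compose)
  show "permute_list \<pi> ` index_seqs n N \<subseteq> index_seqs n N"
    and "permute_list (inv_into UNIV \<pi>) ` index_seqs n N \<subseteq> index_seqs n N"
    using inv assms by (auto simp: permute_list_in_index_seqs_iff)
qed

context cring
begin

lemma tensor_power_entry_closed:
  assumes "g \<in> carrier (Mat R N)" "s \<in> index_seqs n N" "t \<in> index_seqs n N"
  shows "tensor_power_entry R n g s t \<in> carrier R"
  using assms unfolding tensor_power_entry_def carrier_matrix_monoid_iff
  by (intro finprod_closed) (auto simp: nth_index_seqs)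

lemma tensor_power_entry_0: "tensor_power_entry R 0 g s t = \<one>"
  by (simp add: tensor_power_entry_def)

lemma tensor_power_entry_Cons:
  assumes g: "g \<in> carrier (Mat R N)"
    and st: "a < N" "b < N" "s \<in> index_seqs n N" "t \<in> index_seqs n N"
  shows "tensor_power_entry R (Suc n) g (a # s) (b # t)
    = g $$ (a, b) \<otimes> tensor_power_entry R n g s t"
proof -
  have "tensor_power_entry R (Suc n) g (a # s) (b # t)
      = g $$ (a, b) \<otimes> (\<Otimes>l\<in>Suc ` {..<n}. g $$ ((a # s) ! l, (b # t) ! l))"
    unfolding tensor_power_entry_def lessThan_Suc_eq_insert_0
    using g st by (subst finprod_insert) (auto simp: carrier_matrix_monoid_iff nth_index_seqs)
  also have "(\<Otimes>l\<in>Suc ` {..<n}. g $$ ((a # s) ! l, (b # t) ! l)) = tensor_power_entry R n g s t"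
    unfolding tensor_power_entry_def
    using g st by (subst finprod_reindex) (auto simp: carrier_matrix_monoid_iff nth_index_seqs)
  finally show ?thesis .
qed

lemma finsum_mult_finsum:
  assumes "finite S" "finite T" "\<And>s. s \<in> S \<Longrightarrow> f s \<in> carrier R" "\<And>t. t \<in> T \<Longrightarrow> g t \<in> carrier R"
  shows "(\<Oplus>s\<in>S. f s) \<otimes> (\<Oplus>t\<in>T. g t) = (\<Oplus>s\<in>S. \<Oplus>t\<in>T. f s \<otimes> g t)"
proof -
  have "(\<Oplus>s\<in>S. f s) \<otimes> (\<Oplus>t\<in>T. g t) = (\<Oplus>s\<in>S. f s \<otimes> (\<Oplus>t\<in>T. g t))"
    using assms by (intro finsum_ldistr) (auto intro!: finsum_closed)
  also have "\<dots> = (\<Oplus>s\<in>S. \<Oplus>t\<in>T. f s \<otimes> g t)"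
    using assms by (intro finsum_cong' refl finsum_rdistr) (auto intro!: finsum_closed)
  finally show ?thesis .
qed

text \<open>
  A product of sums of products is the sum, over all choices of one summand in each factor, of the
  products of the chosen summands; the choices form the sequence \<open>u\<close>.
\<close>

lemma tensor_power_entry_mult:
  assumes g: "g \<in> carrier (Mat R N)" and h: "h \<in> carrier (Mat R N)"
    and "s \<in> index_seqs n N" "t \<in> index_seqs n N"
  shows "tensor_power_entry R n (g \<otimes>\<^bsub>Mat R N\<^esub> h) s t
    = (\<Oplus>u\<in>index_seqs n N. tensor_power_entry R n g s u \<otimes> tensor_power_entry R n h u t)"
  using assms(3,4)
proof (induction n arbitrary: s t)
  case 0
  show ?case
    by (simp add: tensor_power_entry_0 index_seqs_0)
next
  case (Suc n)
  obtain a s' b t' where st: "s = a # s'" "t = b # t'"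
    using Suc.prems by (auto simp: index_seqs_def length_Suc_conv)
  have ab: "a < N" "b < N" and s't': "s' \<in> index_seqs n N" "t' \<in> index_seqs n N"
    using Suc.prems by (auto simp: st Cons_in_index_seqs_iff)
  note [simp] = tensor_power_entry_closed[OF g] tensor_power_entry_closed[OF h] s't'
  have [simp]: "g $$ (i, j) \<in> carrier R" "h $$ (i, j) \<in> carrier R" if "i < N" "j < N" for i j
    using g h that by (auto simp: carrier_matrix_monoid_iff)
  let ?T = "tensor_power_entry R"
  have "?T (Suc n) (g \<otimes>\<^bsub>Mat R N\<^esub> h) s t
      = (\<Oplus>j\<in>{..<N}. g $$ (a, j) \<otimes> h $$ (j, b)) \<otimes> (\<Oplus>u\<in>index_seqs n N. ?T n g s' u \<otimes> ?T n h u t')"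
    using g h ab s't'
    by (simp add: st tensor_power_entry_Cons[OF matrix_monoid_mult_closed[OF g h]] Suc.IH
        index_matrix_monoid_mult)
  also have "\<dots> = (\<Oplus>j\<in>{..<N}. \<Oplus>u\<in>index_seqs n N.
      (g $$ (a, j) \<otimes> h $$ (j, b)) \<otimes> (?T n g s' u \<otimes> ?T n h u t'))"
    using ab by (intro finsum_mult_finsum) (auto simp: finite_index_seqs)
  also have "\<dots> = (\<Oplus>j\<in>{..<N}. \<Oplus>u\<in>index_seqs n N.
      ?T (Suc n) g s (j # u) \<otimes> ?T (Suc n) h (j # u) t)"
    using ab g h unfolding st
    by (intro finsum_cong' refl) (auto intro!: finsum_closed simp: tensor_power_entry_Cons[OF g] tensor_power_entry_Cons[OF h] m_ac)
  also have "\<dots> = (\<Oplus>x\<in>{..<N} \<times> index_seqs n N.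
      ?T (Suc n) g s (fst x # snd x) \<otimes> ?T (Suc n) h (fst x # snd x) t)"
    using Suc.prems
    by (intro finsum_cartesian[symmetric])
      (auto simp: finite_index_seqs Cons_in_index_seqs_iff)
  also have "\<dots> = (\<Oplus>u\<in>index_seqs (Suc n) N. ?T (Suc n) g s u \<otimes> ?T (Suc n) h u t)"
    using Suc.prems by (intro finsum_reindex_bij index_seqs_Suc) auto
  finally show ?case .
qed

lemma tensor_power_entry_one:
  assumes "s \<in> index_seqs n N" "t \<in> index_seqs n N"
  shows "tensor_power_entry R n \<one>\<^bsub>Mat R N\<^esub> s t = (if s = t then \<one> else \<zero>)"
  using assms
proof (induction n arbitrary: s t)
  case 0
  thus ?case
    by (simp add: tensor_power_entry_0 index_seqs_0)
next
  case (Suc n)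
  obtain a s' b t' where st: "s = a # s'" "t = b # t'"
    using Suc.prems by (auto simp: index_seqs_def length_Suc_conv)
  thus ?case
    using Suc by (auto simp: Cons_in_index_seqs_iff
        tensor_power_entry_Cons[OF matrix_monoid_one_closed] index_matrix_monoid_one)
qed

lemma tensor_power_entry_permute:
  assumes "g \<in> carrier (Mat R N)" "s \<in> index_seqs n N" "t \<in> index_seqs n N"
    and \<pi>: "\<pi> permutes {..<n}"
  shows "tensor_power_entry R n g (permute_list \<pi> s) (permute_list \<pi> t)
    = tensor_power_entry R n g s t"
proof -
  have "tensor_power_entry R n g (permute_list \<pi> s) (permute_list \<pi> t)
      = (\<Otimes>l\<in>{..<n}. g $$ (s ! \<pi> l, t ! \<pi> l))"
    unfolding tensor_power_entry_def using assms permutes_in_image[OF \<pi>]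
    by (intro finprod_cong' refl)
      (auto simp: permute_list_nth length_index_seqs carrier_matrix_monoid_iff nth_index_seqs)
  also have "\<dots> = (\<Otimes>l\<in>\<pi> ` {..<n}. g $$ (s ! l, t ! l))"
    using assms by (subst finprod_reindex)
      (auto simp: permutes_image[OF \<pi>] carrier_matrix_monoid_iff nth_index_seqs permutes_inj_on)
  also have "\<dots> = tensor_power_entry R n g s t"
    by (simp add: permutes_image[OF \<pi>] tensor_power_entry_def)
  finally show ?thesis .
qed

lemma tensor_power_entry_transpose:
  assumes "g \<in> carrier (Mat R N)" "s \<in> index_seqs n N" "t \<in> index_seqs n N"
  shows "tensor_power_entry R n (transpose_mat g) s t = tensor_power_entry R n g t s"
  using assms unfolding tensor_power_entry_def
  by (intro finprod_cong') (auto simp: carrier_matrix_monoid_iff nth_index_seqs)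

end

lemma (in ring_hom_cring) hom_tensor_power_entry:
  assumes "g \<in> carrier (Mat R N)" "s \<in> index_seqs n N" "t \<in> index_seqs n N"
  shows "h (tensor_power_entry R n g s t) = tensor_power_entry S n (map_mat h g) s t"
  using assms unfolding tensor_power_entry_def
  by (subst hom_finprod)
    (auto simp: carrier_matrix_monoid_iff nth_index_seqs intro!: S.finprod_cong')

section \<open>Symmetric and divided powers\<close>

lemma set_incr_seqs: "set (incr_seqs n N) = {s \<in> index_seqs n N. sorted s}"
  by (auto simp: incr_seqs_def index_seqs_def set_n_lists atLeast0LessThan)

lemma distinct_incr_seqs: "distinct (incr_seqs n N)"
  by (simp add: incr_seqs_def distinct_n_lists)

context cring
begin

text \<open>
  The coefficient of the monomial with weakly increasing index \<open>x\<close> in the product of the vectors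
  \<open>g e\<^bsub>t\<^sub>1\<^esub>, \<dots>, g e\<^bsub>t\<^sub>n\<^esub>\<close>, for an arbitrary, not necessarily increasing sequence \<open>t\<close>.
\<close>

definition sym_entry :: "nat \<Rightarrow> nat \<Rightarrow> 'a mat \<Rightarrow> nat list \<Rightarrow> nat list \<Rightarrow> 'a" where
  "sym_entry n N g x t = (\<Oplus>s\<in>{s \<in> index_seqs n N. sort s = x}. tensor_power_entry R n g s t)"

lemma sym_entry_closed:
  "g \<in> carrier (Mat R N) \<Longrightarrow> t \<in> index_seqs n N \<Longrightarrow> sym_entry n N g x t \<in> carrier R"
  unfolding sym_entry_def by (intro finsum_closed) (auto simp: tensor_power_entry_closed)

text \<open>
  Monomials do not depend on the order of their factors: a rearrangement of \<open>t\<close> is compensated by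
  the same rearrangement of the summation index \<open>s\<close>.
\<close>

lemma sym_entry_sort:
  assumes g: "g \<in> carrier (Mat R N)" and t: "t \<in> index_seqs n N"
  shows "sym_entry n N g x (sort t) = sym_entry n N g x t"
proof -
  obtain \<pi> where \<pi>: "\<pi> permutes {..<n}" "permute_list \<pi> t = sort t"
    using mset_eq_permutation[of "sort t" t] t by (auto simp: length_index_seqs)
  have sort_\<pi>: "sort (permute_list \<pi> s) = sort s" if "s \<in> index_seqs n N" for s
    using that \<pi>(1) by (intro properties_for_sort) (auto simp: length_index_seqs)
  have "bij_betw (permute_list \<pi>) {s \<in> index_seqs n N. sort s = x} {s \<in> index_seqs n N. sort s = x}"
    using bij_betw_permute_list[OF \<pi>(1), of N]
    by (rule bij_betw_Collect) (simp add: sort_\<pi>)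
  hence "sym_entry n N g x (sort t) = (\<Oplus>s\<in>{s \<in> index_seqs n N. sort s = x}.
      tensor_power_entry R n g (permute_list \<pi> s) (permute_list \<pi> t))"
    unfolding sym_entry_def \<pi>(2)[symmetric] using g t \<pi>(1)
    by (intro finsum_reindex_bij[symmetric])
      (auto simp: tensor_power_entry_closed permute_list_in_index_seqs_iff)
  also have "\<dots> = sym_entry n N g x t"
    unfolding sym_entry_def using g t \<pi>(1)
    by (intro finsum_cong') (auto simp: tensor_power_entry_permute tensor_power_entry_closed)
  finally show ?thesis .
qed

text \<open>
  The sum over all \<open>u\<close> in \<open>tensor_power_entry_mult\<close> is split into the fibres of sorting; the first
  factor is constant on each of them.
\<close>

lemma sym_entry_mult:
  assumes g: "g \<in> carrier (Mat R N)" and h: "h \<in> carrier (Mat R N)"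
    and t: "t \<in> index_seqs n N"
  shows "sym_entry n N (g \<otimes>\<^bsub>Mat R N\<^esub> h) x t
    = (\<Oplus>y\<in>set (incr_seqs n N). sym_entry n N g x y \<otimes> sym_entry n N h y t)"
proof -
  let ?I = "index_seqs n N" and ?T = "tensor_power_entry R n"
  note closed [simp] = tensor_power_entry_closed[OF g] tensor_power_entry_closed[OF h]
    sym_entry_closed[OF g] sym_entry_closed[OF h] finite_index_seqs t
  have "sym_entry n N (g \<otimes>\<^bsub>Mat R N\<^esub> h) x t
      = (\<Oplus>s\<in>{s \<in> ?I. sort s = x}. \<Oplus>u\<in>?I. ?T g s u \<otimes> ?T h u t)"
    unfolding sym_entry_def
    by (intro finsum_cong') (auto simp: tensor_power_entry_mult[OF g h] intro!: finsum_closed)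
  also have "\<dots> = (\<Oplus>u\<in>?I. \<Oplus>s\<in>{s \<in> ?I. sort s = x}. ?T g s u \<otimes> ?T h u t)"
    by (intro finsum_commute) auto
  also have "\<dots> = (\<Oplus>u\<in>?I. sym_entry n N g x u \<otimes> ?T h u t)"
    unfolding sym_entry_def
    by (intro finsum_cong' refl finsum_ldistr[symmetric]) (auto intro!: finsum_closed)
  also have "\<dots> = (\<Oplus>y\<in>set (incr_seqs n N). \<Oplus>u\<in>{u \<in> ?I. sort u = y}. sym_entry n N g x u \<otimes> ?T h u t)"
    by (intro finsum_fibres[symmetric]) (auto simp: set_incr_seqs, auto simp: index_seqs_def)
  also have "\<dots> = (\<Oplus>y\<in>set (incr_seqs n N). \<Oplus>u\<in>{u \<in> ?I. sort u = y}. sym_entry n N g x y \<otimes> ?T h u t)"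
    by (intro finsum_cong' refl)
      (auto simp: set_incr_seqs sym_entry_sort[OF g] intro!: finsum_closed)
  also have "\<dots> = (\<Oplus>y\<in>set (incr_seqs n N). sym_entry n N g x y \<otimes> sym_entry n N h y t)"
    unfolding sym_entry_def[of n N h]
    by (intro finsum_cong' refl finsum_rdistr[symmetric])
      (auto simp: set_incr_seqs intro!: finsum_closed)
  finally show ?thesis .
qed

lemma sym_mat_eq_basis_mat:
  "g \<in> carrier (Mat R N) \<Longrightarrow> sym_mat R n g = basis_mat (incr_seqs n N) (sym_entry n N g)"
  by (simp add: sym_mat_def basis_mat_def Let_def sym_entry_def carrier_matrix_monoid_iff)

lemma sym_mat_hom:
  "sym_mat R n \<in> hom (Mat R N) (Mat R (length (incr_seqs n N)))"
proof (rule homI)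
  fix g assume g: "g \<in> carrier (Mat R N)"
  thus "sym_mat R n g \<in> carrier (Mat R (length (incr_seqs n N)))"
    by (auto simp: sym_mat_eq_basis_mat set_incr_seqs intro!: basis_mat_closed sym_entry_closed)
next
  fix g h assume g: "g \<in> carrier (Mat R N)" and h: "h \<in> carrier (Mat R N)"
  let ?b = "incr_seqs n N"
  have "sym_mat R n g \<otimes>\<^bsub>Mat R (length ?b)\<^esub> sym_mat R n h
      = basis_mat ?b (\<lambda>x t. \<Oplus>y\<in>set ?b. sym_entry n N g x y \<otimes> sym_entry n N h y t)"
    unfolding sym_mat_eq_basis_mat[OF g] sym_mat_eq_basis_mat[OF h]
    by (intro basis_mat_mult distinct_incr_seqs sym_entry_closed[OF g] sym_entry_closed[OF h])
      (auto simp: set_incr_seqs)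
  also have "\<dots> = sym_mat R n (g \<otimes>\<^bsub>Mat R N\<^esub> h)"
    unfolding sym_mat_eq_basis_mat[OF matrix_monoid_mult_closed[OF g h]]
    by (intro basis_mat_cong) (auto simp: sym_entry_mult[OF g h] set_incr_seqs)
  finally show "sym_mat R n (g \<otimes>\<^bsub>Mat R N\<^esub> h)
      = sym_mat R n g \<otimes>\<^bsub>Mat R (length ?b)\<^esub> sym_mat R n h" ..
qed

lemma sym_mat_one:
  "sym_mat R n \<one>\<^bsub>Mat R N\<^esub> = \<one>\<^bsub>Mat R (length (incr_seqs n N))\<^esub>"
proof -
  let ?b = "incr_seqs n N"
  have "sym_entry n N \<one>\<^bsub>Mat R N\<^esub> x y = (if x = y then \<one> else \<zero>)"
    if "x \<in> set ?b" "y \<in> set ?b" for x y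
  proof -
    have xy: "x \<in> index_seqs n N" "sorted x" "y \<in> index_seqs n N" "sorted y"
      using that by (auto simp: set_incr_seqs)
    have "sym_entry n N \<one>\<^bsub>Mat R N\<^esub> x y
        = (\<Oplus>s\<in>{s \<in> index_seqs n N. sort s = x}. if s = y then \<one> else \<zero>)"
      unfolding sym_entry_def using xy by (intro finsum_cong') (auto simp: tensor_power_entry_one)
    also have "\<dots> = (if x = y then \<one> else \<zero>)"
    proof (cases "x = y")
      case True
      thus ?thesis
        using xy by (subst finsum_delta) (auto simp: finite_index_seqs sorted_sort_id)
    next
      case False
      hence "s \<noteq> y" if "sort s = x" for s
        using that xy by (metis sorted_sort_id)
      thus ?thesis
        using False by (intro trans[OF add.finprod_one_eqI]) auto
    qed
    finally show ?thesis .
  qed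
  thus ?thesis
    unfolding sym_mat_eq_basis_mat[OF matrix_monoid_one_closed]
    by (subst basis_mat_one[OF distinct_incr_seqs, symmetric]) (intro basis_mat_cong)
qed

text \<open>Divided powers are dual to symmetric powers: \<open>\<Gamma>\<^sup>n(V) = Sym\<^sup>n(V\<^sup>\<or>)\<^sup>\<or>\<close>.\<close>

lemma divided_power_mat_eq_transpose_sym_mat:
  assumes g: "g \<in> carrier (Mat R N)"
  shows "divided_power_mat R n g = transpose_mat (sym_mat R n (transpose_mat g))"
proof -
  have "divided_power_mat R n g = basis_mat (incr_seqs n N)
      (\<lambda>x y. \<Oplus>s\<in>{s \<in> index_seqs n N. sort s = y}. tensor_power_entry R n g x s)"
    using g by (simp add: divided_power_mat_def basis_mat_def Let_def carrier_matrix_monoid_iff)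
  also have "\<dots> = transpose_mat (sym_mat R n (transpose_mat g))"
    unfolding sym_mat_eq_basis_mat[OF transpose_mat_closed[OF g]] transpose_basis_mat sym_entry_def
    using g by (intro basis_mat_cong finsum_cong')
      (auto simp: tensor_power_entry_transpose tensor_power_entry_closed set_incr_seqs)
  finally show ?thesis .
qed

lemma divided_power_mat_hom:
  "divided_power_mat R n \<in> hom (Mat R N) (Mat R (length (incr_seqs n N)))"
proof (rule homI)
  fix g assume g: "g \<in> carrier (Mat R N)"
  show "divided_power_mat R n g \<in> carrier (Mat R (length (incr_seqs n N)))"
    using g sym_mat_hom[THEN hom_in_carrier] transpose_mat_closed
    by (simp add: divided_power_mat_eq_transpose_sym_mat)
next
  fix g h assume gh: "g \<in> carrier (Mat R N)" "h \<in> carrier (Mat R N)"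
  show "divided_power_mat R n (g \<otimes>\<^bsub>Mat R N\<^esub> h)
      = divided_power_mat R n g \<otimes>\<^bsub>Mat R (length (incr_seqs n N))\<^esub> divided_power_mat R n h"
    using gh hom_mult[OF sym_mat_hom, of "transpose_mat h" N "transpose_mat g" n]
      sym_mat_hom[THEN hom_in_carrier]
    by (simp add: divided_power_mat_eq_transpose_sym_mat[of _ N] matrix_monoid_mult_closed
        transpose_mat_mult transpose_mat_closed)
qed

lemma divided_power_mat_one:
  "divided_power_mat R n \<one>\<^bsub>Mat R N\<^esub> = \<one>\<^bsub>Mat R (length (incr_seqs n N))\<^esub>"
  by (simp add: divided_power_mat_eq_transpose_sym_mat[OF matrix_monoid_one_closed]
      transpose_mat_one sym_mat_one)

end

context ring_hom_cring
begin

lemma map_mat_sym_mat: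
  assumes g: "g \<in> carrier (Mat R N)"
  shows "map_mat h (sym_mat R n g) = sym_mat S n (map_mat h g)"
proof -
  have hg: "map_mat h g \<in> carrier (Mat S N)"
    using g map_mat_hom_matrix_monoid by (rule hom_in_carrier[rotated])
  have "h (R.sym_entry n N g x t) = S.sym_entry n N (map_mat h g) x t" if "t \<in> index_seqs n N" for x t
    unfolding R.sym_entry_def S.sym_entry_def using g hg that
    by (subst hom_finsum)
      (auto simp: hom_tensor_power_entry R.tensor_power_entry_closed S.tensor_power_entry_closed
        intro!: S.finsum_cong')
  thus ?thesis
    unfolding R.sym_mat_eq_basis_mat[OF g] S.sym_mat_eq_basis_mat[OF hg] map_basis_mat
    by (intro basis_mat_cong) (auto simp: set_incr_seqs)
qed

lemma map_mat_divided_power_mat: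
  assumes g: "g \<in> carrier (Mat R N)"
  shows "map_mat h (divided_power_mat R n g) = divided_power_mat S n (map_mat h g)"
proof -
  have "map_mat h g \<in> carrier (Mat S N)"
    using g map_mat_hom_matrix_monoid by (rule hom_in_carrier[rotated])
  thus ?thesis
    using g map_mat_sym_mat[OF R.transpose_mat_closed[OF g], of n]
    by (simp add: R.divided_power_mat_eq_transpose_sym_mat[of _ N]
        S.divided_power_mat_eq_transpose_sym_mat[of _ N] map_mat_transpose)
      (simp flip: map_mat_transpose)
qed

end

section \<open>Exterior powers\<close>

lemma set_strict_incr_seqs: "set (strict_incr_seqs n N) = {s \<in> index_seqs n N. sorted_wrt (<) s}"
  by (auto simp: strict_incr_seqs_def index_seqs_def set_n_lists atLeast0LessThan)

lemma distinct_strict_incr_seqs: "distinct (strict_incr_seqs n N)"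
  by (simp add: strict_incr_seqs_def distinct_n_lists)

lemma permute_list_eq_iff:
  assumes "distinct x" "\<pi> permutes {..<length x}" "\<rho> permutes {..<length x}"
  shows "permute_list \<pi> x = permute_list \<rho> x \<longleftrightarrow> \<pi> = \<rho>"
proof
  assume eq: "permute_list \<pi> x = permute_list \<rho> x"
  show "\<pi> = \<rho>"
  proof
    fix l
    show "\<pi> l = \<rho> l"
    proof (cases "l < length x")
      case True
      hence "x ! \<pi> l = x ! \<rho> l"
        using eq assms by (metis permute_list_nth)
      moreover have "\<pi> l < length x" "\<rho> l < length x"
        using True assms permutes_in_image by (metis lessThan_iff)+
      ultimately show ?thesis
        using assms(1) nth_eq_iff_index_eq by blast
    next
      case False
      thus ?thesis
        using assms by (metis lessThan_iff permutes_not_in)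
    qed
  qed
qed simp

text \<open>
  This bijection turns a sum over all sequences without repetitions into a sum over strictly
  increasing sequences and permutations, as required by the Cauchy-Binet formula.
\<close>

lemma bij_betw_distinct_index_seqs:
  "bij_betw (\<lambda>z. permute_list (snd z) (fst z))
    (set (strict_incr_seqs n N) \<times> {\<pi>. \<pi> permutes {..<n}}) {u \<in> index_seqs n N. distinct u}"
  unfolding bij_betw_def
proof
  show "inj_on (\<lambda>z. permute_list (snd z) (fst z))
      (set (strict_incr_seqs n N) \<times> {\<pi>. \<pi> permutes {..<n}})"
  proof (rule inj_onI)
    fix z w
    assume z: "z \<in> set (strict_incr_seqs n N) \<times> {\<pi>. \<pi> permutes {..<n}}"
      and w: "w \<in> set (strict_incr_seqs n N) \<times> {\<pi>. \<pi> permutes {..<n}}"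
      and eq: "permute_list (snd z) (fst z) = permute_list (snd w) (fst w)"
    obtain x \<pi> y \<rho> where zw: "z = (x, \<pi>)" "w = (y, \<rho>)" by (metis surj_pair)
    have x: "length x = n" "sorted x" "distinct x" and y: "length y = n" "sorted y" "distinct y"
      and \<pi>: "\<pi> permutes {..<n}" and \<rho>: "\<rho> permutes {..<n}"
      using z w by (auto simp: zw set_strict_incr_seqs strict_sorted_iff length_index_seqs)
    have "set (permute_list \<pi> x) = set x" "set (permute_list \<rho> y) = set y"
      using x \<pi> y \<rho> by (auto intro!: set_permute_list)
    hence "x = y"
      using eq x y by (intro sorted_distinct_set_unique) (auto simp: zw)
    thus "z = w"
      using eq permute_list_eq_iff[of x \<pi> \<rho>] x \<pi> \<rho> by (simp add: zw)
  qed
  show "(\<lambda>z. permute_list (snd z) (fst z)) `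
      (set (strict_incr_seqs n N) \<times> {\<pi>. \<pi> permutes {..<n}}) = {u \<in> index_seqs n N. distinct u}"
  proof (intro equalityI subsetI)
    fix u assume "u \<in> (\<lambda>z. permute_list (snd z) (fst z)) `
      (set (strict_incr_seqs n N) \<times> {\<pi>. \<pi> permutes {..<n}})"
    then obtain x \<pi> where "u = permute_list \<pi> x" "x \<in> index_seqs n N" "sorted_wrt (<) x"
      "\<pi> permutes {..<n}"
      by (auto simp: set_strict_incr_seqs)
    thus "u \<in> {u \<in> index_seqs n N. distinct u}"
      by (auto simp: permute_list_in_index_seqs_iff strict_sorted_iff length_index_seqs)
  next
    fix u assume "u \<in> {u \<in> index_seqs n N. distinct u}"
    hence u: "u \<in> index_seqs n N" "distinct u" "length u = n"
      by (auto simp: length_index_seqs)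
    obtain \<pi> where \<pi>: "\<pi> permutes {..<length (sort u)}" "permute_list \<pi> (sort u) = u"
      using mset_eq_permutation[of u "sort u"] by auto
    have "sort u \<in> set (strict_incr_seqs n N)"
      using u by (auto simp: set_strict_incr_seqs strict_sorted_iff index_seqs_def)
    thus "u \<in> (\<lambda>z. permute_list (snd z) (fst z)) `
      (set (strict_incr_seqs n N) \<times> {\<pi>. \<pi> permutes {..<n}})"
      using \<pi> u by (intro image_eqI[where x = "(sort u, \<pi>)"]) auto
  qed
qed

lemma bij_betw_compose_permutation:
  assumes "\<rho> permutes S"
  shows "bij_betw (\<lambda>\<pi>. \<pi> \<circ> \<rho>) {\<pi>. \<pi> permutes S} {\<pi>. \<pi> permutes S}"
proof (rule bij_betw_byWitness[where f' = "\<lambda>\<pi>. \<pi> \<circ> inv_into UNIV \<rho>"])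
  have inv: "inv_into UNIV \<rho> permutes S"
    using assms by (rule permutes_inv)
  show "\<forall>\<pi>\<in>{\<pi>. \<pi> permutes S}. \<pi> \<circ> \<rho> \<circ> inv_into UNIV \<rho> = \<pi>"
    "\<forall>\<pi>\<in>{\<pi>. \<pi> permutes S}. \<pi> \<circ> inv_into UNIV \<rho> \<circ> \<rho> = \<pi>"
    using assms by (auto simp: comp_assoc permutes_inv_o)
  show "(\<lambda>\<pi>. \<pi> \<circ> \<rho>) ` {\<pi>. \<pi> permutes S} \<subseteq> {\<pi>. \<pi> permutes S}"
    "(\<lambda>\<pi>. \<pi> \<circ> inv_into UNIV \<rho>) ` {\<pi>. \<pi> permutes S} \<subseteq> {\<pi>. \<pi> permutes S}"
    using assms inv by (auto intro: permutes_compose)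
qed

context cring
begin

lemma int_mult_closed: "x \<in> carrier R \<Longrightarrow> [(k::int)] \<cdot> x \<in> carrier R"
  by (rule add.int_pow_closed)

lemma int_mult_eq: "x \<in> carrier R \<Longrightarrow> [(k::int)] \<cdot> x = ([k] \<cdot> \<one>) \<otimes> x"
  by (simp add: add_pow_ldistr_int)

lemma int_mult_finsum:
  assumes "\<And>s. s \<in> S \<Longrightarrow> f s \<in> carrier R"
  shows "[(k::int)] \<cdot> (\<Oplus>s\<in>S. f s) = (\<Oplus>s\<in>S. [k] \<cdot> f s)"
proof (cases "finite S")
  case True
  have "[k] \<cdot> (\<Oplus>s\<in>S. f s) = (\<Oplus>s\<in>S. ([k] \<cdot> \<one>) \<otimes> f s)"
    using assms True
    by (subst int_mult_eq) (auto intro!: finsum_closed finsum_rdistr int_mult_closed)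
  also have "\<dots> = (\<Oplus>s\<in>S. [k] \<cdot> f s)"
    using assms by (intro finsum_cong') (auto simp: int_mult_closed int_mult_eq[symmetric])
  finally show ?thesis .
qed (simp add: add.int_pow_one)

lemma int_mult_int_mult: "x \<in> carrier R \<Longrightarrow> [(k::int)] \<cdot> ([(l::int)] \<cdot> x) = [(l * k)] \<cdot> x"
  by (rule add.int_pow_pow)

lemma one_int_mult: "x \<in> carrier R \<Longrightarrow> [(1::int)] \<cdot> x = x"
  by (rule add.int_pow_1)

lemma uminus_int_mult: "x \<in> carrier R \<Longrightarrow> [(- k :: int)] \<cdot> x = \<ominus> ([k] \<cdot> x)"
  by (rule add.int_pow_neg)

text \<open>
  The coefficient of \<open>e\<^sub>x\<close>, \<open>x\<close> strictly increasing, in \<open>g e\<^bsub>t\<^sub>1\<^esub> \<and> \<dots> \<and> g e\<^bsub>t\<^sub>n\<^esub>\<close> for an arbitrary sequence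
  \<open>t\<close>.
\<close>

definition alt_entry :: "nat \<Rightarrow> 'a mat \<Rightarrow> nat list \<Rightarrow> nat list \<Rightarrow> 'a" where
  "alt_entry n g x t =
    (\<Oplus>\<pi>\<in>{\<pi>. \<pi> permutes {..<n}}. [sign \<pi>] \<cdot> tensor_power_entry R n g (permute_list \<pi> x) t)"

lemma alt_summand_closed:
  assumes "g \<in> carrier (Mat R N)" "x \<in> index_seqs n N" "t \<in> index_seqs n N"
    "\<pi> permutes {..<n}"
  shows "[(k::int)] \<cdot> tensor_power_entry R n g (permute_list \<pi> x) t \<in> carrier R"
  using assms by (intro int_mult_closed tensor_power_entry_closed)
    (auto simp: permute_list_in_index_seqs_iff)

lemma alt_entry_closed:
  assumes "g \<in> carrier (Mat R N)" "x \<in> index_seqs n N" "t \<in> index_seqs n N"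
  shows "alt_entry n g x t \<in> carrier R"
  unfolding alt_entry_def using assms by (intro finsum_closed) (auto simp: alt_summand_closed)

text \<open>
  Rearranging both arguments of a tensor power entry by \<open>\<rho>\<close> leaves it unchanged, so that \<open>\<rho>\<close> may be
  moved from \<open>t\<close> to the summation index \<open>\<pi>\<close>, at the cost of its sign.
\<close>

lemma alt_entry_permute:
  assumes g: "g \<in> carrier (Mat R N)" and x: "x \<in> index_seqs n N"
    and t: "t \<in> index_seqs n N" and \<rho>: "\<rho> permutes {..<n}"
  shows "alt_entry n g x (permute_list \<rho> t) = [sign \<rho>] \<cdot> alt_entry n g x t"
proof -
  let ?P = "{\<pi>. \<pi> permutes {..<n}}" and ?T = "tensor_power_entry R n g"
  have \<rho>t: "permute_list \<rho> t \<in> index_seqs n N"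
    using t \<rho> by (simp add: permute_list_in_index_seqs_iff)
  have "alt_entry n g x (permute_list \<rho> t)
      = (\<Oplus>\<pi>\<in>?P. [sign (\<pi> \<circ> \<rho>)] \<cdot> ?T (permute_list (\<pi> \<circ> \<rho>) x) (permute_list \<rho> t))"
    unfolding alt_entry_def using g x \<rho>t
    by (intro finsum_reindex_bij[symmetric] bij_betw_compose_permutation \<rho>)
      (auto simp: alt_summand_closed)
  also have "\<dots> = (\<Oplus>\<pi>\<in>?P. [sign \<rho>] \<cdot> ([sign \<pi>] \<cdot> ?T (permute_list \<pi> x) t))"
  proof (intro finsum_cong' refl)
    fix \<pi> assume "\<pi> \<in> ?P"
    hence \<pi>: "\<pi> permutes {..<n}" by simp
    have \<pi>x: "permute_list \<pi> x \<in> index_seqs n N"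
      using x \<pi> by (simp add: permute_list_in_index_seqs_iff)
    have "permutation \<pi>" "permutation \<rho>"
      using \<pi> \<rho> by (auto intro: permutes_imp_permutation[of "{..<n}"])
    hence "sign (\<pi> \<circ> \<rho>) = sign \<pi> * sign \<rho>"
      by (rule sign_compose)
    moreover have "permute_list (\<pi> \<circ> \<rho>) x = permute_list \<rho> (permute_list \<pi> x)"
      using \<rho> x by (intro permute_list_compose) (simp add: length_index_seqs)
    ultimately show "[sign (\<pi> \<circ> \<rho>)] \<cdot> ?T (permute_list (\<pi> \<circ> \<rho>) x) (permute_list \<rho> t)
        = [sign \<rho>] \<cdot> ([sign \<pi>] \<cdot> ?T (permute_list \<pi> x) t)"
      using g \<pi>x t \<rho>
      by (simp add: int_mult_int_mult tensor_power_entry_permute tensor_power_entry_closed)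
  qed (use g x t in \<open>auto intro!: int_mult_closed[OF alt_summand_closed]\<close>)
  also have "\<dots> = [sign \<rho>] \<cdot> alt_entry n g x t"
    unfolding alt_entry_def using g x t
    by (intro int_mult_finsum[symmetric]) (auto simp: alt_summand_closed)
  finally show ?thesis .
qed

text \<open>
  In characteristic two the sign rule above does not suffice to see that the form is alternating;
  the summands cancel in pairs \<open>\<pi>, \<pi> \<circ> \<tau>\<close>, where the transposition \<open>\<tau>\<close> exchanges two equal members of
  \<open>t\<close>.
\<close>

lemma alt_entry_not_distinct:
  assumes g: "g \<in> carrier (Mat R N)" and x: "x \<in> index_seqs n N"
    and t: "t \<in> index_seqs n N" "\<not> distinct t"
  shows "alt_entry n g x t = \<zero>"
proof -
  let ?P = "{\<pi>. \<pi> permutes {..<n}}" and ?T = "tensor_power_entry R n g"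
  let ?E = "{\<pi> \<in> ?P. evenperm \<pi>}" and ?O = "{\<pi> \<in> ?P. \<not> evenperm \<pi>}"
  define F where "F \<pi> = [sign \<pi>] \<cdot> ?T (permute_list \<pi> x) t" for \<pi>
  obtain i j where ij: "i < n" "j < n" "i \<noteq> j" "t ! i = t ! j"
    using t by (auto simp: distinct_conv_nth length_index_seqs)
  define \<tau> where "\<tau> = transpose i j"
  have \<tau>: "\<tau> permutes {..<n}"
    using ij by (auto simp: \<tau>_def intro!: permutes_swap_id)
  have \<tau>t: "permute_list \<tau> t = t"
    using \<tau> ij t(1) by (intro nth_equalityI)
      (auto simp: permute_list_nth length_index_seqs \<tau>_def transpose_def)
  have F_closed: "F \<pi> \<in> carrier R" if "\<pi> \<in> ?P" for \<pi>
    using that g x t by (auto simp: F_def alt_summand_closed)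
  have perm: "permutation \<pi>" if "\<pi> \<in> ?P" for \<pi>
    using that by (auto intro: permutes_imp_permutation[of "{..<n}"])
  have odd_\<tau>: "\<not> evenperm \<tau>"
    using ij by (simp add: \<tau>_def evenperm_swap)
  have even_iff: "\<not> evenperm (\<pi> \<circ> \<tau>) \<longleftrightarrow> evenperm \<pi>" if "\<pi> \<in> ?P" for \<pi>
    using that perm[of \<pi>] perm[of \<tau>] \<tau> odd_\<tau> by (simp add: evenperm_comp)
  have F_\<tau>: "F (\<pi> \<circ> \<tau>) = \<ominus> F \<pi>" if "\<pi> \<in> ?P" for \<pi>
  proof -
    have \<pi>x: "permute_list \<pi> x \<in> index_seqs n N"
      using x that by (simp add: permute_list_in_index_seqs_iff)
    have "sign (\<pi> \<circ> \<tau>) = - sign \<pi>"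
      using even_iff[OF that] by (auto simp: sign_def)
    moreover have "?T (permute_list (\<pi> \<circ> \<tau>) x) t = ?T (permute_list \<pi> x) t"
    proof -
      have "?T (permute_list (\<pi> \<circ> \<tau>) x) t = ?T (permute_list \<tau> (permute_list \<pi> x)) (permute_list \<tau> t)"
        using \<tau> x by (subst permute_list_compose) (simp_all add: length_index_seqs \<tau>t)
      also have "\<dots> = ?T (permute_list \<pi> x) t"
        by (rule tensor_power_entry_permute[OF g \<pi>x t(1) \<tau>])
      finally show ?thesis .
    qed
    ultimately show ?thesis
      using g \<pi>x t by (simp add: F_def uminus_int_mult tensor_power_entry_closed)
  qed
  have fin: "finite ?P"
    by (simp add: finite_permutations)
  have "bij_betw (\<lambda>\<pi>. \<pi> \<circ> \<tau>) ?E ?O"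
    using bij_betw_compose_permutation[OF \<tau>] by (rule bij_betw_Collect) (simp add: even_iff)
  hence "(\<Oplus>\<pi>\<in>?O. F \<pi>) = (\<Oplus>\<pi>\<in>?E. F (\<pi> \<circ> \<tau>))"
    using F_closed by (intro finsum_reindex_bij[symmetric]) auto
  hence odd_sum: "(\<Oplus>\<pi>\<in>?O. F \<pi>) = (\<Oplus>\<pi>\<in>?E. \<ominus> F \<pi>)"
    using F_closed F_\<tau> by (auto intro!: finsum_cong' elim!: trans)
  have "alt_entry n g x t = (\<Oplus>\<pi>\<in>?P. F \<pi>)"
    by (simp add: alt_entry_def F_def)
  also have "?P = ?E \<union> ?O"
    by auto
  also have "(\<Oplus>\<pi>\<in>?E \<union> ?O. F \<pi>) = (\<Oplus>\<pi>\<in>?E. F \<pi>) \<oplus> (\<Oplus>\<pi>\<in>?O. F \<pi>)"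
    using fin F_closed by (intro finsum_Un_disjoint) auto
  also have "\<dots> = (\<Oplus>\<pi>\<in>?E. F \<pi> \<oplus> \<ominus> F \<pi>)"
    unfolding odd_sum using F_closed by (intro finsum_addf[symmetric]) auto
  also have "\<dots> = \<zero>"
    using F_closed by (intro add.finprod_one_eqI) (auto simp: r_neg)
  finally show ?thesis .
qed

text \<open>
  The Cauchy-Binet formula.  In the sum over all sequences \<open>u\<close> the first factor vanishes unless \<open>u\<close>
  is free of repetitions, and then \<open>u\<close> is a rearrangement of a unique strictly increasing \<open>y\<close>, whose
  sign passes to the second factor.
\<close>

lemma alt_entry_mult:
  assumes g: "g \<in> carrier (Mat R N)" and h: "h \<in> carrier (Mat R N)"
    and x: "x \<in> index_seqs n N" and t: "t \<in> index_seqs n N"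
  shows "alt_entry n (g \<otimes>\<^bsub>Mat R N\<^esub> h) x t
    = (\<Oplus>y\<in>set (strict_incr_seqs n N). alt_entry n g x y \<otimes> alt_entry n h y t)"
proof -
  let ?I = "index_seqs n N" and ?P = "{\<pi>. \<pi> permutes {..<n}}" and ?T = "tensor_power_entry R n"
  have fin: "finite ?P"
    by (simp add: finite_permutations)
  note closed [simp] = tensor_power_entry_closed[OF g] tensor_power_entry_closed[OF h]
    alt_entry_closed[OF g] alt_entry_closed[OF h] alt_summand_closed[OF g] alt_summand_closed[OF h]
    finite_index_seqs fin x t permute_list_in_index_seqs_iff int_mult_closed
  have "alt_entry n (g \<otimes>\<^bsub>Mat R N\<^esub> h) x t
      = (\<Oplus>\<pi>\<in>?P. \<Oplus>u\<in>?I. ([sign \<pi>] \<cdot> ?T g (permute_list \<pi> x) u) \<otimes> ?T h u t)"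
    unfolding alt_entry_def
    by (intro finsum_cong' refl)
      (auto simp: tensor_power_entry_mult[OF g h] int_mult_finsum
        intro!: finsum_closed finsum_cong' add_pow_ldistr_int[symmetric])
  also have "\<dots> = (\<Oplus>u\<in>?I. \<Oplus>\<pi>\<in>?P. ([sign \<pi>] \<cdot> ?T g (permute_list \<pi> x) u) \<otimes> ?T h u t)"
    by (intro finsum_commute) auto
  also have "\<dots> = (\<Oplus>u\<in>?I. alt_entry n g x u \<otimes> ?T h u t)"
    unfolding alt_entry_def
    by (intro finsum_cong' refl finsum_ldistr[symmetric]) (auto intro!: finsum_closed)
  also have "\<dots> = (\<Oplus>u\<in>{u \<in> ?I. distinct u}. alt_entry n g x u \<otimes> ?T h u t)"
    by (intro add.finprod_mono_neutral_cong_right) (auto simp: alt_entry_not_distinct[OF g])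
  also have "\<dots> = (\<Oplus>z\<in>set (strict_incr_seqs n N) \<times> ?P.
      alt_entry n g x (permute_list (snd z) (fst z)) \<otimes> ?T h (permute_list (snd z) (fst z)) t)"
    by (intro finsum_reindex_bij[symmetric] bij_betw_distinct_index_seqs) auto
  also have "\<dots> = (\<Oplus>y\<in>set (strict_incr_seqs n N). \<Oplus>\<rho>\<in>?P.
      alt_entry n g x (permute_list \<rho> y) \<otimes> ?T h (permute_list \<rho> y) t)"
    by (intro finsum_cartesian) (auto simp: set_strict_incr_seqs)
  also have "\<dots> = (\<Oplus>y\<in>set (strict_incr_seqs n N). \<Oplus>\<rho>\<in>?P.
      alt_entry n g x y \<otimes> ([sign \<rho>] \<cdot> ?T h (permute_list \<rho> y) t))"
    by (intro finsum_cong' refl)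
      (auto simp: set_strict_incr_seqs alt_entry_permute[OF g] add_pow_ldistr_int add_pow_rdistr_int
        intro!: finsum_closed)
  also have "\<dots> = (\<Oplus>y\<in>set (strict_incr_seqs n N). alt_entry n g x y \<otimes> alt_entry n h y t)"
    unfolding alt_entry_def[of n h]
    by (intro finsum_cong' refl finsum_rdistr[symmetric])
      (auto simp: set_strict_incr_seqs intro!: finsum_closed)
  finally show ?thesis .
qed

lemma ext_mat_eq_basis_mat:
  "g \<in> carrier (Mat R N) \<Longrightarrow> ext_mat R n g = basis_mat (strict_incr_seqs n N) (alt_entry n g)"
  by (simp add: ext_mat_def basis_mat_def Let_def alt_entry_def carrier_matrix_monoid_iff)

lemma ext_mat_hom:
  "ext_mat R n \<in> hom (Mat R N) (Mat R (length (strict_incr_seqs n N)))"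
proof (rule homI)
  fix g assume g: "g \<in> carrier (Mat R N)"
  thus "ext_mat R n g \<in> carrier (Mat R (length (strict_incr_seqs n N)))"
    by (auto simp: ext_mat_eq_basis_mat set_strict_incr_seqs intro!: basis_mat_closed alt_entry_closed)
next
  fix g h assume g: "g \<in> carrier (Mat R N)" and h: "h \<in> carrier (Mat R N)"
  let ?b = "strict_incr_seqs n N"
  have "ext_mat R n g \<otimes>\<^bsub>Mat R (length ?b)\<^esub> ext_mat R n h
      = basis_mat ?b (\<lambda>x t. \<Oplus>y\<in>set ?b. alt_entry n g x y \<otimes> alt_entry n h y t)"
    unfolding ext_mat_eq_basis_mat[OF g] ext_mat_eq_basis_mat[OF h]
    by (intro basis_mat_mult distinct_strict_incr_seqs alt_entry_closed[OF g] alt_entry_closed[OF h])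
      (auto simp: set_strict_incr_seqs)
  also have "\<dots> = ext_mat R n (g \<otimes>\<^bsub>Mat R N\<^esub> h)"
    unfolding ext_mat_eq_basis_mat[OF matrix_monoid_mult_closed[OF g h]]
    by (intro basis_mat_cong) (auto simp: alt_entry_mult[OF g h] set_strict_incr_seqs)
  finally show "ext_mat R n (g \<otimes>\<^bsub>Mat R N\<^esub> h)
      = ext_mat R n g \<otimes>\<^bsub>Mat R (length ?b)\<^esub> ext_mat R n h" ..
qed

lemma ext_mat_one:
  "ext_mat R n \<one>\<^bsub>Mat R N\<^esub> = \<one>\<^bsub>Mat R (length (strict_incr_seqs n N))\<^esub>"
proof -
  let ?b = "strict_incr_seqs n N" and ?P = "{\<pi>. \<pi> permutes {..<n}}"
  have "alt_entry n \<one>\<^bsub>Mat R N\<^esub> x y = (if x = y then \<one> else \<zero>)"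
    if "x \<in> set ?b" "y \<in> set ?b" for x y
  proof -
    have b: "x \<in> index_seqs n N" "sorted_wrt (<) x" "y \<in> index_seqs n N" "sorted_wrt (<) y"
      using that by (auto simp: set_strict_incr_seqs)
    have "permute_list \<pi> x = y \<longleftrightarrow> x = y \<and> \<pi> = id" if "\<pi> \<in> ?P" for \<pi>
    proof
      assume eq: "permute_list \<pi> x = y"
      have "set (permute_list \<pi> x) = set x"
        using b that by (auto simp: length_index_seqs)
      hence xy: "x = y"
        using eq b by (intro sorted_distinct_set_unique) (auto simp: strict_sorted_iff)
      thus "x = y \<and> \<pi> = id"
        using permute_list_eq_iff[of x \<pi> id] eq b that
        by (simp add: strict_sorted_iff length_index_seqs permutes_id)
    qed simp
    hence summand: "[sign \<pi>] \<cdot> tensor_power_entry R n \<one>\<^bsub>Mat R N\<^esub> (permute_list \<pi> x) y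
        = (if x = y \<and> \<pi> = id then \<one> else \<zero>)" if "\<pi> \<in> ?P" for \<pi>
      using that b by (auto simp: tensor_power_entry_one permute_list_in_index_seqs_iff
          one_int_mult add.int_pow_one)
    have "alt_entry n \<one>\<^bsub>Mat R N\<^esub> x y = (\<Oplus>\<pi>\<in>?P. if x = y \<and> \<pi> = id then \<one> else \<zero>)"
      unfolding alt_entry_def using summand by (intro finsum_cong') auto
    also have "\<dots> = (if x = y then \<one> else \<zero>)"
      using finsum_delta[of ?P id "\<lambda>_. \<one>"] by (auto simp: finite_permutations permutes_id)
    finally show ?thesis .
  qed
  thus ?thesis
    unfolding ext_mat_eq_basis_mat[OF matrix_monoid_one_closed]
    by (subst basis_mat_one[OF distinct_strict_incr_seqs, symmetric]) (intro basis_mat_cong)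
qed

end

context ring_hom_cring
begin

lemma hom_int_mult:
  assumes "x \<in> carrier R"
  shows "h ([(k::int)] \<cdot> x) = [k] \<cdot>\<^bsub>S\<^esub> h x"
proof -
  have nat: "h ([(m::nat)] \<cdot> x) = [m] \<cdot>\<^bsub>S\<^esub> h x" for m
    using assms by (induction m) auto
  show ?thesis
  proof (cases "k \<ge> 0")
    case True
    thus ?thesis by (simp add: add_pow_int_ge  nat)
  next
    case False
    thus ?thesis using assms by (simp add: add_pow_int_lt  nat)
  qed
qed

lemma map_mat_ext_mat:
  assumes g: "g \<in> carrier (Mat R N)"
  shows "map_mat h (ext_mat R n g) = ext_mat S n (map_mat h g)"
proof -
  have hg: "map_mat h g \<in> carrier (Mat S N)"
    using g map_mat_hom_matrix_monoid by (rule hom_in_carrier[rotated])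
  have "h (R.alt_entry n g x t) = S.alt_entry n (map_mat h g) x t"
    if x: "x \<in> index_seqs n N" and t: "t \<in> index_seqs n N" for x t
  proof -
    have "h (R.alt_entry n g x t) = (\<Oplus>\<^bsub>S\<^esub>\<pi>\<in>{\<pi>. \<pi> permutes {..<n}}.
        h (add_pow R (sign \<pi>) (tensor_power_entry R n g (permute_list \<pi> x) t)))"
      unfolding R.alt_entry_def using R.alt_summand_closed[OF g x t] by (subst hom_finsum) (auto simp: comp_def)
    also have "\<dots> = S.alt_entry n (map_mat h g) x t"
      unfolding S.alt_entry_def
    proof (intro S.finsum_cong' refl)
      fix \<pi> assume "\<pi> \<in> {\<pi>. \<pi> permutes {..<n}}"
      hence "permute_list \<pi> x \<in> index_seqs n N"
        using x by (simp add: permute_list_in_index_seqs_iff)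
      thus "h (add_pow R (sign \<pi>) (tensor_power_entry R n g (permute_list \<pi> x) t))
          = add_pow S (sign \<pi>) (tensor_power_entry S n (map_mat h g) (permute_list \<pi> x) t)"
        using t by (simp add: hom_int_mult R.tensor_power_entry_closed[OF g] hom_tensor_power_entry[OF g])
    qed (use S.alt_summand_closed[OF hg x t] in auto)
    finally show ?thesis .
  qed
  thus ?thesis
    unfolding R.ext_mat_eq_basis_mat[OF g] S.ext_mat_eq_basis_mat[OF hg] map_basis_mat
    by (intro basis_mat_cong) (auto simp: set_strict_incr_seqs)
qed

end

section \<open>Frobenius twists\<close>

context cring
begin

lemma binomial_theorem:
  assumes "x \<in> carrier R" "y \<in> carrier R"
  shows "(x \<oplus> y) [^] (n::nat) = (\<Oplus>k\<in>{..n}. [(n choose k)] \<cdot> (x [^] k \<otimes> y [^] (n - k)))"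
proof (induction n)
  case (Suc n)
  note [simp] = assms finsum_closed Pi_iff
  let ?F = "\<lambda>m k. [(m choose k)] \<cdot> (x [^] k \<otimes> y [^] (m - k))"
  let ?G = "\<lambda>k. [(n choose k)] \<cdot> (x [^] k \<otimes> y [^] (Suc n - k))"
  have x_part: "(\<Oplus>k\<in>{..n}. ?F n k) \<otimes> x = (\<Oplus>k\<in>{..n}. [(n choose k)] \<cdot> (x [^] Suc k \<otimes> y [^] (n - k)))"
    by (subst finsum_ldistr) (auto intro!: finsum_cong' simp: add_pow_ldistr add_pow_rdistr m_ac)
  have "(\<Oplus>k\<in>{..n}. ?F n k) \<otimes> y = (\<Oplus>k\<in>{..n}. ?G k)"
    by (subst finsum_ldistr)
      (auto intro!: finsum_cong' simp: add_pow_ldistr m_assoc Suc_diff_le)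
  also have "\<dots> = (\<Oplus>k\<in>{..Suc n}. ?G k)"
    by (subst finsum_Suc) (auto simp: binomial_eq_0)
  also have "\<dots> = (\<Oplus>k\<in>{..n}. ?G (Suc k)) \<oplus> ?G 0"
    by (subst finsum_Suc2) auto
  finally have y_part: "(\<Oplus>k\<in>{..n}. ?F n k) \<otimes> y = (\<Oplus>k\<in>{..n}. ?G (Suc k)) \<oplus> ?G 0" .
  have "(x \<oplus> y) [^] Suc n = (\<Oplus>k\<in>{..n}. ?F n k) \<otimes> x \<oplus> (\<Oplus>k\<in>{..n}. ?F n k) \<otimes> y"
    by (simp add: Suc.IH r_distr)
  also have "\<dots> = (\<Oplus>k\<in>{..n}. [(n choose k)] \<cdot> (x [^] Suc k \<otimes> y [^] (n - k)) \<oplus> ?G (Suc k)) \<oplus> ?G 0"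
    unfolding x_part y_part by (subst finsum_addf) (auto simp: a_assoc)
  also have "\<dots> = (\<Oplus>k\<in>{..n}. ?F (Suc n) (Suc k)) \<oplus> ?F (Suc n) 0"
    by (intro arg_cong2[where f = "(\<oplus>)"] finsum_cong') (auto simp: add.nat_pow_mult)
  also have "\<dots> = (\<Oplus>k\<in>{..Suc n}. ?F (Suc n) k)"
    by (subst finsum_Suc2) auto
  finally show ?case .
qed (use assms in auto)

lemma nat_mult_eq_zero_if_dvd:
  assumes "p dvd (m::nat)" "[p] \<cdot> \<one> = \<zero>" "x \<in> carrier R"
  shows "[m] \<cdot> x = \<zero>"
proof -
  obtain k where "m = p * k"
    using assms(1) by auto
  hence "[m] \<cdot> x = [k] \<cdot> (([p] \<cdot> \<one>) \<otimes> x)"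
    using assms(3) by (simp add: add_pow_ldistr add.nat_pow_pow)
  thus ?thesis
    using assms by simp
qed

text \<open>
  All inner binomial coefficients are divisible by \<open>p\<close>.
\<close>

lemma add_pow_prime_char:
  assumes "x \<in> carrier R" "y \<in> carrier R" "Factorial_Ring.prime (p::nat)" "[p] \<cdot> \<one> = \<zero>"
  shows "(x \<oplus> y) [^] p = x [^] p \<oplus> y [^] p"
proof -
  have p: "p > 0"
    using assms(3) by (rule prime_gt_0_nat)
  have "(x \<oplus> y) [^] p = (\<Oplus>k\<in>{0, p}. [(p choose k)] \<cdot> (x [^] k \<otimes> y [^] (p - k)))"
    unfolding binomial_theorem[OF assms(1,2)] using assms
    by (intro add.finprod_mono_neutral_cong_right)
      (auto intro!: nat_mult_eq_zero_if_dvd[of p] dvd_choose_prime)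
  also have "\<dots> = x [^] p \<oplus> y [^] p"
    using p assms by (simp add: a_comm)
  finally show ?thesis .
qed

text \<open>
  Consequently the matrix of a Frobenius twist is the base change of the given matrix along an
  endomorphism of the algebra, and inherits its functoriality from that of base change.
\<close>

lemma frobenius_ring_hom:
  assumes "Factorial_Ring.prime (p::nat)" "[p] \<cdot> \<one> = \<zero>"
  shows "(\<lambda>x. x [^] (p ^ r)) \<in> Ring.ring_hom R R"
proof (induction r)
  case 0
  show ?case by (rule ring_hom_memI) auto
next
  case (Suc r)
  have eq: "x [^] (p ^ Suc r) = (x [^] (p ^ r)) [^] p" if "x \<in> carrier R" for x
    using that by (simp add: nat_pow_pow mult.commute)
  show ?case
  proof (rule ring_hom_memI)
    fix x y assume xy: "x \<in> carrier R" "y \<in> carrier R"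
    have "(x \<oplus> y) [^] (p ^ r) = x [^] (p ^ r) \<oplus> y [^] (p ^ r)"
      using ring_hom_add[OF Suc xy] by simp
    thus "(x \<oplus> y) [^] (p ^ Suc r) = x [^] (p ^ Suc r) \<oplus> y [^] (p ^ Suc r)"
      using xy add_pow_prime_char[OF _ _ assms] by (simp only: eq a_closed nat_pow_closed)
  qed (auto simp: nat_pow_distrib)
qed

end

lemma (in ring_hom_cring) hom_nat_power: "x \<in> carrier R \<Longrightarrow> h (x [^] (n::nat)) = h x [^]\<^bsub>S\<^esub> n"
  by (induction n) auto

section \<open>Tensor products and duals\<close>

lemma bij_betw_div_mod:
  "bij_betw (\<lambda>x. fst x * M + snd x) ({..<N} \<times> {..<M}) {..<N * M :: nat}"
proof (rule bij_betw_byWitness[where f' = "\<lambda>l. (l div M, l mod M)"])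
  have "a * M + b < N * M" if "a < N" "b < M" for a b :: nat
  proof -
    have "a * M + b < Suc a * M" using that by simp
    also have "\<dots> \<le> N * M" using that by (intro mult_le_mono1) simp
    finally show ?thesis .
  qed
  thus "(\<lambda>x. fst x * M + snd x) ` ({..<N} \<times> {..<M}) \<subseteq> {..<N * M}"
    by auto
  show "(\<lambda>l. (l div M, l mod M)) ` {..<N * M} \<subseteq> {..<N} \<times> {..<M}"
    by (auto simp: less_mult_imp_div_less) (metis mod_less_divisor mult_0_right neq0_conv not_less_zero)
qed auto

lemma div_mod_less: "i < N * M \<Longrightarrow> i div M < N" "i < N * M \<Longrightarrow> i mod M < (M::nat)"
  using bij_betw_div_mod[of M N]
  by (simp_all add: less_mult_imp_div_less) (metis mod_less_divisor mult_0_right neq0_conv not_less_zero)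

lemma dim_tensor_mat [simp]:
  "dim_row (tensor_mat A g h) = dim_row g * dim_row h"
  "dim_col (tensor_mat A g h) = dim_col g * dim_col h"
  by (simp_all add: tensor_mat_def)

lemma index_tensor_mat:
  assumes "g \<in> carrier (Mat A N)" "h \<in> carrier (Mat A M)" "i < N * M" "j < N * M"
  shows "tensor_mat A g h $$ (i, j) = g $$ (i div M, j div M) \<otimes>\<^bsub>A\<^esub> h $$ (i mod M, j mod M)"
  using assms by (simp add: tensor_mat_def carrier_matrix_monoid_iff)

context cring
begin

lemma tensor_mat_closed:
  assumes "g \<in> carrier (Mat R N)" "h \<in> carrier (Mat R M)"
  shows "tensor_mat R g h \<in> carrier (Mat R (N * M))"
  using assms unfolding carrier_matrix_monoid_iff[of "tensor_mat R g h"]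
  by (auto simp: index_tensor_mat) (auto simp: carrier_matrix_monoid_iff div_mod_less)

lemma tensor_mat_mult:
  assumes g: "g \<in> carrier (Mat R N)" "g' \<in> carrier (Mat R N)"
    and h: "h \<in> carrier (Mat R M)" "h' \<in> carrier (Mat R M)"
  shows "tensor_mat R (g \<otimes>\<^bsub>Mat R N\<^esub> g') (h \<otimes>\<^bsub>Mat R M\<^esub> h')
    = tensor_mat R g h \<otimes>\<^bsub>Mat R (N * M)\<^esub> tensor_mat R g' h'"
proof (rule eq_matI)
  fix i j
  assume "i < dim_row (tensor_mat R g h \<otimes>\<^bsub>Mat R (N * M)\<^esub> tensor_mat R g' h')"
    "j < dim_col (tensor_mat R g h \<otimes>\<^bsub>Mat R (N * M)\<^esub> tensor_mat R g' h')"
  hence ij: "i < N * M" "j < N * M" by auto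
  have [simp]: "i div M < N" "i mod M < M" "j div M < N" "j mod M < M"
    using ij div_mod_less by auto
  have [simp]: "g $$ (k, l) \<in> carrier R" "g' $$ (k, l) \<in> carrier R" if "k < N" "l < N" for k l
    using g that by (auto simp: carrier_matrix_monoid_iff)
  have [simp]: "h $$ (k, l) \<in> carrier R" "h' $$ (k, l) \<in> carrier R" if "k < M" "l < M" for k l
    using h that by (auto simp: carrier_matrix_monoid_iff)
  have "tensor_mat R (g \<otimes>\<^bsub>Mat R N\<^esub> g') (h \<otimes>\<^bsub>Mat R M\<^esub> h') $$ (i, j)
      = (\<Oplus>a\<in>{..<N}. g $$ (i div M, a) \<otimes> g' $$ (a, j div M))
        \<otimes> (\<Oplus>b\<in>{..<M}. h $$ (i mod M, b) \<otimes> h' $$ (b, j mod M))"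
    using ij g h by (simp add: index_tensor_mat[of _ _ N _ M] matrix_monoid_mult_closed index_matrix_monoid_mult)
  also have "\<dots> = (\<Oplus>a\<in>{..<N}. \<Oplus>b\<in>{..<M}. (g $$ (i div M, a) \<otimes> g' $$ (a, j div M))
      \<otimes> (h $$ (i mod M, b) \<otimes> h' $$ (b, j mod M)))"
    by (intro finsum_mult_finsum) auto
  also have "\<dots> = (\<Oplus>x\<in>{..<N} \<times> {..<M}. (g $$ (i div M, fst x) \<otimes> g' $$ (fst x, j div M))
      \<otimes> (h $$ (i mod M, snd x) \<otimes> h' $$ (snd x, j mod M)))"
    by (intro finsum_cartesian[symmetric]) auto
  also have "\<dots> = (\<Oplus>x\<in>{..<N} \<times> {..<M}. tensor_mat R g h $$ (i, fst x * M + snd x)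
      \<otimes> tensor_mat R g' h' $$ (fst x * M + snd x, j))"
  proof (intro finsum_cong' refl)
    fix x assume "x \<in> {..<N} \<times> {..<M}"
    hence x: "fst x < N" "snd x < M" "fst x * M + snd x < N * M"
      using bij_betwE[OF bij_betw_div_mod[of M N]] by auto
    show "(g $$ (i div M, fst x) \<otimes> g' $$ (fst x, j div M)) \<otimes> (h $$ (i mod M, snd x) \<otimes> h' $$ (snd x, j mod M))
        = tensor_mat R g h $$ (i, fst x * M + snd x) \<otimes> tensor_mat R g' h' $$ (fst x * M + snd x, j)"
      using x ij g h by (simp add: index_tensor_mat m_ac)
  next
    show "(\<lambda>x. tensor_mat R g h $$ (i, fst x * M + snd x) \<otimes> tensor_mat R g' h' $$ (fst x * M + snd x, j))
        \<in> {..<N} \<times> {..<M} \<rightarrow> carrier R"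
      using bij_betwE[OF bij_betw_div_mod[of M N]] ij tensor_mat_closed[OF g(1) h(1)]
        tensor_mat_closed[OF g(2) h(2)]
      by (auto simp: carrier_matrix_monoid_iff)
  qed
  also have "\<dots> = (\<Oplus>l\<in>{..<N * M}. tensor_mat R g h $$ (i, l) \<otimes> tensor_mat R g' h' $$ (l, j))"
    using ij tensor_mat_closed[OF g(1) h(1)] tensor_mat_closed[OF g(2) h(2)]
    by (intro finsum_reindex_bij bij_betw_div_mod) (auto simp: carrier_matrix_monoid_iff)
  also have "\<dots> = (tensor_mat R g h \<otimes>\<^bsub>Mat R (N * M)\<^esub> tensor_mat R g' h') $$ (i, j)"
    using ij by (simp add: index_matrix_monoid_mult)
  finally show "tensor_mat R (g \<otimes>\<^bsub>Mat R N\<^esub> g') (h \<otimes>\<^bsub>Mat R M\<^esub> h') $$ (i, j)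
    = (tensor_mat R g h \<otimes>\<^bsub>Mat R (N * M)\<^esub> tensor_mat R g' h') $$ (i, j)" .
qed auto

lemma tensor_mat_one:
  "tensor_mat R \<one>\<^bsub>Mat R N\<^esub> \<one>\<^bsub>Mat R M\<^esub> = \<one>\<^bsub>Mat R (N * M)\<^esub>"
proof (rule eq_matI)
  fix i j
  assume "i < dim_row \<one>\<^bsub>Mat R (N * M)\<^esub>" "j < dim_col \<one>\<^bsub>Mat R (N * M)\<^esub>"
  hence ij: "i < N * M" "j < N * M" by auto
  have "i = j \<longleftrightarrow> i div M = j div M \<and> i mod M = j mod M"
    by (metis div_mult_mod_eq)
  thus "tensor_mat R \<one>\<^bsub>Mat R N\<^esub> \<one>\<^bsub>Mat R M\<^esub> $$ (i, j) = \<one>\<^bsub>Mat R (N * M)\<^esub> $$ (i, j)"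
    using ij div_mod_less[OF ij(1)] div_mod_less[OF ij(2)]
    by (simp add: index_tensor_mat[OF matrix_monoid_one_closed matrix_monoid_one_closed]
        index_matrix_monoid_one)
qed auto

lemma tensor_mat_GL:
  assumes "g \<in> carrier (GL R N)" "h \<in> carrier (GL R M)"
  shows "tensor_mat R g h \<in> carrier (GL R (N * M))"
proof -
  obtain g' h' where
    g': "g' \<in> carrier (Mat R N)" "g' \<otimes>\<^bsub>Mat R N\<^esub> g = \<one>\<^bsub>Mat R N\<^esub>"
      "g \<otimes>\<^bsub>Mat R N\<^esub> g' = \<one>\<^bsub>Mat R N\<^esub>" and
    h': "h' \<in> carrier (Mat R M)" "h' \<otimes>\<^bsub>Mat R M\<^esub> h = \<one>\<^bsub>Mat R M\<^esub>"
      "h \<otimes>\<^bsub>Mat R M\<^esub> h' = \<one>\<^bsub>Mat R M\<^esub>"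
    using assms unfolding carrier_GL Units_def by auto
  note gh = assms[THEN GL_subset_matrix_monoid]
  have "tensor_mat R g' h' \<otimes>\<^bsub>Mat R (N * M)\<^esub> tensor_mat R g h = \<one>\<^bsub>Mat R (N * M)\<^esub>"
    "tensor_mat R g h \<otimes>\<^bsub>Mat R (N * M)\<^esub> tensor_mat R g' h' = \<one>\<^bsub>Mat R (N * M)\<^esub>"
    using g' h' gh by (simp_all add: tensor_mat_one flip: tensor_mat_mult)
  thus ?thesis
    using g'(1) h'(1) gh unfolding carrier_GL Units_def by (blast intro: tensor_mat_closed)
qed

lemma transpose_inv_hom_GL: "(\<lambda>g. transpose_mat (inv\<^bsub>GL R N\<^esub> g)) \<in> hom (GL R N) (GL R N)"
proof -
  interpret G: Group.group "GL R N" by (rule GL_group)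
  have transpose_Units: "transpose_mat g \<in> carrier (GL R N)" if g: "g \<in> carrier (GL R N)" for g
  proof -
    obtain g' where
      g': "g' \<in> carrier (Mat R N)" "g' \<otimes>\<^bsub>Mat R N\<^esub> g = \<one>\<^bsub>Mat R N\<^esub>"
        "g \<otimes>\<^bsub>Mat R N\<^esub> g' = \<one>\<^bsub>Mat R N\<^esub>"
      using g unfolding carrier_GL Units_def by auto
    note gM = g[THEN GL_subset_matrix_monoid]
    have "transpose_mat g \<otimes>\<^bsub>Mat R N\<^esub> transpose_mat g' = \<one>\<^bsub>Mat R N\<^esub>"
      "transpose_mat g' \<otimes>\<^bsub>Mat R N\<^esub> transpose_mat g = \<one>\<^bsub>Mat R N\<^esub>"
      using g' gM by (simp_all add: transpose_mat_one flip: transpose_mat_mult)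
    thus ?thesis
      using g'(1) gM unfolding carrier_GL Units_def by (blast intro: transpose_mat_closed)
  qed
  show ?thesis
  proof (rule homI)
    fix g h assume gh: "g \<in> carrier (GL R N)" "h \<in> carrier (GL R N)"
    have "inv\<^bsub>GL R N\<^esub> (g \<otimes>\<^bsub>GL R N\<^esub> h) = inv\<^bsub>GL R N\<^esub> h \<otimes>\<^bsub>GL R N\<^esub> inv\<^bsub>GL R N\<^esub> g"
      using gh by (rule G.inv_mult_group)
    thus "transpose_mat (inv\<^bsub>GL R N\<^esub> (g \<otimes>\<^bsub>GL R N\<^esub> h))
        = transpose_mat (inv\<^bsub>GL R N\<^esub> g) \<otimes>\<^bsub>GL R N\<^esub> transpose_mat (inv\<^bsub>GL R N\<^esub> h)"
      using gh by (simp add: GL_mult transpose_mat_mult GL_subset_matrix_monoid)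
  qed (simp add: transpose_Units)
qed

end

lemma (in ring_hom_cring) map_mat_tensor_mat:
  assumes "g \<in> carrier (Mat R N)" "g' \<in> carrier (Mat R M)"
  shows "map_mat h (tensor_mat R g g') = tensor_mat S (map_mat h g) (map_mat h g')"
  using assms
  by (intro eq_matI) (auto simp: tensor_mat_def carrier_matrix_monoid_iff div_mod_less)

section \<open>Functoriality of monomial expressions\<close>

lemma algebra_cring: "algebra K A \<Longrightarrow> cring A"
  by (rule algebra.axioms(2))

lemma algebra_hom_ring_hom_cring:
  assumes "algebra K A" "algebra K B" "h \<in> algebra_hom K A B"
  shows "ring_hom_cring A B h"
  using assms by (auto simp: algebra_hom_def ring_hom_cring_def ring_hom_cring_axioms_def algebra_cring)

lemma (in algebra) nat_mult_one_eq_smult: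
  "add_pow M (m::nat) \<one>\<^bsub>M\<^esub> = add_pow R m \<one> \<odot>\<^bsub>M\<^esub> \<one>\<^bsub>M\<^esub>"
  by (induction m) (auto simp: smult_l_distr smult_l_null)

definition GL_list :: "'k alg \<Rightarrow> nat list \<Rightarrow> 'k list mat list \<Rightarrow> bool" where
  "GL_list A ds gs \<longleftrightarrow> list_all2 (\<lambda>d g. g \<in> carrier (GL A d)) ds gs"

abbreviation square_mult :: "'k alg \<Rightarrow> 'k list mat \<Rightarrow> 'k list mat \<Rightarrow> 'k list mat" where
  "square_mult A g h \<equiv> g \<otimes>\<^bsub>Mat A (dim_row g)\<^esub> h"

text \<open>
  An association on tuples of vector bundles which deserves the name of a functor: isomorphisms go
  to isomorphisms, compositions to compositions, and everything is compatible with base change.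
\<close>

definition vb_functorial :: "('k, 'b) ring_scheme \<Rightarrow> nat \<Rightarrow> 'k vb_functor \<Rightarrow> bool" where
  "vb_functorial K m E \<longleftrightarrow> m \<ge> 1 \<and>
    (\<forall>A ds gs. algebra K A \<longrightarrow> length ds = m \<longrightarrow> GL_list A ds gs \<longrightarrow>
      vb_iso E A gs \<in> carrier (GL A (vb_rank E ds)) \<and>
      (\<forall>hs. GL_list A ds hs \<longrightarrow>
        vb_iso E A (map2 (square_mult A) gs hs)
          = vb_iso E A gs \<otimes>\<^bsub>GL A (vb_rank E ds)\<^esub> vb_iso E A hs) \<and>
      (\<forall>B h. algebra K B \<longrightarrow> h \<in> algebra_hom K A B \<longrightarrow>
        vb_iso E B (map (map_mat h) gs) = map_mat h (vb_iso E A gs)))"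

lemma vb_functorialI:
  assumes "m \<ge> 1"
    and "\<And>A ds gs. algebra K A \<Longrightarrow> length ds = m \<Longrightarrow> GL_list A ds gs \<Longrightarrow>
      vb_iso E A gs \<in> carrier (GL A (vb_rank E ds))"
    and "\<And>A ds gs hs. algebra K A \<Longrightarrow> length ds = m \<Longrightarrow> GL_list A ds gs \<Longrightarrow> GL_list A ds hs \<Longrightarrow>
      vb_iso E A (map2 (square_mult A) gs hs) = vb_iso E A gs \<otimes>\<^bsub>GL A (vb_rank E ds)\<^esub> vb_iso E A hs"
    and "\<And>A B h ds gs. algebra K A \<Longrightarrow> algebra K B \<Longrightarrow> h \<in> algebra_hom K A B \<Longrightarrow> length ds = m \<Longrightarrow>
      GL_list A ds gs \<Longrightarrow> vb_iso E B (map (map_mat h) gs) = map_mat h (vb_iso E A gs)"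
  shows "vb_functorial K m E"
  using assms unfolding vb_functorial_def by blast

lemma
  assumes "vb_functorial K m E" "algebra K A" "length ds = m" "GL_list A ds gs"
  shows vb_iso_GL: "vb_iso E A gs \<in> carrier (GL A (vb_rank E ds))"
    and vb_iso_mult: "GL_list A ds hs \<Longrightarrow>
      vb_iso E A (map2 (square_mult A) gs hs) = vb_iso E A gs \<otimes>\<^bsub>GL A (vb_rank E ds)\<^esub> vb_iso E A hs"
    and vb_iso_base_change: "algebra K B \<Longrightarrow> h \<in> algebra_hom K A B \<Longrightarrow>
      vb_iso E B (map (map_mat h) gs) = map_mat h (vb_iso E A gs)"
  using assms unfolding vb_functorial_def by blast+

lemma vb_functorial_pos: "vb_functorial K m E \<Longrightarrow> m \<ge> 1"
  by (simp add: vb_functorial_def)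

lemma GL_list_length: "GL_list A ds gs \<Longrightarrow> length gs = length ds"
  by (simp add: GL_list_def list_all2_lengthD)

lemma GL_list_iff_nth:
  "GL_list A ds gs \<longleftrightarrow> length gs = length ds \<and> (\<forall>j<length ds. gs ! j \<in> carrier (GL A (ds ! j)))"
  by (auto simp: GL_list_def list_all2_conv_all_nth)

lemma vb_functorial_unary:
  assumes hom: "\<And>A N. algebra K A \<Longrightarrow> \<Phi> A \<in> hom (GL A N) (GL A (\<rho> N))"
    and base: "\<And>A B h N g. algebra K A \<Longrightarrow> algebra K B \<Longrightarrow> h \<in> algebra_hom K A B \<Longrightarrow>
      g \<in> carrier (GL A N) \<Longrightarrow> \<Phi> B (map_mat h g) = map_mat h (\<Phi> A g)"
  shows "vb_functorial K 1 \<lparr>vb_rank = (\<lambda>ds. \<rho> (hd ds)), vb_iso = (\<lambda>A gs. \<Phi> A (hd gs))\<rparr>"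
    (is "vb_functorial K 1 ?E")
proof (rule vb_functorialI)
  fix A :: "'a alg" and ds gs hs
  assume A: "algebra K A" and ds: "length ds = 1" and gs: "GL_list A ds gs"
  obtain N g where N: "ds = [N]" "gs = [g]" "g \<in> carrier (GL A N)"
    using ds gs by (auto simp: GL_list_def length_Suc_conv list_all2_Cons1)
  show "vb_iso ?E A gs \<in> carrier (GL A (vb_rank ?E ds))"
    using N hom[OF A, THEN hom_in_carrier] by simp
  show "vb_iso ?E A (map2 (square_mult A) gs hs)
      = vb_iso ?E A gs \<otimes>\<^bsub>GL A (vb_rank ?E ds)\<^esub> vb_iso ?E A hs"
    if "GL_list A ds hs"
    using N that hom_mult[OF hom[OF A], of g N]
    by (auto simp: GL_list_def list_all2_Cons1 dim_GL GL_mult)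
next
  fix A B :: "'a alg" and h ds gs
  assume *: "algebra K A" "algebra K B" "h \<in> algebra_hom K A B" and ds: "length ds = 1"
    and gs: "GL_list A ds gs"
  obtain N g where N: "ds = [N]" "gs = [g]" "g \<in> carrier (GL A N)"
    using ds gs by (auto simp: GL_list_def length_Suc_conv list_all2_Cons1)
  show "vb_iso ?E B (map (map_mat h) gs) = map_mat h (vb_iso ?E A gs)"
    using N base[OF *] by simp
qed simp

text \<open>
  Covariant functors act on all linear maps, so that their multiplicativity may be checked on the
  monoids of all square matrices.
\<close>

lemma vb_functorial_unary_monoid:
  assumes hom: "\<And>A N. algebra K A \<Longrightarrow> \<Phi> A \<in> hom (Mat A N) (Mat A (\<rho> N))"
    and one: "\<And>A N. algebra K A \<Longrightarrow> \<Phi> A \<one>\<^bsub>Mat A N\<^esub> = \<one>\<^bsub>Mat A (\<rho> N)\<^esub>"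
    and base: "\<And>A B h N g. ring_hom_cring A B h \<Longrightarrow> g \<in> carrier (Mat A N) \<Longrightarrow>
      map_mat h (\<Phi> A g) = \<Phi> B (map_mat h g)"
  shows "vb_functorial K 1 \<lparr>vb_rank = (\<lambda>ds. \<rho> (hd ds)), vb_iso = (\<lambda>A gs. \<Phi> A (hd gs))\<rparr>"
proof (rule vb_functorial_unary)
  show "\<Phi> A \<in> hom (GL A N) (GL A (\<rho> N))" if "algebra K A" for A N
    unfolding GL_def by (rule hom_units_of[OF hom[OF that] one[OF that]])
  show "\<Phi> B (map_mat h g) = map_mat h (\<Phi> A g)"
    if "algebra K A" "algebra K B" "h \<in> algebra_hom K A B" "g \<in> carrier (GL A N)" for A B h N g
    using base[OF algebra_hom_ring_hom_cring[OF that(1-3)] GL_subset_matrix_monoid[OF that(4)]] ..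
qed

lemma vb_functorial_sym: "vb_functorial K 1 (sym_functor n)"
  unfolding sym_functor_def
  by (intro vb_functorial_unary_monoid cring.sym_mat_hom cring.sym_mat_one algebra_cring
      ring_hom_cring.map_mat_sym_mat)

lemma vb_functorial_divided_power: "vb_functorial K 1 (divided_power_functor n)"
  unfolding divided_power_functor_def
  by (intro vb_functorial_unary_monoid cring.divided_power_mat_hom cring.divided_power_mat_one
      algebra_cring ring_hom_cring.map_mat_divided_power_mat)

lemma vb_functorial_ext: "vb_functorial K 1 (ext_functor n)"
  unfolding ext_functor_def
  by (intro vb_functorial_unary_monoid cring.ext_mat_hom cring.ext_mat_one algebra_cring
      ring_hom_cring.map_mat_ext_mat)

lemma vb_functorial_frobenius:
  assumes "Factorial_Ring.prime (p::nat)" "add_pow K p \<one>\<^bsub>K\<^esub> = \<zero>\<^bsub>K\<^esub>"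
  shows "vb_functorial K 1 (frobenius_functor (p ^ r))"
proof -
  have eq: "(frobenius_functor (p ^ r) :: 'a vb_functor)
      = \<lparr>vb_rank = (\<lambda>ds. id (hd ds)), vb_iso = (\<lambda>A gs. map_mat (\<lambda>x. x [^]\<^bsub>A\<^esub> (p ^ r)) (hd gs))\<rparr>"
    by (simp add: frobenius_functor_def)
  show ?thesis
    unfolding eq
  proof (rule vb_functorial_unary)
    fix A :: "'a alg" and N assume A: "algebra K A"
    then interpret algebra K A .
    have "add_pow A p \<one>\<^bsub>A\<^esub> = \<zero>\<^bsub>A\<^esub>"
      using assms(2) by (simp add: nat_mult_one_eq_smult smult_l_null)
    then interpret F: ring_hom_cring A A "\<lambda>x. x [^]\<^bsub>A\<^esub> (p ^ r)"
      using cring.frobenius_ring_hom[OF algebra_cring[OF A] assms(1)] algebra_cring[OF A]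
      by (simp add: ring_hom_cring_def ring_hom_cring_axioms_def)
    show "map_mat (\<lambda>x. x [^]\<^bsub>A\<^esub> (p ^ r)) \<in> hom (GL A N) (GL A (id N))"
      using F.map_mat_hom_GL by simp
  next
    fix A B :: "'a alg" and h N g
    assume *: "algebra K A" "algebra K B" "h \<in> algebra_hom K A B" "g \<in> carrier (GL A N)"
    interpret ring_hom_cring A B h using *(1-3) by (rule algebra_hom_ring_hom_cring)
    show "map_mat (\<lambda>x. x [^]\<^bsub>B\<^esub> (p ^ r)) (map_mat h g) = map_mat h (map_mat (\<lambda>x. x [^]\<^bsub>A\<^esub> (p ^ r)) g)"
      using index_GL_closed[OF *(4)] dim_GL[OF *(4)]
      by (intro eq_matI) (auto simp: hom_nat_power)
  qed
qed

lemma vb_functorial_dual: "vb_functorial K 1 dual_functor"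
proof -
  have eq: "(dual_functor :: 'a vb_functor) = \<lparr>vb_rank = (\<lambda>ds. id (hd ds)),
      vb_iso = (\<lambda>A gs. (\<lambda>g. transpose_mat (inv\<^bsub>GL A (dim_row g)\<^esub> g)) (hd gs))\<rparr>"
    by (simp add: dual_functor_def)
  show ?thesis
    unfolding eq
  proof (rule vb_functorial_unary)
    fix A :: "'a alg" and N assume "algebra K A"
    then interpret cring A by (rule algebra_cring)
    have "transpose_mat (inv\<^bsub>GL A (dim_row g)\<^esub> g) = transpose_mat (inv\<^bsub>GL A N\<^esub> g)"
      if "g \<in> carrier (GL A N)" for g
      using that by (simp add: dim_GL)
    thus "(\<lambda>g. transpose_mat (inv\<^bsub>GL A (dim_row g)\<^esub> g)) \<in> hom (GL A N) (GL A (id N))"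
      using transpose_inv_hom_GL[of N] GL_group[of N, THEN Group.group.is_monoid, THEN Group.monoid.m_closed]
      by (auto simp: hom_def Pi_iff)
  next
    fix A B :: "'a alg" and h N g
    assume *: "algebra K A" "algebra K B" "h \<in> algebra_hom K A B" "g \<in> carrier (GL A N)"
    interpret ring_hom_cring A B h using *(1-3) by (rule algebra_hom_ring_hom_cring)
    show "transpose_mat (inv\<^bsub>GL B (dim_row (map_mat h g))\<^esub> (map_mat h g))
        = map_mat h (transpose_mat (inv\<^bsub>GL A (dim_row g)\<^esub> g))"
      using map_mat_GL_inv[OF *(4)] dim_GL[OF *(4)] by (simp flip: map_mat_transpose)
  qed
qed

lemma GL_list_append:
  assumes "length ds = length gs"
  shows "GL_list A (ds @ ds') (gs @ gs') \<longleftrightarrow> GL_list A ds gs \<and> GL_list A ds' gs'"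
  using assms by (simp add: GL_list_def list_all2_append)

lemma GL_list_Cons: "GL_list A (d # ds) (g # gs) \<longleftrightarrow> g \<in> carrier (GL A d) \<and> GL_list A ds gs"
  by (simp add: GL_list_def)

lemma vb_functorial_tensor:
  assumes E: "vb_functorial K m E"
  shows "vb_functorial K (m + 1) (tensor_functor E)"
proof (rule vb_functorialI)
  have split: "\<exists>ds' N gs' g. ds = ds' @ [N] \<and> gs = gs' @ [g] \<and> length ds' = m \<and> length gs' = m
      \<and> GL_list A ds' gs' \<and> g \<in> carrier (GL A N)"
    if "length ds = m + 1" "GL_list A ds gs" for A :: "'a alg" and ds gs
  proof -
    have "length ds = Suc m" "length gs = Suc m"
      using that GL_list_length[OF that(2)] by simp_all
    then obtain ds' N gs' g where "ds = ds' @ [N]" "length ds' = m" "gs = gs' @ [g]" "length gs' = m"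
      unfolding length_Suc_conv_rev by blast
    thus ?thesis
      using that(2) by (simp add: GL_list_append GL_list_Cons)
  qed
  {
    fix A :: "'a alg" and ds gs hs
    assume A: "algebra K A" and ds: "length ds = m + 1" and gs: "GL_list A ds gs"
    then interpret cring A by (simp add: algebra_cring)
    obtain ds' N gs' g where *: "ds = ds' @ [N]" "gs = gs' @ [g]" "length ds' = m" "length gs' = m"
      "GL_list A ds' gs'" "g \<in> carrier (GL A N)"
      using split[OF ds gs] by blast
    note Eg = vb_iso_GL[OF E A *(3,5)]
    show "vb_iso (tensor_functor E) A gs \<in> carrier (GL A (vb_rank (tensor_functor E) ds))"
      using tensor_mat_GL[OF Eg *(6)] * by (simp add: tensor_functor_def)
    show "vb_iso (tensor_functor E) A (map2 (square_mult A) gs hs)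
        = vb_iso (tensor_functor E) A gs \<otimes>\<^bsub>GL A (vb_rank (tensor_functor E) ds)\<^esub> vb_iso (tensor_functor E) A hs"
      if hs: "GL_list A ds hs"
    proof -
      obtain ds'' N' hs' h where **: "ds = ds'' @ [N']" "hs = hs' @ [h]" "length hs' = m"
        "GL_list A ds'' hs'" "h \<in> carrier (GL A N')"
        using split[OF ds hs] by blast
      have eq: "ds'' = ds'" "N' = N"
        using *(1) **(1) by auto
      note Eh = vb_iso_GL[OF E A *(3) **(4)[unfolded eq]]
      have "map2 (square_mult A) gs hs = map2 (square_mult A) gs' hs' @ [square_mult A g h]"
        using * ** by simp
      thus ?thesis
        using * ** vb_iso_mult[OF E A *(3,5) **(4)[unfolded eq]]
          tensor_mat_mult[OF Eg[THEN GL_subset_matrix_monoid] Eh[THEN GL_subset_matrix_monoid]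
            *(6)[THEN GL_subset_matrix_monoid] **(5)[THEN GL_subset_matrix_monoid, unfolded eq]]
        by (simp add: tensor_functor_def GL_mult dim_GL)
    qed
  }
  fix A B :: "'a alg" and h ds gs
  assume AB: "algebra K A" "algebra K B" "h \<in> algebra_hom K A B" and ds: "length ds = m + 1"
    and gs: "GL_list A ds gs"
  interpret ring_hom_cring A B h using AB by (rule algebra_hom_ring_hom_cring)
  obtain ds' N gs' g where *: "ds = ds' @ [N]" "gs = gs' @ [g]" "length ds' = m" "length gs' = m"
    "GL_list A ds' gs'" "g \<in> carrier (GL A N)"
    using split[OF ds gs] by blast
  show "vb_iso (tensor_functor E) B (map (map_mat h) gs) = map_mat h (vb_iso (tensor_functor E) A gs)"
    using * vb_iso_base_change[OF E AB(1) *(3,5) AB(2,3)]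
      map_mat_tensor_mat[OF vb_iso_GL[OF E AB(1) *(3,5), THEN GL_subset_matrix_monoid]
        *(6)[THEN GL_subset_matrix_monoid]]
    by (simp add: tensor_functor_def)
qed simp

lemma vb_functorial_subst:
  assumes E: "vb_functorial K m E" and F: "vb_functorial K m' F"
  shows "vb_functorial K (m + m' - 1) (subst_functor m' E F)"
proof (rule vb_functorialI)
  have pos: "m \<ge> 1" "m' \<ge> 1"
    using E F vb_functorial_pos by auto
  thus "m + m' - 1 \<ge> 1"
    by simp
  have split: "GL_list A (take m' ds) (take m' gs)" "GL_list A (drop m' ds) (drop m' gs)"
    "length (take m' ds) = m'" "length (x # drop m' ds) = m"
    if "length ds = m + m' - 1" "GL_list A ds gs" for A :: "'a alg" and ds gs x
    using that pos by (auto simp: GL_list_def)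
  {
    fix A :: "'a alg" and ds gs hs
    assume A: "algebra K A" and ds: "length ds = m + m' - 1" and gs: "GL_list A ds gs"
    note g = split[OF ds gs]
    have Fg: "vb_iso F A (take m' gs) \<in> carrier (GL A (vb_rank F (take m' ds)))"
      by (rule vb_iso_GL[OF F A g(3,1)])
    have Lg: "GL_list A (vb_rank F (take m' ds) # drop m' ds) (vb_iso F A (take m' gs) # drop m' gs)"
      using Fg g by (simp add: GL_list_Cons)
    show "vb_iso (subst_functor m' E F) A gs \<in> carrier (GL A (vb_rank (subst_functor m' E F) ds))"
      using vb_iso_GL[OF E A g(4) Lg] by (simp add: subst_functor_def)
    show "vb_iso (subst_functor m' E F) A (map2 (square_mult A) gs hs)
      = vb_iso (subst_functor m' E F) A gs \<otimes>\<^bsub>GL A (vb_rank (subst_functor m' E F) ds)\<^esub> vb_iso (subst_functor m' E F) A hs"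
      if hs: "GL_list A ds hs"
    proof -
      note h = split[OF ds hs]
      have Fh: "vb_iso F A (take m' hs) \<in> carrier (GL A (vb_rank F (take m' ds)))"
        by (rule vb_iso_GL[OF F A h(3,1)])
      have Lh: "GL_list A (vb_rank F (take m' ds) # drop m' ds) (vb_iso F A (take m' hs) # drop m' hs)"
        using Fh h by (simp add: GL_list_Cons)
      show ?thesis
        using vb_iso_mult[OF E A g(4) Lg Lh] vb_iso_mult[OF F A g(3,1) h(1)] dim_GL[OF Fg]
        by (simp add: subst_functor_def GL_mult take_map take_zip drop_map drop_zip)
    qed
  }
  fix A B :: "'a alg" and h ds gs
  assume AB: "algebra K A" "algebra K B" "h \<in> algebra_hom K A B" and ds: "length ds = m + m' - 1"
    and gs: "GL_list A ds gs"
  note g = split[OF ds gs]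
  have Fg: "vb_iso F A (take m' gs) \<in> carrier (GL A (vb_rank F (take m' ds)))"
    by (rule vb_iso_GL[OF F AB(1) g(3,1)])
  have Lg: "GL_list A (vb_rank F (take m' ds) # drop m' ds) (vb_iso F A (take m' gs) # drop m' gs)"
    using Fg g by (simp add: GL_list_Cons)
  show "vb_iso (subst_functor m' E F) B (map (map_mat h) gs) = map_mat h (vb_iso (subst_functor m' E F) A gs)"
    using vb_iso_base_change[OF E AB(1) g(4) Lg AB(2,3)] vb_iso_base_change[OF F AB(1) g(3,1) AB(2,3)]
    by (simp add: subst_functor_def take_map drop_map)
qed

lemma vb_functorial_diagonal:
  assumes E: "vb_functorial K (m + 1) E" and m: "m \<ge> 1"
  shows "vb_functorial K m (diagonal_functor E)"
proof (rule vb_functorialI)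
  have L: "GL_list A (hd ds # ds) (hd gs # gs) \<and> ds \<noteq> [] \<and> gs \<noteq> []"
    if "length ds = m" "GL_list A ds gs" for A :: "'a alg" and ds gs
    using that m by (cases ds; cases gs) (auto simp: GL_list_def)
  {
    fix A :: "'a alg" and ds gs hs
    assume A: "algebra K A" and ds: "length ds = m" and gs: "GL_list A ds gs"
    show "vb_iso (diagonal_functor E) A gs \<in> carrier (GL A (vb_rank (diagonal_functor E) ds))"
      using vb_iso_GL[OF E A _ conjunct1[OF L[OF ds gs]]] ds by (simp add: diagonal_functor_def)
    show "vb_iso (diagonal_functor E) A (map2 (square_mult A) gs hs)
        = vb_iso (diagonal_functor E) A gs \<otimes>\<^bsub>GL A (vb_rank (diagonal_functor E) ds)\<^esub> vb_iso (diagonal_functor E) A hs"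
      if hs: "GL_list A ds hs"
    proof -
      have "hd (map2 (square_mult A) gs hs) = square_mult A (hd gs) (hd hs)"
        using L[OF ds gs] L[OF ds hs] by (cases gs; cases hs) auto
      thus ?thesis
        using vb_iso_mult[OF E A _ conjunct1[OF L[OF ds gs]] conjunct1[OF L[OF ds hs]]] ds
        by (simp add: diagonal_functor_def)
    qed
  }
  fix A B :: "'a alg" and h ds gs
  assume AB: "algebra K A" "algebra K B" "h \<in> algebra_hom K A B" and ds: "length ds = m"
    and gs: "GL_list A ds gs"
  show "vb_iso (diagonal_functor E) B (map (map_mat h) gs) = map_mat h (vb_iso (diagonal_functor E) A gs)"
    using vb_iso_base_change[OF E AB(1) _ conjunct1[OF L[OF ds gs]] AB(2,3)] ds L[OF ds gs]
    by (simp add: diagonal_functor_def hd_map)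
qed (rule m)

lemma vb_functorial_permute:
  assumes E: "vb_functorial K m E" and \<pi>: "\<pi> permutes {..<m}"
  shows "vb_functorial K m (permute_functor \<pi> E)"
proof (rule vb_functorialI)
  show "m \<ge> 1"
    using E by (rule vb_functorial_pos)
  have L: "GL_list A (permute_list \<pi> ds) (permute_list \<pi> gs)"
    if "length ds = m" "GL_list A ds gs" for A :: "'a alg" and ds gs
    using that \<pi> by (auto simp: GL_list_def list_all2_permute_list_iff dest: list_all2_lengthD)
  {
    fix A :: "'a alg" and ds gs hs
    assume A: "algebra K A" and ds: "length ds = m" and gs: "GL_list A ds gs"
    show "vb_iso (permute_functor \<pi> E) A gs \<in> carrier (GL A (vb_rank (permute_functor \<pi> E) ds))"
      using vb_iso_GL[OF E A _ L[OF ds gs]] ds by (simp add: permute_functor_def)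
    show "vb_iso (permute_functor \<pi> E) A (map2 (square_mult A) gs hs)
        = vb_iso (permute_functor \<pi> E) A gs \<otimes>\<^bsub>GL A (vb_rank (permute_functor \<pi> E) ds)\<^esub> vb_iso (permute_functor \<pi> E) A hs"
      if hs: "GL_list A ds hs"
    proof -
      have len: "length gs = m" "length hs = m"
        using ds gs hs by (auto dest: GL_list_length)
      hence "permute_list \<pi> (map2 (square_mult A) gs hs)
          = map (case_prod (square_mult A)) (permute_list \<pi> (zip gs hs))"
        using \<pi> by (intro permute_list_map) simp
      also have "permute_list \<pi> (zip gs hs) = zip (permute_list \<pi> gs) (permute_list \<pi> hs)"
        using len by (intro permute_list_zip[OF \<pi>]) auto
      finally have "permute_list \<pi> (map2 (square_mult A) gs hs)
          = map2 (square_mult A) (permute_list \<pi> gs) (permute_list \<pi> hs)" .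
      thus ?thesis
        using vb_iso_mult[OF E A _ L[OF ds gs] L[OF ds hs]] ds
        by (simp add: permute_functor_def)
    qed
  }
  fix A B :: "'a alg" and h ds gs
  assume AB: "algebra K A" "algebra K B" "h \<in> algebra_hom K A B" and ds: "length ds = m"
    and gs: "GL_list A ds gs"
  have "permute_list \<pi> (map (map_mat h) gs) = map (map_mat h) (permute_list \<pi> gs)"
    using GL_list_length[OF gs] ds \<pi> by (intro permute_list_map) simp
  thus "vb_iso (permute_functor \<pi> E) B (map (map_mat h) gs) = map_mat h (vb_iso (permute_functor \<pi> E) A gs)"
    using vb_iso_base_change[OF E AB(1) _ L[OF ds gs] AB(2,3)] ds
    by (simp add: permute_functor_def)
qed

text \<open>
  Each rule of the inductive definition preserves functoriality in the above sense; in particular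
  the value of a monomial expression on standard representations is a representation.
\<close>

theorem monomial_expression_functorial: "monomial_expression K m E \<Longrightarrow> vb_functorial K m E"
proof (induction rule: monomial_expression.induct)
  case (frobenius p r)
  thus ?case by (rule vb_functorial_frobenius)
next
  case (diagonal m E)
  thus ?case by (intro vb_functorial_diagonal)
next
  case (tensor m E)
  thus ?case by (intro vb_functorial_tensor)
next
  case (subst m E m' F)
  thus ?case by (intro vb_functorial_subst)
next
  case (permute m E \<pi>)
  thus ?case by (intro vb_functorial_permute)
qed (rule vb_functorial_sym vb_functorial_divided_power vb_functorial_ext vb_functorial_dual)+

section \<open>The inhomogeneous bar complex of a group\<close>

text \<open>
  The inhomogeneous coboundary without its first term, for functions on tuples of group elements
  with values in an abelian group.  The recursion peels off the first argument \<open>g\<close> and continues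
  with the function \<open>f(g, \<dots>)\<close> of one variable less.
\<close>

fun bar_diff :: "('a, 'b) ring_scheme \<Rightarrow> ('g, 'c) monoid_scheme \<Rightarrow> ('g list \<Rightarrow> 'a) \<Rightarrow> 'g list \<Rightarrow> 'a" where
  "bar_diff M H f [] = \<zero>\<^bsub>M\<^esub>"
| "bar_diff M H f [g] = \<ominus>\<^bsub>M\<^esub> f []"
| "bar_diff M H f (g # h # s) =
    \<ominus>\<^bsub>M\<^esub> f ((g \<otimes>\<^bsub>H\<^esub> h) # s) \<oplus>\<^bsub>M\<^esub> \<ominus>\<^bsub>M\<^esub> bar_diff M H (\<lambda>t. f (g # t)) (h # s)"

text \<open>
  The alternating sum \<open>\<Sum>\<^sub>j (-1)\<^sup>j f(g\<^sub>1, \<dots>, g\<^sub>j, z, g\<^bsub>j+1\<^esub>, \<dots>)\<close>.  For central \<open>z\<close> it is the chain homotopy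
  between the action of \<open>z\<close> on cochains and the identity.
\<close>

primrec insert_sum :: "('a, 'b) ring_scheme \<Rightarrow> 'g \<Rightarrow> ('g list \<Rightarrow> 'a) \<Rightarrow> 'g list \<Rightarrow> 'a" where
  "insert_sum M z f [] = f [z]"
| "insert_sum M z f (g # s) = f (z # g # s) \<oplus>\<^bsub>M\<^esub> \<ominus>\<^bsub>M\<^esub> insert_sum M z (\<lambda>t. f (g # t)) s"

definition bar_coboundary ::
    "('a, 'b) ring_scheme \<Rightarrow> ('g, 'c) monoid_scheme \<Rightarrow> ('g \<Rightarrow> 'a \<Rightarrow> 'a) \<Rightarrow> ('g list \<Rightarrow> 'a) \<Rightarrow> 'g list \<Rightarrow> 'a" where
  "bar_coboundary M H act f s =
    (case s of [] \<Rightarrow> \<zero>\<^bsub>M\<^esub> | g # t \<Rightarrow> act g (f t) \<oplus>\<^bsub>M\<^esub> bar_diff M H f s)"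

lemma bar_coboundary_simps [simp]:
  "bar_coboundary M H act f [] = \<zero>\<^bsub>M\<^esub>"
  "bar_coboundary M H act f (g # t) = act g (f t) \<oplus>\<^bsub>M\<^esub> bar_diff M H f (g # t)"
  by (simp_all add: bar_coboundary_def)

locale bar_complex = H: Group.monoid H + M: abelian_group M
  for H :: "('g, 'c) monoid_scheme" and M :: "('a, 'b) ring_scheme" (structure)
begin

abbreviation cochain :: "('g list \<Rightarrow> 'a) \<Rightarrow> bool" where
  "cochain f \<equiv> \<forall>s\<in>lists (carrier H). f s \<in> carrier M"

lemma bar_diff_closed [simp]:
  "cochain f \<Longrightarrow> s \<in> lists (carrier H) \<Longrightarrow> bar_diff M H f s \<in> carrier M"
proof (induction s arbitrary: f)
  case (Cons g s)
  thus ?case by (cases s) auto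
qed simp

lemma insert_sum_closed [simp]:
  "cochain f \<Longrightarrow> z \<in> carrier H \<Longrightarrow> s \<in> lists (carrier H) \<Longrightarrow> insert_sum M z f s \<in> carrier M"
  by (induction s arbitrary: f) auto

lemma minus_zero_eq: "\<ominus> \<zero> = \<zero>"
  using M.r_neg[of "\<zero>"] by simp

lemma double_minus_add:
  "a \<in> carrier M \<Longrightarrow> b \<in> carrier M \<Longrightarrow>
    \<ominus> (\<ominus> a \<oplus> \<ominus> b) = a \<oplus> b"
  by (simp add: M.minus_add)

text \<open>
  Naturality in the group and in the module at once.  It covers signs, the action of group
  elements, coordinates, base change, and the passage to constant coefficients.
\<close>

lemma bar_diff_hom:
  assumes \<phi>: "abelian_group_hom M N \<phi>"
    and \<psi>: "\<And>g h. g \<in> carrier H \<Longrightarrow> h \<in> carrier H \<Longrightarrow> \<psi> (g \<otimes>\<^bsub>H\<^esub> h) = \<psi> g \<otimes>\<^bsub>H'\<^esub> \<psi> h"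
    and f: "cochain f" "\<And>t. t \<in> lists (carrier H) \<Longrightarrow> f' (map \<psi> t) = \<phi> (f t)"
    and s: "s \<in> lists (carrier H)"
  shows "bar_diff N H' f' (map \<psi> s) = \<phi> (bar_diff M H f s)"
proof -
  interpret abelian_group_hom M N \<phi> by fact
  show ?thesis
    using f s
  proof (induction s arbitrary: f f')
    case (Cons g s)
    have mem: "g \<in> carrier H" "s \<in> lists (carrier H)"
      using Cons.prems(3) by auto
    show ?case
    proof (cases s)
      case Nil
      thus ?thesis
        using Cons.prems(1) Cons.prems(2)[of "[]"] by simp
    next
      case (Cons h t)
      have "bar_diff N H' (\<lambda>t. f' (\<psi> g # t)) (map \<psi> s) = \<phi> (bar_diff M H (\<lambda>t. f (g # t)) s)"
        using Cons.prems(1) Cons.prems(2)[of "g # _"] mem by (intro Cons.IH) auto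
      moreover have "f' (map \<psi> ((g \<otimes>\<^bsub>H\<^esub> h) # t)) = \<phi> (f ((g \<otimes>\<^bsub>H\<^esub> h) # t))"
        using mem Cons by (intro Cons.prems(2)) auto
      moreover have "bar_diff M H (\<lambda>t. f (g # t)) s \<in> carrier M"
        using Cons.prems(1) mem by simp
      ultimately show ?thesis
        using Cons.prems(1) mem Cons by (simp add: \<psi>)
    qed
  qed simp
qed

lemma insert_sum_hom:
  assumes \<phi>: "abelian_group_hom M N \<phi>" and z: "z \<in> carrier H"
    and f: "cochain f" "\<And>t. t \<in> lists (carrier H) \<Longrightarrow> f' (map \<psi> t) = \<phi> (f t)"
    and s: "s \<in> lists (carrier H)"
  shows "insert_sum N (\<psi> z) f' (map \<psi> s) = \<phi> (insert_sum M z f s)"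
proof -
  interpret abelian_group_hom M N \<phi> by fact
  show ?thesis
    using f s
  proof (induction s arbitrary: f f')
    case Nil
    show ?case
      using Nil.prems(2)[of "[z]"] z by simp
  next
    case (Cons g s)
    have mem: "g \<in> carrier H" "s \<in> lists (carrier H)"
      using Cons.prems(3) by auto
    have "insert_sum N (\<psi> z) (\<lambda>t. f' (\<psi> g # t)) (map \<psi> s) = \<phi> (insert_sum M z (\<lambda>t. f (g # t)) s)"
      using Cons.prems(1) Cons.prems(2)[of "g # _"] mem by (intro Cons.IH) auto
    moreover have "f' (map \<psi> (z # g # s)) = \<phi> (f (z # g # s))"
      using mem z by (intro Cons.prems(2)) auto
    moreover have "insert_sum M z (\<lambda>t. f (g # t)) s \<in> carrier M"
      using Cons.prems(1) mem z by simp
    ultimately show ?case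
      using Cons.prems(1) mem z by simp
  qed
qed

lemma minus_hom: "abelian_group_hom M M (\<lambda>x. \<ominus> x)"
  by (intro abelian_group_homI M.abelian_group_axioms group_hom.intro M.a_group group_hom_axioms.intro)
    (auto simp: hom_def M.minus_add)

lemma bar_diff_add:
  assumes "cochain f" "cochain f'" "s \<in> lists (carrier H)"
  shows "bar_diff M H (\<lambda>t. f t \<oplus> f' t) s = bar_diff M H f s \<oplus> bar_diff M H f' s"
  using assms
proof (induction s arbitrary: f f')
  case (Cons g s)
  show ?case
  proof (cases s)
    case (Cons h t)
    have ind: "bar_diff M H (\<lambda>t. f (g # t) \<oplus> f' (g # t)) (h # t)
        = bar_diff M H (\<lambda>t. f (g # t)) (h # t) \<oplus> bar_diff M H (\<lambda>t. f' (g # t)) (h # t)"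
      using Cons.prems Cons.IH[of "\<lambda>t. f (g # t)" "\<lambda>t. f' (g # t)"] by (simp add: Cons)
    have "bar_diff M H (\<lambda>t. f (g # t)) (h # t) \<in> carrier M"
      "bar_diff M H (\<lambda>t. f' (g # t)) (h # t) \<in> carrier M"
      using Cons.prems by (auto simp: Cons)
    thus ?thesis
      using Cons.prems by (simp add: Cons ind M.minus_add M.a_ac)
  qed (use Cons.prems in \<open>auto simp: M.minus_add\<close>)
qed simp

lemma insert_sum_add:
  assumes "cochain f" "cochain f'" "z \<in> carrier H" "s \<in> lists (carrier H)"
  shows "insert_sum M z (\<lambda>t. f t \<oplus> f' t) s = insert_sum M z f s \<oplus> insert_sum M z f' s"
  using assms
proof (induction s arbitrary: f f')
  case (Cons g s)
  have "insert_sum M z (\<lambda>t. f (g # t)) s \<in> carrier M" "insert_sum M z (\<lambda>t. f' (g # t)) s \<in> carrier M"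
    using Cons.prems by auto
  thus ?case
    using Cons.prems Cons.IH[of "\<lambda>t. f (g # t)" "\<lambda>t. f' (g # t)"] by (simp add: M.minus_add M.a_ac)
qed simp

lemma bar_diff_minus:
  "cochain f \<Longrightarrow> s \<in> lists (carrier H) \<Longrightarrow> bar_diff M H (\<lambda>t. \<ominus> f t) s = \<ominus> bar_diff M H f s"
  using bar_diff_hom[OF minus_hom, of id H f _ s] by simp

lemma insert_sum_minus:
  "cochain f \<Longrightarrow> z \<in> carrier H \<Longrightarrow> s \<in> lists (carrier H) \<Longrightarrow>
    insert_sum M z (\<lambda>t. \<ominus> f t) s = \<ominus> insert_sum M z f s"
  using insert_sum_hom[OF minus_hom, of z f _ id s] by simp

lemma bar_diff_minus_add:
  assumes "cochain f" "cochain f'" "s \<in> lists (carrier H)"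
  shows "bar_diff M H (\<lambda>t. \<ominus> f t \<oplus> \<ominus> f' t) s
    = \<ominus> bar_diff M H f s \<oplus> \<ominus> bar_diff M H f' s"
  using assms bar_diff_add[of "\<lambda>t. \<ominus> f t" "\<lambda>t. \<ominus> f' t" s]
  by (simp add: bar_diff_minus)

lemma insert_sum_minus_add:
  assumes "cochain f" "cochain f'" "z \<in> carrier H" "s \<in> lists (carrier H)"
  shows "insert_sum M z (\<lambda>t. \<ominus> f t \<oplus> \<ominus> f' t) s
    = \<ominus> insert_sum M z f s \<oplus> \<ominus> insert_sum M z f' s"
  using assms insert_sum_add[of "\<lambda>t. \<ominus> f t" "\<lambda>t. \<ominus> f' t" z s]
  by (simp add: insert_sum_minus)

text \<open>
  \<open>f\<close> and \<open>f'\<close> have to agree on the tuples of the right length only, so that a cochain of fixed degree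
  may be extended to tuples of all lengths at will.
\<close>

lemma bar_diff_cong:
  assumes "\<And>t. t \<in> lists (carrier H) \<Longrightarrow> Suc (length t) = length s \<Longrightarrow> f t = f' t"
    "s \<in> lists (carrier H)"
  shows "bar_diff M H f s = bar_diff M H f' s"
  using assms
proof (induction s arbitrary: f f')
  case (Cons g s)
  show ?case
  proof (cases s)
    case (Cons h t)
    thus ?thesis
      using Cons.prems Cons.IH[of "\<lambda>t. f (g # t)" "\<lambda>t. f' (g # t)"] by simp
  qed (use Cons.prems in auto)
qed simp

lemma insert_sum_cong:
  assumes "\<And>t. t \<in> lists (carrier H) \<Longrightarrow> length t = Suc (length s) \<Longrightarrow> f t = f' t"
    "z \<in> carrier H" "s \<in> lists (carrier H)"
  shows "insert_sum M z f s = insert_sum M z f' s"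
  using assms
proof (induction s arbitrary: f f')
  case (Cons g s)
  have "f (z # g # s) = f' (z # g # s)"
    using Cons.prems(2,3) by (intro Cons.prems(1)) auto
  moreover have "insert_sum M z (\<lambda>t. f (g # t)) s = insert_sum M z (\<lambda>t. f' (g # t)) s"
    using Cons.prems(2,3) by (intro Cons.IH Cons.prems(1)) auto
  ultimately show ?case
    by simp
qed simp

text \<open>
  By induction on the number of arguments.  Unfolding the recursion twice, all terms in which the
  first argument has been multiplied with others cancel by associativity, and what remains is the
  claim for \<open>f(g, \<dots>)\<close>.
\<close>

lemma bar_diff_bar_diff:
  assumes "cochain f" "s \<in> lists (carrier H)"
  shows "bar_diff M H (bar_diff M H f) s = \<zero>"
  using assms
proof (induction s arbitrary: f)
  case (Cons g s)
  note f = Cons.prems(1)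
  consider "s = []" | h where "s = [h]" | h k r where "s = h # k # r"
    by (metis list.exhaust)
  thus ?case
  proof cases
    case 2
    thus ?thesis using Cons.prems by (simp add: M.r_neg)
  next
    case (3 h k r)
    have mem [simp]: "g \<in> carrier H" "h \<in> carrier H" "k \<in> carrier H" "r \<in> lists (carrier H)"
      using Cons.prems(2) 3 by auto
    define cF where "cF = f ((g \<otimes>\<^bsub>H\<^esub> h \<otimes>\<^bsub>H\<^esub> k) # r)"
    define cX where "cX = bar_diff M H (\<lambda>t. f ((g \<otimes>\<^bsub>H\<^esub> h) # t)) (k # r)"
    define cY where "cY = bar_diff M H (\<lambda>t. f (g # t)) ((h \<otimes>\<^bsub>H\<^esub> k) # r)"
    define cZ where "cZ = bar_diff M H (\<lambda>t. bar_diff M H (\<lambda>t. f (g # t)) (h # t)) (k # r)"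
    have closed [simp]: "cF \<in> carrier M" "cX \<in> carrier M" "cY \<in> carrier M" "cZ \<in> carrier M"
      unfolding cF_def cX_def cY_def cZ_def using f by (simp_all del: bar_diff.simps)
    have "bar_diff M H (\<lambda>t. bar_diff M H f (g # h # t)) (k # r) = \<ominus> cX \<oplus> \<ominus> cZ"
      unfolding cX_def cZ_def bar_diff.simps(3) using f by (intro bar_diff_minus_add) auto
    hence "bar_diff M H (bar_diff M H f) (g # s)
        = (cF \<oplus> cX) \<oplus> \<ominus> ((cF \<oplus> cY) \<oplus> (cX \<oplus> cZ))"
      using 3 by (simp add: double_minus_add cF_def[symmetric] cX_def[symmetric] cY_def[symmetric] H.m_assoc[symmetric])
    also have "(cF \<oplus> cY) \<oplus> (cX \<oplus> cZ) = (cF \<oplus> cX) \<oplus> (cY \<oplus> cZ)"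
      by (simp add: M.a_ac)
    also have "(cF \<oplus> cX) \<oplus> \<ominus> ((cF \<oplus> cX) \<oplus> (cY \<oplus> cZ))
        = \<ominus> cY \<oplus> \<ominus> cZ"
      by (subst M.minus_add, simp, simp, subst M.r_neg2) (simp_all add: M.minus_add)
    also have "\<ominus> cY \<oplus> \<ominus> cZ = bar_diff M H (bar_diff M H (\<lambda>t. f (g # t))) s"
      using 3 by (simp add: cY_def cZ_def)
    also have "\<dots> = \<zero>"
      using Cons.prems by (intro Cons.IH) auto
    finally show ?thesis .
  qed simp
qed simp

text \<open>
  By induction on the number of arguments again.  The terms in which \<open>z\<close> is multiplied with a
  neighbour occur twice with opposite signs because \<open>z g = g z\<close>.  The only term without a partner is
  the one where \<open>z\<close>, inserted in the last place, is dropped by the last summand of the differential; it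
  contributes \<open>-f\<close>.
\<close>

lemma insert_sum_bar_diff:
  assumes "cochain f" "z \<in> carrier H" "s \<in> lists (carrier H)"
    and central: "\<And>g. g \<in> carrier H \<Longrightarrow> z \<otimes>\<^bsub>H\<^esub> g = g \<otimes>\<^bsub>H\<^esub> z"
  shows "insert_sum M z (bar_diff M H f) s \<oplus> bar_diff M H (insert_sum M z f) s = \<ominus> f s"
  using assms(1,3)
proof (induction s arbitrary: f)
  case Nil
  thus ?case using assms(2) by simp
next
  case (Cons g s)
  note f = Cons.prems(1)
  have mem [simp]: "g \<in> carrier H" "z \<in> carrier H"
    using Cons.prems(2) assms(2) by auto
  show ?case
  proof (cases s)
    case Nil
    have [simp]: "f [z] \<in> carrier M" "f [g] \<in> carrier M" "f [g \<otimes>\<^bsub>H\<^esub> z] \<in> carrier M"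
      using f by auto
    have "insert_sum M z (bar_diff M H f) [g] \<oplus> bar_diff M H (insert_sum M z f) [g]
        = ((\<ominus> f [g \<otimes>\<^bsub>H\<^esub> z] \<oplus> f [z]) \<oplus> (f [g \<otimes>\<^bsub>H\<^esub> z] \<oplus> \<ominus> f [g]))
          \<oplus> \<ominus> f [z]"
      using central[of g] by (simp add: M.minus_add)
    also have "\<dots> = (\<ominus> f [g \<otimes>\<^bsub>H\<^esub> z] \<oplus> f [g \<otimes>\<^bsub>H\<^esub> z]) \<oplus> ((\<ominus> f [z] \<oplus> f [z]) \<oplus> \<ominus> f [g])"
      by (simp only: M.a_ac M.a_closed M.a_inv_closed \<open>f [z] \<in> carrier M\<close> \<open>f [g] \<in> carrier M\<close>
          \<open>f [g \<otimes>\<^bsub>H\<^esub> z] \<in> carrier M\<close>)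
    also have "\<dots> = \<ominus> f [g]"
      by (simp add: M.l_neg)
    finally show ?thesis
      by (simp add: Nil)
  next
    case (Cons h r)
    have mem' [simp]: "h \<in> carrier H" "r \<in> lists (carrier H)"
      using Cons.prems(2) Cons by auto
    define cP where "cP = f ((g \<otimes>\<^bsub>H\<^esub> z) # h # r)"
    define cQ where "cQ = f (z # (g \<otimes>\<^bsub>H\<^esub> h) # r)"
    define cU where "cU = bar_diff M H (\<lambda>t. f (z # g # t)) (h # r)"
    define cV where "cV = insert_sum M z (\<lambda>t. f ((g \<otimes>\<^bsub>H\<^esub> h) # t)) r"
    define cW where "cW = insert_sum M z (bar_diff M H (\<lambda>t. f (g # t))) (h # r)"
    define cW' where "cW' = bar_diff M H (insert_sum M z (\<lambda>t. f (g # t))) (h # r)"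
    define cD where "cD = bar_diff M H (\<lambda>t. f (g # t)) (z # h # r)"
    define cI where "cI = insert_sum M z (\<lambda>t. bar_diff M H (\<lambda>t. f (g # t)) (h # t)) r"
    have closed [simp]: "cP \<in> carrier M" "cQ \<in> carrier M" "cU \<in> carrier M" "cV \<in> carrier M"
      "cW \<in> carrier M" "cW' \<in> carrier M" "cD \<in> carrier M" "cI \<in> carrier M"
      unfolding cP_def cQ_def cU_def cV_def cW_def cW'_def cD_def cI_def using f
      by (simp_all del: bar_diff.simps insert_sum.simps)
    have cW_eq: "cW = cD \<oplus> \<ominus> cI"
      by (simp add: cW_def cD_def cI_def)
    have "insert_sum M z (\<lambda>t. bar_diff M H f (g # h # t)) r = \<ominus> cV \<oplus> \<ominus> cI"
      unfolding cV_def cI_def bar_diff.simps(3) using f by (intro insert_sum_minus_add) auto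
    moreover have "bar_diff M H f (g # z # h # r) = \<ominus> cP \<oplus> \<ominus> cD"
      by (simp only: bar_diff.simps(3) cP_def cD_def)
    ultimately have s1: "insert_sum M z (\<lambda>t. bar_diff M H f (g # t)) s
        = (\<ominus> cP \<oplus> \<ominus> cD) \<oplus> (cV \<oplus> cI)"
      by (simp add: Cons double_minus_add del: bar_diff.simps)
    have s2: "bar_diff M H f (z # g # s) = \<ominus> cP \<oplus> (cQ \<oplus> cU)"
      using Cons central[of g] by (simp add: double_minus_add cP_def[symmetric] cQ_def[symmetric] cU_def[symmetric])
    have "bar_diff M H (\<lambda>t. f (z # g # t) \<oplus> \<ominus> insert_sum M z (\<lambda>t. f (g # t)) t) (h # r)
        = cU \<oplus> \<ominus> cW'"
    proof -
      have "bar_diff M H (\<lambda>t. f (z # g # t) \<oplus> \<ominus> insert_sum M z (\<lambda>t. f (g # t)) t) (h # r)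
          = bar_diff M H (\<lambda>t. \<ominus> (\<ominus> f (z # g # t)) \<oplus> \<ominus> insert_sum M z (\<lambda>t. f (g # t)) t) (h # r)"
        using f by (intro bar_diff_cong) auto
      also have "\<dots> = \<ominus> bar_diff M H (\<lambda>t. \<ominus> f (z # g # t)) (h # r) \<oplus> \<ominus> cW'"
        unfolding cW'_def using f by (intro bar_diff_minus_add) auto
      also have "bar_diff M H (\<lambda>t. \<ominus> f (z # g # t)) (h # r) = \<ominus> cU"
        unfolding cU_def using f by (intro bar_diff_minus) auto
      finally show ?thesis by simp
    qed
    hence s3: "bar_diff M H (insert_sum M z f) (g # s)
        = (\<ominus> cQ \<oplus> cV) \<oplus> (\<ominus> cU \<oplus> cW')"
      using Cons by (simp add: M.minus_add cQ_def[symmetric] cV_def[symmetric])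
    have IH: "cW \<oplus> cW' = \<ominus> f (g # s)"
      unfolding cW_def cW'_def using Cons.prems Cons Cons.IH[of "\<lambda>t. f (g # t)"] by simp
    have "insert_sum M z (bar_diff M H f) (g # s) \<oplus> bar_diff M H (insert_sum M z f) (g # s)
        = (\<ominus> cP \<oplus> (cQ \<oplus> cU)) \<oplus> \<ominus> ((\<ominus> cP \<oplus> \<ominus> cD) \<oplus> (cV \<oplus> cI))
          \<oplus> ((\<ominus> cQ \<oplus> cV) \<oplus> (\<ominus> cU \<oplus> cW'))"
      by (simp only: insert_sum.simps s1 s2 s3)
    also have "\<dots> = (\<ominus> cP \<oplus> cP) \<oplus> ((\<ominus> cQ \<oplus> cQ) \<oplus> ((\<ominus> cU \<oplus> cU)
        \<oplus> ((\<ominus> cV \<oplus> cV) \<oplus> ((cD \<oplus> \<ominus> cI) \<oplus> cW'))))"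
      by (simp only: M.minus_add M.minus_minus M.a_ac M.a_closed M.a_inv_closed closed)
    also have "\<dots> = cW \<oplus> cW'"
      by (simp add: M.l_neg cW_eq)
    finally show ?thesis
      by (simp only: IH)
  qed
qed

end

locale group_module = bar_complex H M
  for H :: "('g, 'c) monoid_scheme" and M :: "('a, 'b) ring_scheme" (structure) +
  fixes act :: "'g \<Rightarrow> 'a \<Rightarrow> 'a"
  assumes act_closed [simp]: "g \<in> carrier H \<Longrightarrow> x \<in> carrier M \<Longrightarrow> act g x \<in> carrier M"
    and act_add: "g \<in> carrier H \<Longrightarrow> x \<in> carrier M \<Longrightarrow> y \<in> carrier M \<Longrightarrow>
      act g (x \<oplus> y) = act g x \<oplus> act g y"
    and act_mult: "g \<in> carrier H \<Longrightarrow> h \<in> carrier H \<Longrightarrow> x \<in> carrier M \<Longrightarrow>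
      act (g \<otimes>\<^bsub>H\<^esub> h) x = act g (act h x)"
begin

lemma act_hom: "g \<in> carrier H \<Longrightarrow> abelian_group_hom M M (act g)"
  by (intro abelian_group_homI M.abelian_group_axioms group_hom.intro M.a_group group_hom_axioms.intro)
    (auto simp: hom_def act_add)

lemma bar_diff_act:
  "cochain f \<Longrightarrow> g \<in> carrier H \<Longrightarrow> s \<in> lists (carrier H) \<Longrightarrow>
    bar_diff M H (\<lambda>t. act g (f t)) s = act g (bar_diff M H f s)"
  using bar_diff_hom[OF act_hom, of g id H f _ s] by simp

lemma insert_sum_act:
  "cochain f \<Longrightarrow> g \<in> carrier H \<Longrightarrow> z \<in> carrier H \<Longrightarrow> s \<in> lists (carrier H) \<Longrightarrow>
    insert_sum M z (\<lambda>t. act g (f t)) s = act g (insert_sum M z f s)"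
  using insert_sum_hom[OF act_hom, of g z f _ id s] by simp

lemma bar_coboundary_closed:
  "cochain f \<Longrightarrow> s \<in> lists (carrier H) \<Longrightarrow> bar_coboundary M H act f s \<in> carrier M"
  by (cases s) auto

lemma bar_coboundary_add:
  assumes "cochain f" "cochain f'" "s \<in> lists (carrier H)"
  shows "bar_coboundary M H act (\<lambda>t. f t \<oplus> f' t) s
    = bar_coboundary M H act f s \<oplus> bar_coboundary M H act f' s"
proof (cases s)
  case (Cons g t)
  have "bar_diff M H f (g # t) \<in> carrier M" "bar_diff M H f' (g # t) \<in> carrier M"
    using assms Cons by auto
  thus ?thesis
    using assms Cons by (simp add: bar_diff_add act_add M.a_ac)
qed simp

lemma bar_coboundary_cong:
  assumes "\<And>t. t \<in> lists (carrier H) \<Longrightarrow> Suc (length t) = length s \<Longrightarrow> f t = f' t"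
    "s \<in> lists (carrier H)"
  shows "bar_coboundary M H act f s = bar_coboundary M H act f' s"
  using assms bar_diff_cong[of s f f'] by (cases s) auto

text \<open>
  The coboundary is the sum of \<open>bar_diff\<close> and of the operator \<open>L\<close> with \<open>(L f)(g, t) = g f(t)\<close>.  Since
  \<open>bar_diff\<close> has square zero and commutes with the action of \<open>g\<close>, the remaining terms cancel by
  multiplicativity of the action.
\<close>

theorem bar_coboundary_bar_coboundary:
  assumes f: "cochain f" and s: "s \<in> lists (carrier H)" "length s \<ge> 2"
  shows "bar_coboundary M H act (bar_coboundary M H act f) s = \<zero>"
proof -
  obtain g h r where s_eq: "s = g # h # r"
    using s(2) by (cases s; cases "tl s") auto
  have mem [simp]: "g \<in> carrier H" "h \<in> carrier H" "r \<in> lists (carrier H)"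
    using s s_eq by auto
  let ?d = "bar_coboundary M H act f" and ?b = "bar_diff M H f"
  define L where "L = (\<lambda>t. case t of [] \<Rightarrow> \<zero> | k # t' \<Rightarrow> act k (f t'))"
  have L: "cochain L"
  proof
    fix t assume "t \<in> lists (carrier H)"
    thus "L t \<in> carrier M"
      using f by (cases t) (simp_all add: L_def)
  qed
  have b: "cochain ?b"
    using f by simp
  interpret g: abelian_group_hom M M "act g" by (rule act_hom) simp
  have "bar_diff M H ?d s = bar_diff M H (\<lambda>t. L t \<oplus> ?b t) s"
  proof (rule bar_diff_cong)
    fix t assume "t \<in> lists (carrier H)"
    thus "?d t = L t \<oplus> ?b t"
      by (cases t) (auto simp: L_def)
  qed (rule s)
  also have "\<dots> = bar_diff M H L s \<oplus> bar_diff M H ?b s"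
    using L b s(1) by (rule bar_diff_add)
  also have "bar_diff M H ?b s = \<zero>"
    using f s(1) by (rule bar_diff_bar_diff)
  also have "bar_diff M H L s = \<ominus> act g (act h (f r)) \<oplus> \<ominus> act g (?b (h # r))"
    using f by (simp add: s_eq L_def act_mult bar_diff_act)
  finally have "bar_diff M H ?d s
      = \<ominus> act g (act h (f r)) \<oplus> \<ominus> act g (?b (h # r))"
    using f by simp
  moreover have "act g (?d (h # r)) = act g (act h (f r)) \<oplus> act g (?b (h # r))"
    using f by simp
  moreover have "bar_coboundary M H act ?d s = act g (?d (h # r)) \<oplus> bar_diff M H ?d s"
    by (simp add: s_eq)
  moreover have "act g (act h (f r)) \<in> carrier M" "act g (?b (h # r)) \<in> carrier M"
    using f by simp_all
  ultimately show ?thesis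
    by (simp add: M.r_neg flip: M.minus_add)
qed

text \<open>
  With \<open>L\<close> as before, inserting \<open>z\<close> in the first place of \<open>L f\<close> gives \<open>z f\<close>, whereas the other places
  commute with \<open>L\<close>.  Together with the contribution \<open>-f\<close> of \<open>bar_diff\<close> this gives \<open>z f - f\<close>.
\<close>

theorem insert_sum_homotopy:
  assumes f: "cochain f" and z: "z \<in> carrier H" and s: "s \<in> lists (carrier H)"
    and central: "\<And>g. g \<in> carrier H \<Longrightarrow> z \<otimes>\<^bsub>H\<^esub> g = g \<otimes>\<^bsub>H\<^esub> z"
  shows "insert_sum M z (bar_coboundary M H act f) s \<oplus> bar_coboundary M H act (insert_sum M z f) s
    = act z (f s) \<oplus> \<ominus> f s"
proof (cases s)
  case Nil
  thus ?thesis using f z by simp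
next
  case (Cons g t)
  have mem: "g \<in> carrier H" "t \<in> lists (carrier H)"
    using s Cons by auto
  define L where "L = (\<lambda>t. case t of [] \<Rightarrow> \<zero> | k # t' \<Rightarrow> act k (f t'))"
  have L: "cochain L"
  proof
    fix t assume "t \<in> lists (carrier H)"
    thus "L t \<in> carrier M"
      using f by (cases t) (simp_all add: L_def)
  qed
  let ?a = "act g (insert_sum M z f t)" and ?I = "insert_sum M z (bar_diff M H f) s"
    and ?J = "bar_diff M H (insert_sum M z f) s"
  have [simp]: "act z (f s) \<in> carrier M" "?a \<in> carrier M" "?I \<in> carrier M" "?J \<in> carrier M"
    using f z s mem by simp_all
  have "insert_sum M z (bar_coboundary M H act f) s
      = insert_sum M z (\<lambda>t. L t \<oplus> bar_diff M H f t) s"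
  proof (rule insert_sum_cong)
    fix t assume "t \<in> lists (carrier H)"
    thus "bar_coboundary M H act f t = L t \<oplus> bar_diff M H f t"
      by (cases t) (auto simp: L_def)
  qed (use z s in auto)
  also have "\<dots> = insert_sum M z L s \<oplus> ?I"
    using L f z s by (intro insert_sum_add) auto
  also have "insert_sum M z L s = act z (f s) \<oplus> \<ominus> ?a"
    using f z mem by (simp add: Cons L_def insert_sum_act)
  finally have "insert_sum M z (bar_coboundary M H act f) s \<oplus> bar_coboundary M H act (insert_sum M z f) s
      = ((act z (f s) \<oplus> \<ominus> ?a) \<oplus> ?I) \<oplus> (?a \<oplus> ?J)"
    by (simp add: Cons)
  also have "\<dots> = (act z (f s) \<oplus> (\<ominus> ?a \<oplus> ?a)) \<oplus> (?I \<oplus> ?J)"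
    by (simp add: M.a_ac)
  also have "\<dots> = act z (f s) \<oplus> (?I \<oplus> ?J)"
    by (simp add: M.l_neg)
  also have "?I \<oplus> ?J = \<ominus> f s"
    using f z s central by (rule insert_sum_bar_diff)
  finally show ?thesis .
qed

end

section \<open>Group algebras of finite cyclic groups\<close>

text \<open>
  Addition and subtraction of residues modulo \<open>N\<close> for arguments in \<open>{..<N}\<close>.  Stated with case
  distinctions, their laws are linear arithmetic.
\<close>

definition cyc_add :: "nat \<Rightarrow> nat \<Rightarrow> nat \<Rightarrow> nat" where
  "cyc_add N i j = (if i + j < N then i + j else i + j - N)"

definition cyc_diff :: "nat \<Rightarrow> nat \<Rightarrow> nat \<Rightarrow> nat" where
  "cyc_diff N k i = (if i \<le> k then k - i else k + N - i)"

lemma cyc_diff_less [simp]: "k < N \<Longrightarrow> i < N \<Longrightarrow> cyc_diff N k i < N"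
  by (auto simp: cyc_diff_def)

lemma bij_betw_cyc_add: "i < N \<Longrightarrow> bij_betw (cyc_add N i) {..<N} {..<N}"
  by (rule bij_betw_byWitness[where f' = "\<lambda>m. cyc_diff N m i"]) (auto simp: cyc_add_def cyc_diff_def)

lemma bij_betw_cyc_diff: "k < N \<Longrightarrow> bij_betw (cyc_diff N k) {..<N} {..<N}"
  by (rule bij_betw_byWitness[where f' = "cyc_diff N k"]) (auto simp: cyc_diff_def)

lemma cyc_diff_cyc_add: "i < N \<Longrightarrow> j < N \<Longrightarrow> cyc_diff N (cyc_add N i j) i = j"
  by (auto simp: cyc_add_def cyc_diff_def)

lemma cyc_diff_of_cyc_add:
  "k < N \<Longrightarrow> i < N \<Longrightarrow> j < N \<Longrightarrow> cyc_diff N k (cyc_add N i j) = cyc_diff N (cyc_diff N k i) j"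
  by (auto simp: cyc_add_def cyc_diff_def)

lemma cyc_diff_cyc_diff: "k < N \<Longrightarrow> i < N \<Longrightarrow> cyc_diff N k (cyc_diff N k i) = i"
  by (auto simp: cyc_diff_def)

text \<open>
  The \<open>k\<close>-th coefficient of the product of \<open>\<Sum>\<^sub>i p\<^sub>i x\<^sup>i\<close> and \<open>\<Sum>\<^sub>i q\<^sub>i x\<^sup>i\<close> modulo \<open>x\<^sup>N - 1\<close>.
\<close>

definition cyc_conv :: "('a, 'b) ring_scheme \<Rightarrow> nat \<Rightarrow> (nat \<Rightarrow> 'a) \<Rightarrow> (nat \<Rightarrow> 'a) \<Rightarrow> nat \<Rightarrow> 'a" where
  "cyc_conv A N p q k = (\<Oplus>\<^bsub>A\<^esub>i\<in>{..<N}. p i \<otimes>\<^bsub>A\<^esub> q (cyc_diff N k i))"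

context cring
begin

lemma cyc_conv_closed:
  assumes "\<And>i. i < N \<Longrightarrow> p i \<in> carrier R" "\<And>i. i < N \<Longrightarrow> q i \<in> carrier R" "k < N"
  shows "cyc_conv R N p q k \<in> carrier R"
  unfolding cyc_conv_def using assms by (intro finsum_closed) auto

lemma cyc_conv_commute:
  assumes "\<And>i. i < N \<Longrightarrow> p i \<in> carrier R" "\<And>i. i < N \<Longrightarrow> q i \<in> carrier R" "k < N"
  shows "cyc_conv R N p q k = cyc_conv R N q p k"
proof -
  have "cyc_conv R N p q k
      = (\<Oplus>i\<in>{..<N}. p (cyc_diff N k i) \<otimes> q (cyc_diff N k (cyc_diff N k i)))"
    unfolding cyc_conv_def using assms
    by (intro finsum_reindex_bij[symmetric, OF bij_betw_cyc_diff]) auto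
  also have "\<dots> = cyc_conv R N q p k"
    unfolding cyc_conv_def using assms
    by (intro finsum_cong') (auto simp: cyc_diff_cyc_diff m_comm)
  finally show ?thesis .
qed

lemma cyc_conv_assoc:
  assumes p: "\<And>i. i < N \<Longrightarrow> p i \<in> carrier R" and q: "\<And>i. i < N \<Longrightarrow> q i \<in> carrier R"
    and r: "\<And>i. i < N \<Longrightarrow> r i \<in> carrier R" and k: "k < N"
  shows "cyc_conv R N (cyc_conv R N p q) r k = cyc_conv R N p (cyc_conv R N q r) k"
proof -
  note [simp] = p q r k
  have "cyc_conv R N (cyc_conv R N p q) r k
      = (\<Oplus>m\<in>{..<N}. \<Oplus>i\<in>{..<N}. p i \<otimes> q (cyc_diff N m i) \<otimes> r (cyc_diff N k m))"
    unfolding cyc_conv_def by (intro finsum_cong' refl finsum_ldistr) (auto intro!: finsum_closed)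
  also have "\<dots> = (\<Oplus>i\<in>{..<N}. \<Oplus>m\<in>{..<N}. p i \<otimes> q (cyc_diff N m i) \<otimes> r (cyc_diff N k m))"
    by (intro finsum_commute) auto
  also have "\<dots> = (\<Oplus>i\<in>{..<N}. \<Oplus>j\<in>{..<N}. p i \<otimes> (q j \<otimes> r (cyc_diff N (cyc_diff N k i) j)))"
  proof (rule finsum_cong'[OF refl])
    fix i assume "i \<in> {..<N}"
    hence i [simp]: "i < N" by simp
    have "(\<Oplus>m\<in>{..<N}. p i \<otimes> q (cyc_diff N m i) \<otimes> r (cyc_diff N k m))
        = (\<Oplus>j\<in>{..<N}. p i \<otimes> q (cyc_diff N (cyc_add N i j) i) \<otimes> r (cyc_diff N k (cyc_add N i j)))"
      by (intro finsum_reindex_bij[symmetric, OF bij_betw_cyc_add]) auto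
    also have "\<dots> = (\<Oplus>j\<in>{..<N}. p i \<otimes> (q j \<otimes> r (cyc_diff N (cyc_diff N k i) j)))"
      by (intro finsum_cong') (auto simp: cyc_diff_cyc_add cyc_diff_of_cyc_add m_assoc)
    finally show "(\<Oplus>m\<in>{..<N}. p i \<otimes> q (cyc_diff N m i) \<otimes> r (cyc_diff N k m))
        = (\<Oplus>j\<in>{..<N}. p i \<otimes> (q j \<otimes> r (cyc_diff N (cyc_diff N k i) j)))" .
  qed (auto intro!: finsum_closed)
  also have "\<dots> = cyc_conv R N p (cyc_conv R N q r) k"
    unfolding cyc_conv_def
    by (intro finsum_cong' refl finsum_rdistr[symmetric]) (auto intro!: finsum_closed)
  finally show ?thesis .
qed

lemma cyc_conv_single:
  assumes "c \<in> carrier R" "\<And>i. i < N \<Longrightarrow> q i \<in> carrier R" "i < N" "k < N"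
  shows "cyc_conv R N (\<lambda>j. if j = i then c else \<zero>) q k = c \<otimes> q (cyc_diff N k i)"
  unfolding cyc_conv_def
  using assms finsum_eq_single[of "{..<N}" i "\<lambda>j. (if j = i then c else \<zero>) \<otimes> q (cyc_diff N k j)"]
  by simp

lemma cyc_conv_add:
  assumes "\<And>i. i < N \<Longrightarrow> p i \<in> carrier R" "\<And>i. i < N \<Longrightarrow> p' i \<in> carrier R"
    "\<And>i. i < N \<Longrightarrow> q i \<in> carrier R" "k < N"
  shows "cyc_conv R N (\<lambda>i. p i \<oplus> p' i) q k = cyc_conv R N p q k \<oplus> cyc_conv R N p' q k"
proof -
  have "cyc_conv R N (\<lambda>i. p i \<oplus> p' i) q k
      = (\<Oplus>i\<in>{..<N}. p i \<otimes> q (cyc_diff N k i) \<oplus> p' i \<otimes> q (cyc_diff N k i))"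
    unfolding cyc_conv_def using assms by (intro finsum_cong') (auto simp: l_distr)
  also have "\<dots> = cyc_conv R N p q k \<oplus> cyc_conv R N p' q k"
    unfolding cyc_conv_def using assms by (intro finsum_addf) auto
  finally show ?thesis .
qed

lemma cyc_conv_cong:
  assumes "\<And>i. i < N \<Longrightarrow> p i = p' i" "\<And>i. i < N \<Longrightarrow> q i = q' i"
    "\<And>i. i < N \<Longrightarrow> p' i \<in> carrier R" "\<And>i. i < N \<Longrightarrow> q' i \<in> carrier R" "k < N"
  shows "cyc_conv R N p q k = cyc_conv R N p' q' k"
  unfolding cyc_conv_def using assms by (intro finsum_cong') auto

end

subsection \<open>Realization inside the type of lists\<close>

text \<open>
  Lists of lists are coded by lists: the members of an inner list are preceded by \<open>a\<close>, its end is
  marked by \<open>b\<close>.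
\<close>

lemma ex_inj_list_list_code:
  assumes "a \<noteq> (b :: 'k)"
  shows "\<exists>c :: 'k list list \<Rightarrow> 'k list. inj c"
proof -
  define e where "e xs = concat (map (\<lambda>x. [a, x]) xs) @ [b]" for xs :: "'k list"
  have e: "e xs @ u = e ys @ v \<longleftrightarrow> xs = ys \<and> u = v" for xs ys u v
  proof (induction xs arbitrary: ys)
    case Nil
    show ?case using assms by (cases ys) (auto simp: e_def)
  next
    case (Cons x xs)
    show ?case using assms Cons.IH by (cases ys) (auto simp: e_def)
  qed
  have e_ne: "e xs \<noteq> []" for xs
    by (simp add: e_def)
  have "xss = yss" if "concat (map e xss) = concat (map e yss)" for xss yss
    using that
  proof (induction xss arbitrary: yss)
    case Nil
    thus ?case using e_ne by (cases yss) auto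
  next
    case (Cons xs xss)
    thus ?case using e e_ne by (cases yss) auto
  qed
  thus ?thesis
    by (intro exI[of _ "\<lambda>xss. concat (map e xss)"] injI)
qed

definition list_list_code :: "'k list list \<Rightarrow> 'k list" where
  "list_list_code = (SOME c. inj c)"

definition cyc_elem :: "nat \<Rightarrow> (nat \<Rightarrow> 'k list) \<Rightarrow> 'k list" where
  "cyc_elem N p = list_list_code (map p [0..<N])"

definition cyc_coeff :: "'k list \<Rightarrow> nat \<Rightarrow> 'k list" where
  "cyc_coeff x k = inv_into UNIV list_list_code x ! k"

text \<open>The group algebra \<open>A[\<int>/N]\<close>, that is \<open>A[x]/(x\<^sup>N - 1)\<close>.\<close>

definition cyc_algebra :: "nat \<Rightarrow> 'k alg \<Rightarrow> 'k alg" where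
  "cyc_algebra N A =
    \<lparr>carrier = cyc_elem N ` {p. \<forall>k<N. p k \<in> carrier A},
     monoid.mult = (\<lambda>x y. cyc_elem N (cyc_conv A N (cyc_coeff x) (cyc_coeff y))),
     one = cyc_elem N (\<lambda>k. if k = 0 then \<one>\<^bsub>A\<^esub> else \<zero>\<^bsub>A\<^esub>),
     ring.zero = cyc_elem N (\<lambda>k. \<zero>\<^bsub>A\<^esub>),
     ring.add = (\<lambda>x y. cyc_elem N (\<lambda>k. cyc_coeff x k \<oplus>\<^bsub>A\<^esub> cyc_coeff y k)),
     smult = (\<lambda>c x. cyc_elem N (\<lambda>k. c \<odot>\<^bsub>A\<^esub> cyc_coeff x k))\<rparr>"

lemma cyc_algebra_simps:
  "carrier (cyc_algebra N A) = cyc_elem N ` {p. \<forall>k<N. p k \<in> carrier A}"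
  "x \<otimes>\<^bsub>cyc_algebra N A\<^esub> y = cyc_elem N (cyc_conv A N (cyc_coeff x) (cyc_coeff y))"
  "\<one>\<^bsub>cyc_algebra N A\<^esub> = cyc_elem N (\<lambda>k. if k = 0 then \<one>\<^bsub>A\<^esub> else \<zero>\<^bsub>A\<^esub>)"
  "\<zero>\<^bsub>cyc_algebra N A\<^esub> = cyc_elem N (\<lambda>k. \<zero>\<^bsub>A\<^esub>)"
  "x \<oplus>\<^bsub>cyc_algebra N A\<^esub> y = cyc_elem N (\<lambda>k. cyc_coeff x k \<oplus>\<^bsub>A\<^esub> cyc_coeff y k)"
  "c \<odot>\<^bsub>cyc_algebra N A\<^esub> x = cyc_elem N (\<lambda>k. c \<odot>\<^bsub>A\<^esub> cyc_coeff x k)"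
  by (simp_all add: cyc_algebra_def)

lemma cyc_elem_cong: "(\<And>k. k < N \<Longrightarrow> p k = q k) \<Longrightarrow> cyc_elem N p = cyc_elem N q"
  by (auto simp: cyc_elem_def intro!: arg_cong[where f = list_list_code])

text \<open>The field \<open>K\<close> provides the two distinct elements of \<open>'k\<close> which the coding requires.\<close>

locale cyclic_group_algebra =
  fixes K :: "('k, 'b) ring_scheme" and N :: nat
  assumes field_K: "field K" and N_pos: "0 < N"
begin

lemma inj_list_list_code: "inj (list_list_code :: 'k list list \<Rightarrow> 'k list)"
proof -
  have "\<zero>\<^bsub>K\<^esub> \<noteq> \<one>\<^bsub>K\<^esub>"
    using field_K by (simp add: field.axioms domain.zero_not_one)
  thus ?thesis
    unfolding list_list_code_def by (rule someI_ex[OF ex_inj_list_list_code])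
qed

lemma cyc_coeff_elem [simp]: "k < N \<Longrightarrow> cyc_coeff (cyc_elem N p :: 'k list) k = p k"
  using inj_list_list_code by (simp add: cyc_coeff_def cyc_elem_def)

lemma cyc_elem_closed: "(\<And>k. k < N \<Longrightarrow> p k \<in> carrier A) \<Longrightarrow> cyc_elem N p \<in> carrier (cyc_algebra N A)"
  for A :: "'k alg"
  by (auto simp: cyc_algebra_simps)

lemma cyc_coeff_closed [simp]:
  "x \<in> carrier (cyc_algebra N A) \<Longrightarrow> k < N \<Longrightarrow> cyc_coeff x k \<in> carrier A" for A :: "'k alg"
  by (auto simp: cyc_algebra_simps)

lemma cyc_elem_coeff: "x \<in> carrier (cyc_algebra N A) \<Longrightarrow> cyc_elem N (cyc_coeff x) = x" for A :: "'k alg"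
  by (auto simp: cyc_algebra_simps intro!: cyc_elem_cong)

lemma cyc_eqI:
  fixes A :: "'k alg"
  assumes "x \<in> carrier (cyc_algebra N A)" "y \<in> carrier (cyc_algebra N A)"
    "\<And>k. k < N \<Longrightarrow> cyc_coeff x k = cyc_coeff y k"
  shows "x = y"
proof -
  have "cyc_elem N (cyc_coeff x) = cyc_elem N (cyc_coeff y)"
    using assms(3) by (rule cyc_elem_cong)
  thus ?thesis
    by (simp add: cyc_elem_coeff[OF assms(1)] cyc_elem_coeff[OF assms(2)])
qed

lemma algebra_cyc_algebra:
  fixes A :: "'k alg"
  assumes A: "algebra K A"
  shows "algebra K (cyc_algebra N A)"
proof -
  interpret A: algebra K A by fact
  let ?B = "cyc_algebra N A"
  note c = cyc_coeff_closed[of _ A]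
  have one: "\<one>\<^bsub>?B\<^esub> \<in> carrier ?B" and zero: "\<zero>\<^bsub>?B\<^esub> \<in> carrier ?B"
    unfolding cyc_algebra_simps(3,4) by (auto intro!: cyc_elem_closed)
  have mult: "x \<otimes>\<^bsub>?B\<^esub> y \<in> carrier ?B" and add: "x \<oplus>\<^bsub>?B\<^esub> y \<in> carrier ?B"
    if "x \<in> carrier ?B" "y \<in> carrier ?B" for x y
    using that unfolding cyc_algebra_simps(2,5) by (auto intro!: cyc_elem_closed A.cyc_conv_closed)
  have smult: "r \<odot>\<^bsub>?B\<^esub> x \<in> carrier ?B" if "r \<in> carrier K" "x \<in> carrier ?B" for r x
    using that unfolding cyc_algebra_simps(6) by (auto intro!: cyc_elem_closed)
  have abelian: "abelian_group ?B"
  proof (rule abelian_groupI)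
    fix x assume x: "x \<in> carrier ?B"
    have "cyc_elem N (\<lambda>k. \<ominus>\<^bsub>A\<^esub> cyc_coeff x k) \<in> carrier ?B"
      using x by (auto intro!: cyc_elem_closed)
    moreover have "cyc_elem N (\<lambda>k. \<ominus>\<^bsub>A\<^esub> cyc_coeff x k) \<oplus>\<^bsub>?B\<^esub> x = \<zero>\<^bsub>?B\<^esub>"
      using x unfolding cyc_algebra_simps(4,5) by (intro cyc_elem_cong) (auto simp: A.M.l_neg)
    ultimately show "\<exists>y\<in>carrier ?B. y \<oplus>\<^bsub>?B\<^esub> x = \<zero>\<^bsub>?B\<^esub>"
      by blast
    show "\<zero>\<^bsub>?B\<^esub> \<oplus>\<^bsub>?B\<^esub> x = x"
    proof (rule cyc_eqI[OF add[OF zero x] x])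
      fix k assume "k < N"
      thus "cyc_coeff (\<zero>\<^bsub>?B\<^esub> \<oplus>\<^bsub>?B\<^esub> x) k = cyc_coeff x k"
        using x by (simp add: cyc_algebra_simps(4,5))
    qed
  next
    fix x y z assume xyz: "x \<in> carrier ?B" "y \<in> carrier ?B" "z \<in> carrier ?B"
    show "x \<oplus>\<^bsub>?B\<^esub> y \<oplus>\<^bsub>?B\<^esub> z = x \<oplus>\<^bsub>?B\<^esub> (y \<oplus>\<^bsub>?B\<^esub> z)"
      using xyz unfolding cyc_algebra_simps(5) by (intro cyc_elem_cong) (auto simp: A.M.a_assoc)
  next
    fix x y assume xy: "x \<in> carrier ?B" "y \<in> carrier ?B"
    show "x \<oplus>\<^bsub>?B\<^esub> y = y \<oplus>\<^bsub>?B\<^esub> x"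
      using xy unfolding cyc_algebra_simps(5) by (intro cyc_elem_cong) (auto simp: A.M.a_comm)
  qed (use add zero in auto)
  have "comm_monoid ?B"
  proof (rule comm_monoidI)
    fix x y z assume xyz: "x \<in> carrier ?B" "y \<in> carrier ?B" "z \<in> carrier ?B"
    show "x \<otimes>\<^bsub>?B\<^esub> y \<otimes>\<^bsub>?B\<^esub> z = x \<otimes>\<^bsub>?B\<^esub> (y \<otimes>\<^bsub>?B\<^esub> z)"
      unfolding cyc_algebra_simps(2)
    proof (rule cyc_elem_cong)
      fix k assume k: "k < N"
      let ?x = "cyc_coeff x" and ?y = "cyc_coeff y" and ?z = "cyc_coeff z"
      have "cyc_conv A N (cyc_coeff (cyc_elem N (cyc_conv A N ?x ?y))) ?z k
          = cyc_conv A N (cyc_conv A N ?x ?y) ?z k"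
        using xyz k by (intro A.cyc_conv_cong) (auto intro!: A.cyc_conv_closed)
      also have "\<dots> = cyc_conv A N ?x (cyc_conv A N ?y ?z) k"
        using xyz k by (intro A.cyc_conv_assoc) auto
      also have "\<dots> = cyc_conv A N ?x (cyc_coeff (cyc_elem N (cyc_conv A N ?y ?z))) k"
        using xyz k by (intro A.cyc_conv_cong) (auto intro!: A.cyc_conv_closed)
      finally show "cyc_conv A N (cyc_coeff (cyc_elem N (cyc_conv A N ?x ?y))) ?z k
          = cyc_conv A N ?x (cyc_coeff (cyc_elem N (cyc_conv A N ?y ?z))) k" .
    qed
  next
    fix x assume x: "x \<in> carrier ?B"
    show "\<one>\<^bsub>?B\<^esub> \<otimes>\<^bsub>?B\<^esub> x = x"
    proof (rule cyc_eqI[OF mult[OF one x] x])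
      fix k assume k: "k < N"
      have "cyc_coeff (\<one>\<^bsub>?B\<^esub> \<otimes>\<^bsub>?B\<^esub> x) k = cyc_conv A N (cyc_coeff \<one>\<^bsub>?B\<^esub>) (cyc_coeff x) k"
        using k by (simp add: cyc_algebra_simps(2))
      also have "\<dots> = cyc_conv A N (\<lambda>k. if k = 0 then \<one>\<^bsub>A\<^esub> else \<zero>\<^bsub>A\<^esub>) (cyc_coeff x) k"
        using x k by (intro A.cyc_conv_cong) (auto simp: cyc_algebra_simps(3))
      also have "\<dots> = cyc_coeff x k"
        using x k N_pos A.cyc_conv_single[of "\<one>\<^bsub>A\<^esub>" N "cyc_coeff x" 0 k]
        by (simp add: cyc_diff_def)
      finally show "cyc_coeff (\<one>\<^bsub>?B\<^esub> \<otimes>\<^bsub>?B\<^esub> x) k = cyc_coeff x k" .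
    qed
  next
    fix x y assume xy: "x \<in> carrier ?B" "y \<in> carrier ?B"
    show "x \<otimes>\<^bsub>?B\<^esub> y = y \<otimes>\<^bsub>?B\<^esub> x"
      using xy unfolding cyc_algebra_simps(2) by (intro cyc_elem_cong A.cyc_conv_commute) auto
  qed (use mult one in auto)
  moreover have "(x \<oplus>\<^bsub>?B\<^esub> y) \<otimes>\<^bsub>?B\<^esub> z = x \<otimes>\<^bsub>?B\<^esub> z \<oplus>\<^bsub>?B\<^esub> y \<otimes>\<^bsub>?B\<^esub> z"
    if xyz: "x \<in> carrier ?B" "y \<in> carrier ?B" "z \<in> carrier ?B" for x y z
    unfolding cyc_algebra_simps(2,5)
  proof (rule cyc_elem_cong)
    fix k assume k: "k < N"
    have "cyc_conv A N (cyc_coeff (cyc_elem N (\<lambda>k. cyc_coeff x k \<oplus>\<^bsub>A\<^esub> cyc_coeff y k))) (cyc_coeff z) k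
        = cyc_conv A N (\<lambda>k. cyc_coeff x k \<oplus>\<^bsub>A\<^esub> cyc_coeff y k) (cyc_coeff z) k"
      using xyz k by (intro A.cyc_conv_cong) auto
    also have "\<dots> = cyc_conv A N (cyc_coeff x) (cyc_coeff z) k \<oplus>\<^bsub>A\<^esub> cyc_conv A N (cyc_coeff y) (cyc_coeff z) k"
      using xyz k by (intro A.cyc_conv_add) auto
    finally show "cyc_conv A N (cyc_coeff (cyc_elem N (\<lambda>k. cyc_coeff x k \<oplus>\<^bsub>A\<^esub> cyc_coeff y k))) (cyc_coeff z) k
        = cyc_coeff (cyc_elem N (cyc_conv A N (cyc_coeff x) (cyc_coeff z))) k \<oplus>\<^bsub>A\<^esub>
          cyc_coeff (cyc_elem N (cyc_conv A N (cyc_coeff y) (cyc_coeff z))) k"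
      using k by simp
  qed
  ultimately have cring: "cring ?B"
    using abelian by (intro cringI)
  show ?thesis
  proof (rule algebraI)
    fix r x y assume rxy: "r \<in> carrier K" "x \<in> carrier ?B" "y \<in> carrier ?B"
    show "r \<odot>\<^bsub>?B\<^esub> (x \<oplus>\<^bsub>?B\<^esub> y) = r \<odot>\<^bsub>?B\<^esub> x \<oplus>\<^bsub>?B\<^esub> r \<odot>\<^bsub>?B\<^esub> y"
      using rxy unfolding cyc_algebra_simps(5,6) by (intro cyc_elem_cong) (auto simp: A.smult_r_distr)
    show "(r \<odot>\<^bsub>?B\<^esub> x) \<otimes>\<^bsub>?B\<^esub> y = r \<odot>\<^bsub>?B\<^esub> (x \<otimes>\<^bsub>?B\<^esub> y)"
      unfolding cyc_algebra_simps(2,6)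
    proof (rule cyc_elem_cong)
      fix k assume k: "k < N"
      have "cyc_conv A N (cyc_coeff (cyc_elem N (\<lambda>k. r \<odot>\<^bsub>A\<^esub> cyc_coeff x k))) (cyc_coeff y) k
          = cyc_conv A N (\<lambda>k. r \<odot>\<^bsub>A\<^esub> cyc_coeff x k) (cyc_coeff y) k"
        using rxy k by (intro A.cyc_conv_cong) auto
      also have "\<dots> = r \<odot>\<^bsub>A\<^esub> cyc_conv A N (cyc_coeff x) (cyc_coeff y) k"
        unfolding cyc_conv_def using rxy k
        by (subst A.finsum_smult_ldistr) (auto intro!: A.M.finsum_cong' simp: A.smult_assoc2)
      finally show "cyc_conv A N (cyc_coeff (cyc_elem N (\<lambda>k. r \<odot>\<^bsub>A\<^esub> cyc_coeff x k))) (cyc_coeff y) k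
          = r \<odot>\<^bsub>A\<^esub> cyc_coeff (cyc_elem N (cyc_conv A N (cyc_coeff x) (cyc_coeff y))) k"
        using k by simp
    qed
  next
    fix r s x assume rsx: "r \<in> carrier K" "s \<in> carrier K" "x \<in> carrier ?B"
    show "(r \<oplus>\<^bsub>K\<^esub> s) \<odot>\<^bsub>?B\<^esub> x = r \<odot>\<^bsub>?B\<^esub> x \<oplus>\<^bsub>?B\<^esub> s \<odot>\<^bsub>?B\<^esub> x"
      using rsx unfolding cyc_algebra_simps(5,6) by (intro cyc_elem_cong) (auto simp: A.smult_l_distr)
    show "(r \<otimes>\<^bsub>K\<^esub> s) \<odot>\<^bsub>?B\<^esub> x = r \<odot>\<^bsub>?B\<^esub> (s \<odot>\<^bsub>?B\<^esub> x)"
      using rsx unfolding cyc_algebra_simps(6) by (intro cyc_elem_cong) (auto simp: A.smult_assoc1)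
  next
    fix x assume x: "x \<in> carrier ?B"
    show "\<one>\<^bsub>K\<^esub> \<odot>\<^bsub>?B\<^esub> x = x"
    proof (rule cyc_eqI[OF smult[OF A.R.one_closed x] x])
      fix k assume "k < N"
      thus "cyc_coeff (\<one>\<^bsub>K\<^esub> \<odot>\<^bsub>?B\<^esub> x) k = cyc_coeff x k"
        using x by (simp add: cyc_algebra_simps(6))
    qed
  qed (use cring smult A.R.cring_axioms in auto)
qed

definition cyc_const :: "'k alg \<Rightarrow> 'k list \<Rightarrow> 'k list" where
  "cyc_const A a = cyc_elem N (\<lambda>k. if k = 0 then a else \<zero>\<^bsub>A\<^esub>)"

definition cyc_monom :: "'k alg \<Rightarrow> nat \<Rightarrow> 'k list" where
  "cyc_monom A i = cyc_elem N (\<lambda>k. if k = i then \<one>\<^bsub>A\<^esub> else \<zero>\<^bsub>A\<^esub>)"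

definition cyc_map :: "('k list \<Rightarrow> 'k list) \<Rightarrow> 'k list \<Rightarrow> 'k list" where
  "cyc_map h x = cyc_elem N (\<lambda>k. h (cyc_coeff x k))"

lemma cyc_coeff_map [simp]: "k < N \<Longrightarrow> cyc_coeff (cyc_map h x) k = h (cyc_coeff x k)"
  by (simp add: cyc_map_def)

context
  fixes A :: "'k alg"
  assumes A: "algebra K A"
begin

interpretation A: algebra K A by (rule A)

interpretation B: algebra K "cyc_algebra N A" by (rule algebra_cyc_algebra[OF A])

lemma cyc_const_closed: "a \<in> carrier A \<Longrightarrow> cyc_const A a \<in> carrier (cyc_algebra N A)"
  unfolding cyc_const_def by (intro cyc_elem_closed) auto

lemma cyc_monom_closed: "cyc_monom A i \<in> carrier (cyc_algebra N A)"
  unfolding cyc_monom_def by (intro cyc_elem_closed) auto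

lemma cyc_coeff_add:
  "k < N \<Longrightarrow> cyc_coeff (x \<oplus>\<^bsub>cyc_algebra N A\<^esub> y) k = cyc_coeff x k \<oplus>\<^bsub>A\<^esub> cyc_coeff y k"
  by (simp add: cyc_algebra_simps(5))

lemma cyc_coeff_single_mult:
  assumes "c \<in> carrier A" "y \<in> carrier (cyc_algebra N A)" "i < N" "k < N"
  shows "cyc_coeff (cyc_elem N (\<lambda>k. if k = i then c else \<zero>\<^bsub>A\<^esub>) \<otimes>\<^bsub>cyc_algebra N A\<^esub> y) k
    = c \<otimes>\<^bsub>A\<^esub> cyc_coeff y (cyc_diff N k i)"
proof -
  let ?p = "\<lambda>k. if k = i then c else \<zero>\<^bsub>A\<^esub>"
  have "cyc_coeff (cyc_elem N ?p \<otimes>\<^bsub>cyc_algebra N A\<^esub> y) k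
      = cyc_conv A N (cyc_coeff (cyc_elem N ?p)) (cyc_coeff y) k"
    using assms by (simp add: cyc_algebra_simps(2))
  also have "\<dots> = cyc_conv A N ?p (cyc_coeff y) k"
    using assms by (intro A.cyc_conv_cong) auto
  also have "\<dots> = c \<otimes>\<^bsub>A\<^esub> cyc_coeff y (cyc_diff N k i)"
    using assms by (intro A.cyc_conv_single) auto
  finally show ?thesis .
qed

text \<open>
  The coefficients are \<open>A\<close>-linear; the coefficient of index \<open>0\<close> will turn homotopies over \<open>A[\<int>/N]\<close>
  into homotopies over \<open>A\<close>.
\<close>

lemma cyc_coeff_const_mult:
  assumes "a \<in> carrier A" "y \<in> carrier (cyc_algebra N A)" "k < N"
  shows "cyc_coeff (cyc_const A a \<otimes>\<^bsub>cyc_algebra N A\<^esub> y) k = a \<otimes>\<^bsub>A\<^esub> cyc_coeff y k"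
  using cyc_coeff_single_mult[OF assms(1,2) N_pos assms(3)] by (simp add: cyc_const_def cyc_diff_def)

lemma cyc_monom_mult:
  assumes "i < N" "j < N"
  shows "cyc_monom A i \<otimes>\<^bsub>cyc_algebra N A\<^esub> cyc_monom A j = cyc_monom A (cyc_add N i j)"
proof (rule cyc_eqI[of _ A])
  fix k assume k: "k < N"
  have "cyc_diff N k i = j \<longleftrightarrow> k = cyc_add N i j"
    using assms k by (auto simp: cyc_diff_def cyc_add_def)
  thus "cyc_coeff (cyc_monom A i \<otimes>\<^bsub>cyc_algebra N A\<^esub> cyc_monom A j) k = cyc_coeff (cyc_monom A (cyc_add N i j)) k"
    using assms k cyc_coeff_single_mult[OF A.one_closed cyc_monom_closed[of j] assms(1) k]
    by (simp add: cyc_monom_def)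
qed (simp_all add: cyc_monom_closed)

lemma cyc_monom_0: "cyc_monom A 0 = \<one>\<^bsub>cyc_algebra N A\<^esub>"
  by (simp add: cyc_monom_def cyc_algebra_simps(3))

lemma cyc_monom_pow: "m < N \<Longrightarrow> cyc_monom A 1 [^]\<^bsub>cyc_algebra N A\<^esub> (m::nat) = cyc_monom A m"
  by (induction m) (auto simp: cyc_monom_0 cyc_monom_mult cyc_add_def)

lemma cyc_monom_Unit: "1 < N \<Longrightarrow> cyc_monom A 1 \<in> Units (cyc_algebra N A)"
  unfolding Units_def using cyc_monom_mult[of 1 "N - 1"] cyc_monom_mult[of "N - 1" 1]
  by (auto simp: cyc_monom_closed cyc_add_def cyc_monom_0 intro!: bexI[of _ "cyc_monom A (N - 1)"])

text \<open>
  Nontrivial powers of the generator have no constant coefficient, which distinguishes their action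
  from the identity.
\<close>

lemma cyc_coeff_monom_mult_const:
  assumes "0 < m" "m < N" "a \<in> carrier A"
  shows "cyc_coeff (cyc_monom A m \<otimes>\<^bsub>cyc_algebra N A\<^esub> cyc_const A a) 0 = \<zero>\<^bsub>A\<^esub>"
  using assms cyc_coeff_single_mult[OF A.one_closed cyc_const_closed[of a] assms(2) N_pos]
  by (simp add: cyc_monom_def cyc_const_def cyc_diff_def)

lemma cyc_coeff_const: "cyc_coeff (cyc_const A a) 0 = a"
  using N_pos by (simp add: cyc_const_def)

lemma cyc_const_hom: "cyc_const A \<in> algebra_hom K A (cyc_algebra N A)"
  unfolding algebra_hom_def
proof (intro CollectI conjI ballI ring_hom_memI)
  fix a b assume ab: "a \<in> carrier A" "b \<in> carrier A"
  show "cyc_const A (a \<otimes>\<^bsub>A\<^esub> b) = cyc_const A a \<otimes>\<^bsub>cyc_algebra N A\<^esub> cyc_const A b"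
  proof (rule cyc_eqI[of _ A])
    fix k assume k: "k < N"
    show "cyc_coeff (cyc_const A (a \<otimes>\<^bsub>A\<^esub> b)) k = cyc_coeff (cyc_const A a \<otimes>\<^bsub>cyc_algebra N A\<^esub> cyc_const A b) k"
      unfolding cyc_coeff_const_mult[OF ab(1) cyc_const_closed[OF ab(2)] k]
      using ab k by (simp add: cyc_const_def)
  qed (use ab in \<open>simp_all add: cyc_const_closed\<close>)
  show "cyc_const A (a \<oplus>\<^bsub>A\<^esub> b) = cyc_const A a \<oplus>\<^bsub>cyc_algebra N A\<^esub> cyc_const A b"
    using ab unfolding cyc_algebra_simps(5) cyc_const_def by (intro cyc_elem_cong) auto
next
  fix c a assume "c \<in> carrier K" "a \<in> carrier A"
  thus "cyc_const A (c \<odot>\<^bsub>A\<^esub> a) = c \<odot>\<^bsub>cyc_algebra N A\<^esub> cyc_const A a"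
    unfolding cyc_algebra_simps(6) cyc_const_def by (intro cyc_elem_cong) (auto simp: A.smult_r_null)
next
  show "cyc_const A \<one>\<^bsub>A\<^esub> = \<one>\<^bsub>cyc_algebra N A\<^esub>"
    by (simp add: cyc_const_def cyc_algebra_simps(3))
qed (rule cyc_const_closed)

end

lemma cyc_map_hom:
  assumes A: "algebra K A" and B: "algebra K B" and h: "h \<in> algebra_hom K A B"
  shows "cyc_map h \<in> algebra_hom K (cyc_algebra N A) (cyc_algebra N B)"
proof -
  interpret A: algebra K A by fact
  interpret B: algebra K B by fact
  have hom: "h \<in> Ring.ring_hom A B" and smult: "\<And>c x. c \<in> carrier K \<Longrightarrow> x \<in> carrier A \<Longrightarrow> h (c \<odot>\<^bsub>A\<^esub> x) = c \<odot>\<^bsub>B\<^esub> h x"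
    using h by (auto simp: algebra_hom_def)
  interpret h: ring_hom_cring A B h
    using hom by unfold_locales
  have closed: "cyc_map h x \<in> carrier (cyc_algebra N B)" if "x \<in> carrier (cyc_algebra N A)" for x
    unfolding cyc_map_def using that by (intro cyc_elem_closed) (auto intro: cyc_coeff_closed)
  note c = cyc_coeff_closed[of _ A]
  show ?thesis
    unfolding algebra_hom_def
  proof (intro CollectI conjI ballI ring_hom_memI)
    fix x y assume xy: "x \<in> carrier (cyc_algebra N A)" "y \<in> carrier (cyc_algebra N A)"
    show "cyc_map h (x \<otimes>\<^bsub>cyc_algebra N A\<^esub> y) = cyc_map h x \<otimes>\<^bsub>cyc_algebra N B\<^esub> cyc_map h y"
      unfolding cyc_algebra_simps(2) cyc_map_def
    proof (rule cyc_elem_cong)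
      fix k assume k: "k < N"
      have "h (cyc_conv A N (cyc_coeff x) (cyc_coeff y) k)
          = (\<Oplus>\<^bsub>B\<^esub>i\<in>{..<N}. h (cyc_coeff x i) \<otimes>\<^bsub>B\<^esub> h (cyc_coeff y (cyc_diff N k i)))"
        unfolding cyc_conv_def using xy k c
        by (subst h.hom_finsum) (auto intro!: B.M.finsum_cong')
      also have "\<dots> = cyc_conv B N (cyc_coeff (cyc_elem N (\<lambda>k. h (cyc_coeff x k))))
          (cyc_coeff (cyc_elem N (\<lambda>k. h (cyc_coeff y k)))) k"
        unfolding cyc_conv_def using xy k c by (intro B.M.finsum_cong') auto
      finally show "h (cyc_coeff (cyc_elem N (cyc_conv A N (cyc_coeff x) (cyc_coeff y))) k)
          = cyc_conv B N (cyc_coeff (cyc_elem N (\<lambda>k. h (cyc_coeff x k))))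
            (cyc_coeff (cyc_elem N (\<lambda>k. h (cyc_coeff y k)))) k"
        using k by simp
    qed
    show "cyc_map h (x \<oplus>\<^bsub>cyc_algebra N A\<^esub> y) = cyc_map h x \<oplus>\<^bsub>cyc_algebra N B\<^esub> cyc_map h y"
      unfolding cyc_algebra_simps(5) cyc_map_def using xy c by (intro cyc_elem_cong) auto
  next
    fix r x assume "r \<in> carrier K" "x \<in> carrier (cyc_algebra N A)"
    thus "cyc_map h (r \<odot>\<^bsub>cyc_algebra N A\<^esub> x) = r \<odot>\<^bsub>cyc_algebra N B\<^esub> cyc_map h x"
      unfolding cyc_algebra_simps(6) cyc_map_def using c by (intro cyc_elem_cong) (auto simp: smult)
  next
    show "cyc_map h \<one>\<^bsub>cyc_algebra N A\<^esub> = \<one>\<^bsub>cyc_algebra N B\<^esub>"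
      unfolding cyc_algebra_simps(3) cyc_map_def by (intro cyc_elem_cong) auto
  qed (rule closed)
qed

lemma cyc_map_const:
  assumes "ring_hom_cring A B h"
  shows "cyc_map h (cyc_const A a) = cyc_const B (h a)"
proof -
  interpret ring_hom_cring A B h by fact
  show ?thesis
    unfolding cyc_map_def cyc_const_def by (intro cyc_elem_cong) auto
qed

lemma cyc_map_monom:
  assumes "ring_hom_cring A B h"
  shows "cyc_map h (cyc_monom A i) = cyc_monom B i"
proof -
  interpret ring_hom_cring A B h by fact
  show ?thesis
    unfolding cyc_map_def cyc_monom_def by (intro cyc_elem_cong) auto
qed

end

section \<open>The action of matrices on free modules\<close>

text \<open>
  The abelian group \<open>A\<^sup>D\<close>.  Abelian groups in additive notation are encoded as ring records.
\<close>

definition vec_module :: "('a, 'b) ring_scheme \<Rightarrow> nat \<Rightarrow> 'a vec ring" where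
  "vec_module A D = \<lparr>carrier = free_module A D, monoid.mult = (\<lambda>u v. u), one = vec D (\<lambda>p. \<zero>\<^bsub>A\<^esub>),
    ring.zero = vec D (\<lambda>p. \<zero>\<^bsub>A\<^esub>), ring.add = (\<lambda>u v. vec D (\<lambda>p. u $ p \<oplus>\<^bsub>A\<^esub> v $ p))\<rparr>"

lemma vec_module_simps:
  "carrier (vec_module A D) = free_module A D"
  "\<zero>\<^bsub>vec_module A D\<^esub> = vec D (\<lambda>p. \<zero>\<^bsub>A\<^esub>)"
  "u \<oplus>\<^bsub>vec_module A D\<^esub> v = vec D (\<lambda>p. u $ p \<oplus>\<^bsub>A\<^esub> v $ p)"
  by (simp_all add: vec_module_def)

lemma free_module_iff: "v \<in> free_module A D \<longleftrightarrow> dim_vec v = D \<and> (\<forall>p<D. v $ p \<in> carrier A)"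
  unfolding free_module_def carrier_vec_def by blast

lemma dim_free_module: "v \<in> free_module A D \<Longrightarrow> dim_vec v = D"
  by (simp add: free_module_iff)

lemma free_module_eqI:
  "u \<in> free_module A D \<Longrightarrow> v \<in> free_module A D \<Longrightarrow> (\<And>p. p < D \<Longrightarrow> u $ p = v $ p) \<Longrightarrow> u = v"
  by (intro eq_vecI) (auto simp: free_module_iff)

lemma merge_at_closed:
  assumes "Group.monoid H" "s \<in> lists (carrier H)" "Suc j < length s"
  shows "merge_at H j s \<in> lists (carrier H)"
proof -
  interpret Group.monoid H by fact
  have "s ! j \<in> carrier H" "s ! Suc j \<in> carrier H"
    using assms(2,3) nth_mem[of j s] nth_mem[of "Suc j" s] by (auto simp: in_lists_conv_set)
  thus ?thesis
    using assms(2) by (auto simp: merge_at_def dest!: in_set_takeD in_set_dropD)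
qed

lemma length_merge_at: "Suc j < length s \<Longrightarrow> length (merge_at H j s) = length s - 1"
  by (simp add: merge_at_def)

context cring
begin

lemma vec_module_abelian_group: "abelian_group (vec_module R D)"
proof (rule abelian_groupI)
  fix u assume u: "u \<in> carrier (vec_module R D)"
  show "\<exists>v\<in>carrier (vec_module R D). v \<oplus>\<^bsub>vec_module R D\<^esub> u = \<zero>\<^bsub>vec_module R D\<^esub>"
    using u by (intro bexI[of _ "vec D (\<lambda>p. \<ominus> (u $ p))"])
      (auto simp: vec_module_simps free_module_iff l_neg intro!: eq_vecI)
qed (auto simp: vec_module_simps free_module_iff a_ac intro!: eq_vecI)

lemma apply_mat_closed:
  "g \<in> carrier (Mat R D) \<Longrightarrow> v \<in> free_module R D \<Longrightarrow> apply_mat R g v \<in> free_module R D"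
  by (auto simp: apply_mat_def free_module_iff carrier_matrix_monoid_iff intro!: finsum_closed)

lemma index_apply_mat:
  "g \<in> carrier (Mat R D) \<Longrightarrow> p < D \<Longrightarrow> apply_mat R g v $ p = (\<Oplus>q\<in>{..<D}. g $$ (p, q) \<otimes> v $ q)"
  by (simp add: apply_mat_def carrier_matrix_monoid_iff)

lemma apply_mat_add:
  assumes g: "g \<in> carrier (Mat R D)" and u: "u \<in> free_module R D" and v: "v \<in> free_module R D"
  shows "apply_mat R g (u \<oplus>\<^bsub>vec_module R D\<^esub> v) = apply_mat R g u \<oplus>\<^bsub>vec_module R D\<^esub> apply_mat R g v"
proof (rule free_module_eqI)
  interpret M: abelian_group "vec_module R D" by (rule vec_module_abelian_group)
  have uv: "u \<oplus>\<^bsub>vec_module R D\<^esub> v \<in> free_module R D"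
    using M.a_closed u v by (simp add: vec_module_simps(1))
  show "apply_mat R g (u \<oplus>\<^bsub>vec_module R D\<^esub> v) \<in> free_module R D"
    by (rule apply_mat_closed[OF g uv])
  show "apply_mat R g u \<oplus>\<^bsub>vec_module R D\<^esub> apply_mat R g v \<in> free_module R D"
    using M.a_closed apply_mat_closed[OF g u] apply_mat_closed[OF g v] by (simp add: vec_module_simps(1))
  fix p assume p: "p < D"
  have "apply_mat R g (u \<oplus>\<^bsub>vec_module R D\<^esub> v) $ p
      = (\<Oplus>q\<in>{..<D}. g $$ (p, q) \<otimes> u $ q \<oplus> g $$ (p, q) \<otimes> v $ q)"
    unfolding index_apply_mat[OF g p] using g u v p
    by (intro finsum_cong') (auto simp: vec_module_simps free_module_iff carrier_matrix_monoid_iff r_distr)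
  also have "\<dots> = (apply_mat R g u \<oplus>\<^bsub>vec_module R D\<^esub> apply_mat R g v) $ p"
    using g u v p by (simp add: vec_module_simps index_apply_mat)
      (intro finsum_addf, auto simp: free_module_iff carrier_matrix_monoid_iff)
  finally show "apply_mat R g (u \<oplus>\<^bsub>vec_module R D\<^esub> v) $ p
      = (apply_mat R g u \<oplus>\<^bsub>vec_module R D\<^esub> apply_mat R g v) $ p" .
qed

lemma apply_mat_mult:
  assumes g: "g \<in> carrier (Mat R D)" and h: "h \<in> carrier (Mat R D)"
    and v: "v \<in> free_module R D"
  shows "apply_mat R (g \<otimes>\<^bsub>Mat R D\<^esub> h) v = apply_mat R g (apply_mat R h v)"
proof (rule free_module_eqI)
  note gh = matrix_monoid_mult_closed[OF g h]
  show "apply_mat R (g \<otimes>\<^bsub>Mat R D\<^esub> h) v \<in> free_module R D"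
    by (rule apply_mat_closed[OF gh v])
  show "apply_mat R g (apply_mat R h v) \<in> free_module R D"
    by (intro apply_mat_closed g h v)
  have [simp]: "g $$ (i, j) \<in> carrier R" "h $$ (i, j) \<in> carrier R" "v $ i \<in> carrier R"
    if "i < D" "j < D" for i j
    using g h v that by (auto simp: carrier_matrix_monoid_iff free_module_iff)
  fix p assume p: "p < D"
  have "apply_mat R (g \<otimes>\<^bsub>Mat R D\<^esub> h) v $ p
      = (\<Oplus>q\<in>{..<D}. \<Oplus>l\<in>{..<D}. g $$ (p, l) \<otimes> h $$ (l, q) \<otimes> v $ q)"
    unfolding index_apply_mat[OF gh p]
  proof (rule finsum_cong'[OF refl])
    fix q assume "q \<in> {..<D}"
    thus "(g \<otimes>\<^bsub>Mat R D\<^esub> h) $$ (p, q) \<otimes> v $ q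
        = (\<Oplus>l\<in>{..<D}. g $$ (p, l) \<otimes> h $$ (l, q) \<otimes> v $ q)"
      using p by (simp add: index_matrix_monoid_mult) (intro finsum_ldistr, auto)
  qed (use p in \<open>auto intro!: finsum_closed\<close>)
  also have "\<dots> = (\<Oplus>l\<in>{..<D}. \<Oplus>q\<in>{..<D}. g $$ (p, l) \<otimes> h $$ (l, q) \<otimes> v $ q)"
    using p by (intro finsum_commute) auto
  also have "\<dots> = apply_mat R g (apply_mat R h v) $ p"
    unfolding index_apply_mat[OF g p]
  proof (rule finsum_cong'[OF refl])
    fix l assume "l \<in> {..<D}"
    hence l: "l < D" by simp
    have "(\<Oplus>q\<in>{..<D}. g $$ (p, l) \<otimes> h $$ (l, q) \<otimes> v $ q)
        = (\<Oplus>q\<in>{..<D}. g $$ (p, l) \<otimes> (h $$ (l, q) \<otimes> v $ q))"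
      using p l by (intro finsum_cong') (auto simp: m_assoc)
    also have "\<dots> = g $$ (p, l) \<otimes> (\<Oplus>q\<in>{..<D}. h $$ (l, q) \<otimes> v $ q)"
      using p l by (intro finsum_rdistr[symmetric]) auto
    finally show "(\<Oplus>q\<in>{..<D}. g $$ (p, l) \<otimes> h $$ (l, q) \<otimes> v $ q) = g $$ (p, l) \<otimes> apply_mat R h v $ l"
      using l h by (simp add: index_apply_mat)
  qed (use p apply_mat_closed[OF h v] in \<open>auto simp: free_module_iff\<close>)
  finally show "apply_mat R (g \<otimes>\<^bsub>Mat R D\<^esub> h) v $ p = apply_mat R g (apply_mat R h v) $ p" .
qed

lemma component_hom: "p < D \<Longrightarrow> abelian_group_hom (vec_module R D) R (\<lambda>v. v $ p)"
  by (intro abelian_group_homI vec_module_abelian_group abelian_group_axioms group_hom.intro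
      abelian_group.a_group group_hom_axioms.intro)
    (auto simp: hom_def vec_module_simps free_module_iff)

text \<open>
  Fixing the first argument shifts the index \<open>j\<close> of the merged pair by one and hence changes all
  signs, in accordance with the recursion for \<open>bar_diff\<close>.
\<close>

lemma bar_diff_eq_sum:
  assumes "Group.monoid H" "\<forall>t\<in>lists (carrier H). F t \<in> carrier R"
    "s \<in> lists (carrier H)" "length s = Suc i"
  shows "bar_diff R H F s = (\<Oplus>j\<in>{..<i}. [((- 1 :: int) ^ Suc j)] \<cdot> F (merge_at H j s))
    \<oplus> [((- 1 :: int) ^ Suc i)] \<cdot> F (butlast s)"
  using assms(2-4)
proof (induction i arbitrary: s F)
  case 0
  then obtain g where "s = [g]"
    by (auto simp: length_Suc_conv)
  thus ?case
    using 0 by (simp add: uminus_int_mult one_int_mult)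
next
  case (Suc i)
  interpret H: Group.monoid H by fact
  obtain g h t where s: "s = g # h # t" "length t = i"
    using Suc.prems(3) by (auto simp: length_Suc_conv)
  have mem: "g \<in> carrier H" "h \<in> carrier H" "t \<in> lists (carrier H)"
    using Suc.prems(2) s by auto
  have merge_mem: "merge_at H j (h # t) \<in> lists (carrier H)" if "j < i" for j
    using that mem s(2) assms(1) by (intro merge_at_closed) auto
  let ?F = "\<lambda>t. F (g # t)"
  have F: "\<forall>t\<in>lists (carrier H). ?F t \<in> carrier R"
    using Suc.prems(1) mem by auto
  let ?G = "\<lambda>j. [((- 1 :: int) ^ Suc j)] \<cdot> ?F (merge_at H j (h # t))"
  have G: "?G j \<in> carrier R" if "j < i" for j
    using that F merge_mem by (intro int_mult_closed) auto
  have B: "?F (butlast (h # t)) \<in> carrier R"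
  proof -
    have "butlast (h # t) \<in> lists (carrier H)"
      using mem in_set_butlastD[of _ "h # t"] by (auto simp: in_lists_conv_set simp del: butlast.simps)
    thus ?thesis using F by blast
  qed
  have "(\<Oplus>j\<in>{..<Suc i}. [((- 1 :: int) ^ Suc j)] \<cdot> F (merge_at H j s))
      = ([((- 1 :: int))] \<cdot> F ((g \<otimes>\<^bsub>H\<^esub> h) # t))
        \<oplus> (\<Oplus>j\<in>Suc ` {..<i}. [((- 1 :: int) ^ Suc j)] \<cdot> F (merge_at H j s))"
    unfolding lessThan_Suc_eq_insert_0 using Suc.prems(1) mem merge_mem
    by (subst finsum_insert) (auto simp: s merge_at_def intro!: int_mult_closed)
  also have "(\<Oplus>j\<in>Suc ` {..<i}. [((- 1 :: int) ^ Suc j)] \<cdot> F (merge_at H j s))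
      = (\<Oplus>j\<in>{..<i}. [((- 1 :: int) ^ Suc (Suc j))] \<cdot> F (merge_at H (Suc j) s))"
    using Suc.prems(1) mem merge_mem
    by (intro finsum_reindex) (auto simp: s merge_at_def intro!: int_mult_closed)
  also have "\<dots> = (\<Oplus>j\<in>{..<i}. [(- 1 :: int)] \<cdot> ?G j)"
    using F merge_mem G
    by (intro finsum_cong') (auto simp: int_mult_int_mult s merge_at_def intro!: int_mult_closed)
  also have "\<dots> = \<ominus> (\<Oplus>j\<in>{..<i}. ?G j)"
    using G by (subst int_mult_finsum[symmetric]) (auto simp: uminus_int_mult one_int_mult intro!: finsum_closed)
  finally have sum: "(\<Oplus>j\<in>{..<Suc i}. [((- 1 :: int) ^ Suc j)] \<cdot> F (merge_at H j s))
      = \<ominus> F ((g \<otimes>\<^bsub>H\<^esub> h) # t) \<oplus> \<ominus> (\<Oplus>j\<in>{..<i}. ?G j)"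
    using Suc.prems(1) mem by (simp add: uminus_int_mult one_int_mult)
  have last: "[((- 1 :: int) ^ Suc (Suc i))] \<cdot> F (butlast s) = \<ominus> ([((- 1 :: int) ^ Suc i)] \<cdot> ?F (butlast (h # t)))"
    using B by (simp add: s flip: uminus_int_mult)
  have "bar_diff R H F s = \<ominus> F ((g \<otimes>\<^bsub>H\<^esub> h) # t) \<oplus> \<ominus> bar_diff R H ?F (h # t)"
    by (simp add: s)
  also have "bar_diff R H ?F (h # t) = (\<Oplus>j\<in>{..<i}. ?G j) \<oplus> [((- 1 :: int) ^ Suc i)] \<cdot> ?F (butlast (h # t))"
    using F mem s(2) by (intro Suc.IH) auto
  also have "\<ominus> F ((g \<otimes>\<^bsub>H\<^esub> h) # t) \<oplus> \<ominus> ((\<Oplus>j\<in>{..<i}. ?G j) \<oplus> [((- 1 :: int) ^ Suc i)] \<cdot> ?F (butlast (h # t)))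
      = (\<ominus> F ((g \<otimes>\<^bsub>H\<^esub> h) # t) \<oplus> \<ominus> (\<Oplus>j\<in>{..<i}. ?G j)) \<oplus> \<ominus> ([((- 1 :: int) ^ Suc i)] \<cdot> ?F (butlast (h # t)))"
  proof -
    have "F ((g \<otimes>\<^bsub>H\<^esub> h) # t) \<in> carrier R"
      using Suc.prems(1) mem by simp
    moreover have "(\<Oplus>j\<in>{..<i}. ?G j) \<in> carrier R"
      using G by (intro finsum_closed) auto
    moreover have "[((- 1 :: int) ^ Suc i)] \<cdot> ?F (butlast (h # t)) \<in> carrier R"
      by (rule int_mult_closed[OF B])
    ultimately show ?thesis
      by (simp only: minus_add a_assoc a_inv_closed)
  qed
  finally show ?case
    by (simp only: sum last)
qed

end

context ring_hom_cring
begin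

lemma map_vec_hom: "abelian_group_hom (vec_module R D) (vec_module S D) (map_vec h)"
  by (intro abelian_group_homI R.vec_module_abelian_group S.vec_module_abelian_group group_hom.intro
      abelian_group.a_group group_hom_axioms.intro)
    (auto simp: hom_def vec_module_simps free_module_iff intro!: eq_vecI)

lemma map_vec_apply_mat:
  assumes g: "g \<in> carrier (Mat R D)" and v: "v \<in> free_module R D"
  shows "map_vec h (apply_mat R g v) = apply_mat S (map_mat h g) (map_vec h v)"
proof (rule eq_vecI)
  have hg: "map_mat h g \<in> carrier (Mat S D)"
    using g map_mat_hom_matrix_monoid by (rule hom_in_carrier[rotated])
  fix p assume "p < dim_vec (apply_mat S (map_mat h g) (map_vec h v))"
  hence p: "p < D"
    using g by (simp add: apply_mat_def carrier_matrix_monoid_iff)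
  have "map_vec h (apply_mat R g v) $ p = h (\<Oplus>\<^bsub>R\<^esub>q\<in>{..<D}. g $$ (p, q) \<otimes>\<^bsub>R\<^esub> v $ q)"
    using R.apply_mat_closed[OF g v] p by (simp add: free_module_iff R.index_apply_mat[OF g])
  also have "\<dots> = apply_mat S (map_mat h g) (map_vec h v) $ p"
    unfolding S.index_apply_mat[OF hg p] using g v p
    by (subst hom_finsum) (auto simp: carrier_matrix_monoid_iff free_module_iff intro!: S.finsum_cong')
  finally show "map_vec h (apply_mat R g v) $ p = apply_mat S (map_mat h g) (map_vec h v) $ p" .
qed (use g in \<open>simp add: apply_mat_def carrier_matrix_monoid_iff\<close>)

end

section \<open>Hochschild cohomology of a group functor with a representation\<close>

text \<open>
  The facts about a group functor and a representation on which the Hochschild complex relies: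
  group structure, linearity of the action, and compatibility of both with base change.
\<close>

locale functor_rep =
  fixes K :: "('k, 'b) ring_scheme" and G :: "('k, 'g) group_functor" and V :: "('k, 'g) group_rep"
  assumes points_group: "algebra K A \<Longrightarrow> Group.group (points G A)"
    and base_change_hom: "algebra K A \<Longrightarrow> algebra K B \<Longrightarrow> h \<in> algebra_hom K A B \<Longrightarrow>
      base_change G h \<in> hom (points G A) (points G B)"
    and rep_closed: "algebra K A \<Longrightarrow> g \<in> carrier (points G A) \<Longrightarrow>
      rep_mat V A g \<in> carrier (Mat A (rep_dim V))"
    and rep_mult: "algebra K A \<Longrightarrow> g \<in> carrier (points G A) \<Longrightarrow> g' \<in> carrier (points G A) \<Longrightarrow>
      rep_mat V A (g \<otimes>\<^bsub>points G A\<^esub> g') = rep_mat V A g \<otimes>\<^bsub>Mat A (rep_dim V)\<^esub> rep_mat V A g'"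
    and rep_base_change: "algebra K A \<Longrightarrow> algebra K B \<Longrightarrow> h \<in> algebra_hom K A B \<Longrightarrow>
      g \<in> carrier (points G A) \<Longrightarrow> rep_mat V B (base_change G h g) = map_mat h (rep_mat V A g)"
begin

abbreviation "D \<equiv> rep_dim V"

abbreviation module_at :: "'k alg \<Rightarrow> 'k list vec ring" where
  "module_at A \<equiv> vec_module A D"

abbreviation act_at :: "'k alg \<Rightarrow> 'g \<Rightarrow> 'k list vec \<Rightarrow> 'k list vec" where
  "act_at A g \<equiv> apply_mat A (rep_mat V A g)"

abbreviation bar_cob :: "'k alg \<Rightarrow> ('g list \<Rightarrow> 'k list vec) \<Rightarrow> 'g list \<Rightarrow> 'k list vec" where
  "bar_cob A \<equiv> bar_coboundary (module_at A) (points G A) (act_at A)"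

abbreviation tuples :: "nat \<Rightarrow> ('k alg \<times> 'g list) set" where
  "tuples i \<equiv> group_tuples K G i"

lemma group_module_at: "algebra K A \<Longrightarrow> group_module (points G A) (module_at A) (act_at A)"
proof -
  assume A: "algebra K A"
  interpret cring A using A by (rule algebra_cring)
  interpret P: Group.group "points G A" using A by (rule points_group)
  interpret M: abelian_group "module_at A" by (rule vec_module_abelian_group)
  show ?thesis
    by unfold_locales
      (auto simp: A rep_mult apply_mat_mult apply_mat_add rep_closed vec_module_simps(1)
        intro!: apply_mat_closed)
qed

lemma base_change_lists:
  assumes "algebra K A" "algebra K B" "h \<in> algebra_hom K A B" "s \<in> lists (carrier (points G A))"
  shows "map (base_change G h) s \<in> lists (carrier (points G B))"
  using assms(4) hom_in_carrier[OF base_change_hom[OF assms(1-3)]] by (auto simp: in_lists_conv_set)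

lemma tuples_iff: "(A, s) \<in> tuples i \<longleftrightarrow> algebra K A \<and> length s = i \<and> s \<in> lists (carrier (points G A))"
  by (auto simp: group_tuples_def)

text \<open>
  A cochain of degree \<open>i\<close> at the algebra \<open>A\<close>, extended by zero to tuples of all lengths, so that it
  may be used with the bar complex of the group \<open>G(A)\<close>.
\<close>

definition cochain_at :: "nat \<Rightarrow> ('k alg \<times> 'g list \<Rightarrow> 'k list vec) \<Rightarrow> 'k alg \<Rightarrow> 'g list \<Rightarrow> 'k list vec" where
  "cochain_at i f A s = (if length s = i then f (A, s) else \<zero>\<^bsub>module_at A\<^esub>)"

lemma cochains_iff:
  "f \<in> cochains K G V i \<longleftrightarrow> f \<in> extensional (tuples i) \<and>
    (\<forall>A s. (A, s) \<in> tuples i \<longrightarrow> f (A, s) \<in> free_module A D) \<and>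
    (\<forall>A B h s. (A, s) \<in> tuples i \<longrightarrow> algebra K B \<longrightarrow> h \<in> algebra_hom K A B \<longrightarrow>
      f (B, map (base_change G h) s) = map_vec h (f (A, s)))"
  unfolding cochains_def PiE_def by (auto simp: Pi_iff)

lemma cochainsI:
  assumes "f \<in> extensional (tuples i)"
    and "\<And>A s. algebra K A \<Longrightarrow> length s = i \<Longrightarrow> s \<in> lists (carrier (points G A)) \<Longrightarrow> f (A, s) \<in> free_module A D"
    and "\<And>A B h s. algebra K A \<Longrightarrow> algebra K B \<Longrightarrow> h \<in> algebra_hom K A B \<Longrightarrow> length s = i \<Longrightarrow>
      s \<in> lists (carrier (points G A)) \<Longrightarrow> f (B, map (base_change G h) s) = map_vec h (f (A, s))"
  shows "f \<in> cochains K G V i"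
  using assms unfolding cochains_iff by (auto simp: tuples_iff)

lemma
  assumes "f \<in> cochains K G V i" "algebra K A" "s \<in> lists (carrier (points G A))"
  shows cochain_closed: "length s = i \<Longrightarrow> f (A, s) \<in> free_module A D"
    and cochain_natural: "length s = i \<Longrightarrow> algebra K B \<Longrightarrow> h \<in> algebra_hom K A B \<Longrightarrow>
      f (B, map (base_change G h) s) = map_vec h (f (A, s))"
  using assms unfolding cochains_iff by (auto simp: tuples_iff)

lemma cochain_ext: "f \<in> cochains K G V i \<Longrightarrow> f \<in> extensional (tuples i)"
  by (simp add: cochains_iff)

lemma zero_closed_at: "algebra K A \<Longrightarrow> \<zero>\<^bsub>module_at A\<^esub> \<in> carrier (module_at A)"
  using cring.vec_module_abelian_group[OF algebra_cring] abelian_group.axioms(1) abelian_monoid.zero_closed by blast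

lemma cochain_at_closed:
  "f \<in> cochains K G V i \<Longrightarrow> algebra K A \<Longrightarrow>
    \<forall>s\<in>lists (carrier (points G A)). cochain_at i f A s \<in> carrier (module_at A)"
  using cochain_closed zero_closed_at by (auto simp: cochain_at_def vec_module_simps(1))

lemma cochain_at_natural:
  assumes f: "f \<in> cochains K G V i" and AB: "algebra K A" "algebra K B" "h \<in> algebra_hom K A B"
    and s: "s \<in> lists (carrier (points G A))"
  shows "cochain_at i f B (map (base_change G h) s) = map_vec h (cochain_at i f A s)"
proof -
  interpret ring_hom_cring A B h using AB by (rule algebra_hom_ring_hom_cring)
  interpret abelian_group_hom "module_at A" "module_at B" "map_vec h" by (rule map_vec_hom)
  show ?thesis
    using cochain_natural[OF f AB(1) s _ AB(2,3)] by (simp add: cochain_at_def)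
qed

lemma bar_cob_natural:
  assumes AB: "algebra K A" "algebra K B" "h \<in> algebra_hom K A B"
    and F: "\<forall>s\<in>lists (carrier (points G A)). F s \<in> carrier (module_at A)"
    and F': "\<And>s. s \<in> lists (carrier (points G A)) \<Longrightarrow> F' (map (base_change G h) s) = map_vec h (F s)"
    and s: "s \<in> lists (carrier (points G A))"
  shows "bar_cob B F' (map (base_change G h) s) = map_vec h (bar_cob A F s)"
proof -
  interpret ring_hom_cring A B h using AB by (rule algebra_hom_ring_hom_cring)
  interpret M: abelian_group_hom "module_at A" "module_at B" "map_vec h" by (rule map_vec_hom)
  interpret GA: group_module "points G A" "module_at A" "act_at A" by (rule group_module_at[OF AB(1)])
  show ?thesis
  proof (cases s)
    case (Cons g t)
    have mem: "g \<in> carrier (points G A)" "t \<in> lists (carrier (points G A))"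
      using s Cons by auto
    have "bar_diff (module_at B) (points G B) F' (map (base_change G h) s)
        = map_vec h (bar_diff (module_at A) (points G A) F s)"
      using base_change_hom[OF AB] F F' s
      by (intro GA.bar_diff_hom map_vec_hom) (auto simp: Group.hom_mult)
    moreover have "act_at B (base_change G h g) (F' (map (base_change G h) t)) = map_vec h (act_at A g (F t))"
      using F mem AB by (simp add: F' rep_base_change map_vec_apply_mat[OF rep_closed] vec_module_simps(1))
    ultimately show ?thesis
      using F mem Cons by simp
  qed simp
qed

text \<open>
  At each algebra \<open>A\<close> the Hochschild coboundary is the coboundary of the group \<open>G(A)\<close> acting on \<open>A\<^sup>D\<close>,
  so that the results on the bar complex of a single group apply.
\<close>

lemma coboundary_eq_bar_cob:
  assumes f: "f \<in> cochains K G V i" and A: "algebra K A" and s: "s \<in> lists (carrier (points G A))" "length s = Suc i"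
  shows "coboundary K G V i f (A, s) = bar_cob A (cochain_at i f A) s"
proof (rule free_module_eqI[of _ A D])
  interpret cring A using A by (rule algebra_cring)
  interpret GA: group_module "points G A" "module_at A" "act_at A" by (rule group_module_at[OF A])
  obtain g t where "s = g # t"
    using s(2) by (auto simp: length_Suc_conv)
  hence gt: "s = g # t" "g \<in> carrier (points G A)" "t \<in> lists (carrier (points G A))" "length t = i"
    using s by auto
  have tup: "(A, s) \<in> tuples (Suc i)"
    using A s by (simp add: tuples_iff)
  let ?F = "cochain_at i f A"
  have F: "\<forall>s\<in>lists (carrier (points G A)). ?F s \<in> carrier (module_at A)"
    by (rule cochain_at_closed[OF f A])
  show bc: "bar_cob A ?F s \<in> free_module A D"
    using GA.bar_coboundary_closed[OF F s(1)] by (simp add: vec_module_simps(1))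
  have eq: "coboundary K G V i f (A, s) $ p = bar_cob A ?F s $ p" if p: "p < D" for p
  proof -
    let ?Fp = "\<lambda>t. ?F t $ p"
    interpret c: abelian_group_hom "module_at A" A "\<lambda>v. v $ p" by (rule component_hom[OF p])
    have merge: "?Fp (merge_at (points G A) j s) \<in> carrier A" if "j < i" for j
      using F merge_at_closed[OF GA.H.monoid_axioms s(1)] s(2) that by (intro c.hom_closed) auto
    let ?S = "\<Oplus>\<^bsub>A\<^esub>j\<in>{..<i}. [((- 1 :: int) ^ Suc j)] \<cdot>\<^bsub>A\<^esub> ?Fp (merge_at (points G A) j s)"
      and ?L = "[((- 1 :: int) ^ Suc i)] \<cdot>\<^bsub>A\<^esub> ?Fp (butlast s)"
      and ?x = "act_at A g (?F t) $ p"
    have "butlast s \<in> lists (carrier (points G A))"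
      using s(1) in_set_butlastD[of _ s] by (auto simp: in_lists_conv_set)
    hence last: "?Fp (butlast s) \<in> carrier A"
      using F by (intro c.hom_closed) auto
    have closed: "?x \<in> carrier A" "?S \<in> carrier A" "?L \<in> carrier A"
      using F gt merge last
      by (auto intro!: c.hom_closed GA.act_closed int_mult_closed finsum_closed simp del: butlast.simps)
    have sum: "(\<Oplus>\<^bsub>A\<^esub>j\<in>{..<i}. [((- 1 :: int) ^ Suc j)] \<cdot>\<^bsub>A\<^esub> (f (A, merge_at (points G A) j s) $ p)) = ?S"
      using s(2) int_mult_closed[OF merge]
      by (intro finsum_cong') (auto simp: cochain_at_def length_merge_at)
    have "bar_diff (module_at A) (points G A) ?F s $ p = bar_diff A (points G A) ?Fp s"
      using GA.bar_diff_hom[OF c.is_abelian_group_hom, of id "points G A" ?F ?Fp s] F s(1) by simp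
    also have "\<dots> = ?S \<oplus>\<^bsub>A\<^esub> ?L"
      using F s by (intro bar_diff_eq_sum GA.H.monoid_axioms) (auto intro!: c.hom_closed)
    finally have "bar_cob A ?F s $ p = ?x \<oplus>\<^bsub>A\<^esub> (?S \<oplus>\<^bsub>A\<^esub> ?L)"
      using p gt(1) by (simp add: vec_module_simps(3) del: butlast.simps)
    also have "\<dots> = ?x \<oplus>\<^bsub>A\<^esub> ?S \<oplus>\<^bsub>A\<^esub> ?L"
      using closed by (simp only: a_assoc)
    also have "\<dots> = coboundary K G V i f (A, s) $ p"
    proof -
      have "?F t = f (A, tl s)" "g = hd s"
        using gt by (simp_all add: cochain_at_def)
      moreover have "?Fp (butlast s) = f (A, butlast s) $ p"
        using s(2) by (simp add: cochain_at_def)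
      ultimately show ?thesis
        using tup p sum by (simp add: coboundary_def del: power_Suc)
    qed
    finally show ?thesis
      by simp
  qed
  show "coboundary K G V i f (A, s) \<in> free_module A D"
    using tup eq bc by (auto simp: free_module_iff) (simp add: coboundary_def)
  show "\<And>p. p < D \<Longrightarrow> coboundary K G V i f (A, s) $ p = bar_cob A ?F s $ p"
    by (rule eq)
qed

lemma coboundary_cochain:
  assumes f: "f \<in> cochains K G V i"
  shows "coboundary K G V i f \<in> cochains K G V (Suc i)"
proof (rule cochainsI)
  show "coboundary K G V i f \<in> extensional (tuples (Suc i))"
    by (simp add: coboundary_def)
next
  fix A s assume As: "algebra K A" "length s = Suc i" "s \<in> lists (carrier (points G A))"
  interpret GA: group_module "points G A" "module_at A" "act_at A" by (rule group_module_at[OF As(1)])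
  show "coboundary K G V i f (A, s) \<in> free_module A D"
    using coboundary_eq_bar_cob[OF f As(1,3,2)]
      GA.bar_coboundary_closed[OF cochain_at_closed[OF f As(1)] As(3)]
    by (simp add: vec_module_simps(1))
next
  fix A B h s
  assume AB: "algebra K A" "algebra K B" "h \<in> algebra_hom K A B"
    and s: "length s = Suc i" "s \<in> lists (carrier (points G A))"
  show "coboundary K G V i f (B, map (base_change G h) s) = map_vec h (coboundary K G V i f (A, s))"
    using coboundary_eq_bar_cob[OF f AB(1) s(2,1)] s
      coboundary_eq_bar_cob[OF f AB(2) base_change_lists[OF AB s(2)]]
      bar_cob_natural[OF AB cochain_at_closed[OF f AB(1)] cochain_at_natural[OF f AB] s(2)]
    by simp
qed

lemma cochain_group_simps:
  "carrier (cochain_group K G V i) = cochains K G V i"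
  "f \<otimes>\<^bsub>cochain_group K G V i\<^esub> f' = (\<lambda>x\<in>tuples i. f x \<oplus>\<^bsub>module_at (fst x)\<^esub> f' x)"
  "\<one>\<^bsub>cochain_group K G V i\<^esub> = (\<lambda>x\<in>tuples i. \<zero>\<^bsub>module_at (fst x)\<^esub>)"
  by (simp_all add: cochain_group_def vec_module_simps)

lemma cochain_eqI:
  assumes "f \<in> extensional (tuples i)" "f' \<in> extensional (tuples i)"
    and "\<And>A s. algebra K A \<Longrightarrow> length s = i \<Longrightarrow> s \<in> lists (carrier (points G A)) \<Longrightarrow> f (A, s) = f' (A, s)"
  shows "f = f'"
proof (rule extensionalityI[OF assms(1,2)])
  fix x assume "x \<in> tuples i"
  thus "f x = f' x"
    using assms(3)[of "fst x" "snd x"] tuples_iff[of "fst x" "snd x" i] by simp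
qed

lemma restrict_cochain:
  assumes "\<And>A s. algebra K A \<Longrightarrow> length s = i \<Longrightarrow> s \<in> lists (carrier (points G A)) \<Longrightarrow> F (A, s) \<in> free_module A D"
    and "\<And>A B h s. algebra K A \<Longrightarrow> algebra K B \<Longrightarrow> h \<in> algebra_hom K A B \<Longrightarrow> length s = i \<Longrightarrow>
      s \<in> lists (carrier (points G A)) \<Longrightarrow> F (B, map (base_change G h) s) = map_vec h (F (A, s))"
  shows "restrict F (tuples i) \<in> cochains K G V i"
  using assms base_change_lists by (intro cochainsI) (auto simp: tuples_iff)

lemma module_at_abelian: "algebra K A \<Longrightarrow> abelian_group (module_at A)"
  by (rule cring.vec_module_abelian_group[OF algebra_cring])

lemma map_vec_hom_at:
  "algebra K A \<Longrightarrow> algebra K B \<Longrightarrow> h \<in> algebra_hom K A B \<Longrightarrow>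
    abelian_group_hom (module_at A) (module_at B) (map_vec h)"
  by (rule ring_hom_cring.map_vec_hom[OF algebra_hom_ring_hom_cring])

lemma cochain_mult_closed:
  assumes "f \<in> cochains K G V i" "f' \<in> cochains K G V i"
  shows "f \<otimes>\<^bsub>cochain_group K G V i\<^esub> f' \<in> cochains K G V i"
  unfolding cochain_group_simps
proof (rule restrict_cochain)
  fix A s assume A: "algebra K A" and s: "length s = i" "s \<in> lists (carrier (points G A))"
  interpret abelian_group "module_at A" by (rule module_at_abelian[OF A])
  show "f (A, s) \<oplus>\<^bsub>module_at (fst (A, s))\<^esub> f' (A, s) \<in> free_module A D"
    using a_closed assms A s cochain_closed by (simp add: vec_module_simps(1))
next
  fix A B h s
  assume AB: "algebra K A" "algebra K B" "h \<in> algebra_hom K A B"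
    and s: "length s = i" "s \<in> lists (carrier (points G A))"
  interpret abelian_group_hom "module_at A" "module_at B" "map_vec h" by (rule map_vec_hom_at[OF AB])
  show "f (B, map (base_change G h) s) \<oplus>\<^bsub>module_at (fst (B, map (base_change G h) s))\<^esub>
      f' (B, map (base_change G h) s) = map_vec h (f (A, s) \<oplus>\<^bsub>module_at (fst (A, s))\<^esub> f' (A, s))"
    using assms AB s cochain_natural cochain_closed by (simp add: vec_module_simps(1))
qed

lemma cochain_group_group: "Group.group (cochain_group K G V i)"
proof (rule groupI)
  fix f f' f'' assume f: "f \<in> carrier (cochain_group K G V i)" "f' \<in> carrier (cochain_group K G V i)"
    "f'' \<in> carrier (cochain_group K G V i)"
  show "f \<otimes>\<^bsub>cochain_group K G V i\<^esub> f' \<otimes>\<^bsub>cochain_group K G V i\<^esub> f''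
      = f \<otimes>\<^bsub>cochain_group K G V i\<^esub> (f' \<otimes>\<^bsub>cochain_group K G V i\<^esub> f'')"
  proof (rule cochain_eqI)
    fix A s assume A: "algebra K A" and s: "length s = i" "s \<in> lists (carrier (points G A))"
    interpret abelian_group "module_at A" by (rule module_at_abelian[OF A])
    show "(f \<otimes>\<^bsub>cochain_group K G V i\<^esub> f' \<otimes>\<^bsub>cochain_group K G V i\<^esub> f'') (A, s)
        = (f \<otimes>\<^bsub>cochain_group K G V i\<^esub> (f' \<otimes>\<^bsub>cochain_group K G V i\<^esub> f'')) (A, s)"
      using f A s cochain_closed by (simp add: cochain_group_simps tuples_iff a_assoc vec_module_simps(1))
  qed (simp_all add: cochain_group_simps)
next
  show "\<one>\<^bsub>cochain_group K G V i\<^esub> \<in> carrier (cochain_group K G V i)"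
    unfolding cochain_group_simps
  proof (rule restrict_cochain)
    show "\<zero>\<^bsub>module_at (fst (A, s))\<^esub> \<in> free_module A D" if "algebra K A" for A s
      using zero_closed_at[OF that] by (simp add: vec_module_simps(1))
    show "\<zero>\<^bsub>module_at (fst (B, map (base_change G h) s))\<^esub> = map_vec h \<zero>\<^bsub>module_at (fst (A, s))\<^esub>"
      if "algebra K A" "algebra K B" "h \<in> algebra_hom K A B" for A B h s
      using abelian_group_hom.hom_zero[OF map_vec_hom_at[OF that]] by simp
  qed
next
  fix f assume f: "f \<in> carrier (cochain_group K G V i)"
  show "\<one>\<^bsub>cochain_group K G V i\<^esub> \<otimes>\<^bsub>cochain_group K G V i\<^esub> f = f"
  proof (rule cochain_eqI)
    fix A s assume A: "algebra K A" and s: "length s = i" "s \<in> lists (carrier (points G A))"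
    interpret abelian_group "module_at A" by (rule module_at_abelian[OF A])
    show "(\<one>\<^bsub>cochain_group K G V i\<^esub> \<otimes>\<^bsub>cochain_group K G V i\<^esub> f) (A, s) = f (A, s)"
      using f A s cochain_closed[of f i A s] l_zero[of "f (A, s)"]
      by (simp add: cochain_group_simps tuples_iff vec_module_simps(1))
  qed (use f cochain_ext in \<open>simp_all add: cochain_group_simps\<close>)
  let ?g = "\<lambda>x\<in>tuples i. \<ominus>\<^bsub>module_at (fst x)\<^esub> f x"
  have "?g \<in> cochains K G V i"
  proof (rule restrict_cochain)
    fix A s assume A: "algebra K A" and s: "length s = i" "s \<in> lists (carrier (points G A))"
    interpret abelian_group "module_at A" by (rule module_at_abelian[OF A])
    show "\<ominus>\<^bsub>module_at (fst (A, s))\<^esub> f (A, s) \<in> free_module A D"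
      using f A s cochain_closed[of f i A s] a_inv_closed[of "f (A, s)"]
      by (simp add: cochain_group_simps vec_module_simps(1))
  next
    fix A B h s
    assume AB: "algebra K A" "algebra K B" "h \<in> algebra_hom K A B"
      and s: "length s = i" "s \<in> lists (carrier (points G A))"
    interpret abelian_group_hom "module_at A" "module_at B" "map_vec h" by (rule map_vec_hom_at[OF AB])
    show "\<ominus>\<^bsub>module_at (fst (B, map (base_change G h) s))\<^esub> f (B, map (base_change G h) s)
        = map_vec h (\<ominus>\<^bsub>module_at (fst (A, s))\<^esub> f (A, s))"
      using f AB s cochain_natural[of f i A s B h] cochain_closed[of f i A s]
      by (simp add: cochain_group_simps vec_module_simps(1))
  qed
  moreover have "?g \<otimes>\<^bsub>cochain_group K G V i\<^esub> f = \<one>\<^bsub>cochain_group K G V i\<^esub>"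
  proof (rule cochain_eqI)
    fix A s assume A: "algebra K A" and s: "length s = i" "s \<in> lists (carrier (points G A))"
    interpret abelian_group "module_at A" by (rule module_at_abelian[OF A])
    show "(?g \<otimes>\<^bsub>cochain_group K G V i\<^esub> f) (A, s) = \<one>\<^bsub>cochain_group K G V i\<^esub> (A, s)"
      using f A s cochain_closed[of f i A s] l_neg[of "f (A, s)"]
      by (simp add: cochain_group_simps tuples_iff vec_module_simps(1))
  qed (simp_all add: cochain_group_simps)
  ultimately show "\<exists>f'\<in>carrier (cochain_group K G V i).
      f' \<otimes>\<^bsub>cochain_group K G V i\<^esub> f = \<one>\<^bsub>cochain_group K G V i\<^esub>"
    unfolding cochain_group_simps(1) by blast
qed (use cochain_mult_closed in \<open>simp_all add: cochain_group_simps(1)\<close>)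

lemma coboundary_hom: "coboundary K G V i \<in> hom (cochain_group K G V i) (cochain_group K G V (Suc i))"
proof (rule homI)
  fix f f' assume f: "f \<in> carrier (cochain_group K G V i)" "f' \<in> carrier (cochain_group K G V i)"
  hence f': "f \<in> cochains K G V i" "f' \<in> cochains K G V i"
    by (simp_all add: cochain_group_simps)
  note ff' = cochain_mult_closed[OF f']
  show "coboundary K G V i (f \<otimes>\<^bsub>cochain_group K G V i\<^esub> f')
      = coboundary K G V i f \<otimes>\<^bsub>cochain_group K G V (Suc i)\<^esub> coboundary K G V i f'"
  proof (rule cochain_eqI)
    fix A s assume A: "algebra K A" and s: "length s = Suc i" "s \<in> lists (carrier (points G A))"
    interpret GA: group_module "points G A" "module_at A" "act_at A" by (rule group_module_at[OF A])
    have "bar_cob A (cochain_at i (f \<otimes>\<^bsub>cochain_group K G V i\<^esub> f') A) s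
        = bar_cob A (\<lambda>t. cochain_at i f A t \<oplus>\<^bsub>module_at A\<^esub> cochain_at i f' A t) s"
      using A s by (intro GA.bar_coboundary_cong)
        (auto simp: cochain_at_def cochain_group_simps tuples_iff)
    also have "\<dots> = bar_cob A (cochain_at i f A) s \<oplus>\<^bsub>module_at A\<^esub> bar_cob A (cochain_at i f' A) s"
      using cochain_at_closed[OF f'(1) A] cochain_at_closed[OF f'(2) A] s(2) by (rule GA.bar_coboundary_add)
    finally show "coboundary K G V i (f \<otimes>\<^bsub>cochain_group K G V i\<^esub> f') (A, s)
        = (coboundary K G V i f \<otimes>\<^bsub>cochain_group K G V (Suc i)\<^esub> coboundary K G V i f') (A, s)"
      using A s f' ff' by (simp add: coboundary_eq_bar_cob cochain_group_simps(2) tuples_iff)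
  qed (simp_all add: coboundary_def cochain_group_simps)
qed (simp add: cochain_group_simps coboundary_cochain)

lemma coboundary_coboundary:
  assumes f: "f \<in> cochains K G V i"
  shows "coboundary K G V (Suc i) (coboundary K G V i f) = \<one>\<^bsub>cochain_group K G V (Suc (Suc i))\<^esub>"
proof (rule cochain_eqI)
  fix A s assume A: "algebra K A" and s: "length s = Suc (Suc i)" "s \<in> lists (carrier (points G A))"
  interpret GA: group_module "points G A" "module_at A" "act_at A" by (rule group_module_at[OF A])
  have "coboundary K G V (Suc i) (coboundary K G V i f) (A, s)
      = bar_cob A (cochain_at (Suc i) (coboundary K G V i f) A) s"
    using coboundary_cochain[OF f] A s by (simp add: coboundary_eq_bar_cob)
  also have "\<dots> = bar_cob A (bar_cob A (cochain_at i f A)) s"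
    using f A s by (intro GA.bar_coboundary_cong) (auto simp: cochain_at_def coboundary_eq_bar_cob)
  also have "\<dots> = \<zero>\<^bsub>module_at A\<^esub>"
    using cochain_at_closed[OF f A] s by (intro GA.bar_coboundary_bar_coboundary) auto
  finally show "coboundary K G V (Suc i) (coboundary K G V i f) (A, s) = \<one>\<^bsub>cochain_group K G V (Suc (Suc i))\<^esub> (A, s)"
    using A s by (simp add: cochain_group_simps tuples_iff)
qed (simp_all add: coboundary_def cochain_group_simps)

lemma cocycles_iff:
  "f \<in> cocycles K G V i \<longleftrightarrow> f \<in> cochains K G V i \<and> coboundary K G V i f = \<one>\<^bsub>cochain_group K G V (Suc i)\<^esub>"
  by (auto simp: cocycles_def kernel_def cochain_group_simps)

lemma subgroup_cocycles: "subgroup (cocycles K G V i) (cochain_group K G V i)"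
  unfolding cocycles_def
  by (intro group_hom.subgroup_kernel group_hom.intro group_hom_axioms.intro cochain_group_group coboundary_hom)

text \<open>
  Since \<open>\<partial>\<^sup>2 = 0\<close>, exactness means that the subgroup of coboundaries is the whole group of cocycles,
  and the quotient of a group by itself is trivial.
\<close>

lemma trivial_cohomologyI:
  assumes exact: "\<And>f. f \<in> cocycles K G V i \<Longrightarrow> f \<in> coboundaries K G V i"
  shows "trivial_group (hochschild_cohomology K G V i)"
proof -
  let ?C = "cochain_group K G V i"
  let ?Z = "?C\<lparr>carrier := cocycles K G V i\<rparr>"
  interpret C: Group.group ?C by (rule cochain_group_group)
  interpret Z: Group.group ?Z
    by (rule subgroup.subgroup_is_group[OF subgroup_cocycles cochain_group_group])
  have "coboundaries K G V i \<subseteq> cocycles K G V i"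
  proof (cases i)
    case 0
    thus ?thesis
      using subgroup.one_closed[OF subgroup_cocycles, of 0] by (simp add: coboundaries_def)
  next
    case (Suc j)
    thus ?thesis
      using coboundary_cochain coboundary_coboundary
      by (auto simp: coboundaries_def cocycles_iff)
  qed
  hence eq: "coboundaries K G V i = carrier ?Z"
    using exact by auto
  have normal: "carrier ?Z \<lhd> ?Z"
    by (rule Z.normal_self)
  have "carrier (?Z Mod carrier ?Z) = {carrier ?Z}"
  proof -
    have "carrier ?Z #>\<^bsub>?Z\<^esub> f = carrier ?Z" if "f \<in> carrier ?Z" for f
      using Z.coset_join2[OF that Z.subgroup_self that] .
    thus ?thesis
      using Z.one_closed by (auto simp: FactGroup_def RCOSETS_def)
  qed
  moreover have "\<one>\<^bsub>?Z Mod carrier ?Z\<^esub> = carrier ?Z"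
    by (simp add: FactGroup_def)
  ultimately show ?thesis
    unfolding hochschild_cohomology_def eq trivial_group_def
    using normal.factorgroup_is_group[OF normal] by simp
qed

end

section \<open>A central element acting with nonzero weight kills the cohomology\<close>

text \<open>
  Here \<open>z A\<close> is a central element of \<open>G(A[\<int>/N])\<close> which acts as multiplication by the power \<open>x\<^sup>m \<noteq> 1\<close> of
  the generator \<open>x\<close> of the cyclic group, and which is natural in \<open>A\<close>.
\<close>

locale functor_rep_central = functor_rep K G V + cyclic_group_algebra K N
  for K :: "('k, 'b) ring_scheme" and G :: "('k, 'g) group_functor" and V :: "('k, 'g) group_rep"
    and N :: nat +
  fixes m :: nat and z :: "'k alg \<Rightarrow> 'g"
  assumes m: "0 < m" "m < N"
    and z_closed: "algebra K A \<Longrightarrow> z A \<in> carrier (points G (cyc_algebra N A))"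
    and z_central: "algebra K A \<Longrightarrow> g \<in> carrier (points G (cyc_algebra N A)) \<Longrightarrow>
      z A \<otimes>\<^bsub>points G (cyc_algebra N A)\<^esub> g = g \<otimes>\<^bsub>points G (cyc_algebra N A)\<^esub> z A"
    and z_natural: "algebra K A \<Longrightarrow> algebra K B \<Longrightarrow> h \<in> algebra_hom K A B \<Longrightarrow>
      base_change G (cyc_map h) (z A) = z B"
    and z_rep: "algebra K A \<Longrightarrow> rep_mat V (cyc_algebra N A) (z A) =
      mat (rep_dim V) (rep_dim V) (\<lambda>(p, q). if p = q then cyc_monom A m else \<zero>\<^bsub>cyc_algebra N A\<^esub>)"
    and base_change_const: "algebra K A \<Longrightarrow> algebra K B \<Longrightarrow> h \<in> algebra_hom K A B \<Longrightarrow>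
      g \<in> carrier (points G A) \<Longrightarrow>
      base_change G (cyc_map h) (base_change G (cyc_const A) g) = base_change G (cyc_const B) (base_change G h g)"
begin

text \<open>
  Minus the constant coefficient.  The sign is chosen such that \<open>z v - v\<close> is sent to \<open>v\<close> for \<open>v \<in> A\<^sup>D\<close>.
\<close>

definition neg_coeff :: "'k alg \<Rightarrow> 'k list vec \<Rightarrow> 'k list vec" where
  "neg_coeff A = map_vec (\<lambda>x. \<ominus>\<^bsub>A\<^esub> cyc_coeff x 0)"

context
  fixes A :: "'k alg"
  assumes A: "algebra K A"
begin

interpretation A: algebra K A by (rule A)

interpretation B: algebra K "cyc_algebra N A" by (rule algebra_cyc_algebra[OF A])

interpretation \<iota>: ring_hom_cring A "cyc_algebra N A" "cyc_const A"
  by (rule algebra_hom_ring_hom_cring[OF A algebra_cyc_algebra[OF A] cyc_const_hom[OF A]])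

lemma neg_coeff_hom: "abelian_group_hom (module_at (cyc_algebra N A)) (module_at A) (neg_coeff A)"
proof (intro abelian_group_homI group_hom.intro group_hom_axioms.intro abelian_group.a_group)
  show "abelian_group (module_at A)" "abelian_group (module_at A)"
    "abelian_group (module_at (cyc_algebra N A))" "abelian_group (module_at (cyc_algebra N A))"
    using module_at_abelian A algebra_cyc_algebra[OF A] by auto
  show "neg_coeff A \<in> hom (add_monoid (module_at (cyc_algebra N A))) (add_monoid (module_at A))"
    using N_pos
    by (auto simp: hom_def vec_module_simps free_module_iff neg_coeff_def cyc_coeff_add[OF A] A.minus_add
        intro!: eq_vecI)
qed

lemma neg_coeff_const:
  assumes "v \<in> free_module A D"
  shows "neg_coeff A (map_vec (cyc_const A) v) = \<ominus>\<^bsub>module_at A\<^esub> v"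
proof -
  interpret M: abelian_group "module_at A" by (rule module_at_abelian[OF A])
  have v: "v \<in> carrier (module_at A)"
    using assms by (simp add: vec_module_simps)
  have "neg_coeff A (map_vec (cyc_const A) v) \<in> carrier (module_at A)"
    using assms by (auto simp: neg_coeff_def vec_module_simps free_module_iff cyc_coeff_const[OF A])
  moreover have "neg_coeff A (map_vec (cyc_const A) v) \<oplus>\<^bsub>module_at A\<^esub> v = \<zero>\<^bsub>module_at A\<^esub>"
    using assms by (auto simp: neg_coeff_def vec_module_simps free_module_iff cyc_coeff_const[OF A] A.l_neg
        intro!: eq_vecI)
  ultimately show ?thesis
    using v by (metis M.minus_equality)
qed

lemma neg_coeff_act:
  assumes g: "g \<in> carrier (points G A)" and v: "v \<in> free_module (cyc_algebra N A) D"
  shows "neg_coeff A (act_at (cyc_algebra N A) (base_change G (cyc_const A) g) v) = act_at A g (neg_coeff A v)"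
proof -
  let ?B = "cyc_algebra N A"
  interpret nc: abelian_group_hom "module_at ?B" "module_at A" "neg_coeff A" by (rule neg_coeff_hom)
  have rg: "rep_mat V A g \<in> carrier (Mat A D)"
    by (rule rep_closed[OF A g])
  have rB: "rep_mat V ?B (base_change G (cyc_const A) g) = map_mat (cyc_const A) (rep_mat V A g)"
    by (rule rep_base_change[OF A algebra_cyc_algebra[OF A] cyc_const_hom[OF A] g])
  have rB_closed: "map_mat (cyc_const A) (rep_mat V A g) \<in> carrier (Mat ?B D)"
    by (rule hom_in_carrier[OF \<iota>.map_mat_hom_matrix_monoid rg])
  have nv: "neg_coeff A v \<in> free_module A D"
    using nc.hom_closed v by (simp add: vec_module_simps)
  have av: "apply_mat ?B (map_mat (cyc_const A) (rep_mat V A g)) v \<in> free_module ?B D"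
    by (rule B.apply_mat_closed[OF rB_closed v])
  have nav: "neg_coeff A (apply_mat ?B (map_mat (cyc_const A) (rep_mat V A g)) v) \<in> free_module A D"
    using nc.hom_closed av by (simp add: vec_module_simps)
  show ?thesis
    unfolding rB
  proof (rule free_module_eqI[OF nav A.apply_mat_closed[OF rg nv]])
    fix p assume p: "p < D"
    let ?r = "rep_mat V A g" and ?c = "\<lambda>x. \<ominus>\<^bsub>A\<^esub> cyc_coeff x 0"
    have r: "?r $$ (p, q) \<in> carrier A" "dim_row ?r = D" "dim_col ?r = D" if "q < D" for q
      using rg p that by (auto simp: carrier_matrix_monoid_iff)
    have vq: "v $ q \<in> carrier ?B" if "q < D" for q
      using v that by (simp add: free_module_iff)
    have c_add: "?c (x \<oplus>\<^bsub>?B\<^esub> y) = ?c x \<oplus>\<^bsub>A\<^esub> ?c y" if "x \<in> carrier ?B" "y \<in> carrier ?B" for x y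
      using that N_pos by (simp add: cyc_coeff_add[OF A] A.minus_add)
    have c_zero: "?c \<zero>\<^bsub>?B\<^esub> = \<zero>\<^bsub>A\<^esub>"
      using N_pos by (simp add: cyc_algebra_simps(4))
    have c_sum: "?c (\<Oplus>\<^bsub>?B\<^esub>q\<in>S. F q) = (\<Oplus>\<^bsub>A\<^esub>q\<in>S. ?c (F q))"
      if "finite S" "\<And>q. q \<in> S \<Longrightarrow> F q \<in> carrier ?B" for S :: "nat set" and F
      using that
    proof (induction S rule: finite_induct)
      case (insert q S)
      have "(\<Oplus>\<^bsub>?B\<^esub>q\<in>insert q S. F q) = F q \<oplus>\<^bsub>?B\<^esub> (\<Oplus>\<^bsub>?B\<^esub>q\<in>S. F q)"
        using insert by (intro B.finsum_insert) auto
      moreover have "(\<Oplus>\<^bsub>A\<^esub>q\<in>insert q S. ?c (F q)) = ?c (F q) \<oplus>\<^bsub>A\<^esub> (\<Oplus>\<^bsub>A\<^esub>q\<in>S. ?c (F q))"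
        using insert N_pos by (intro A.finsum_insert) auto
      moreover have "(\<Oplus>\<^bsub>?B\<^esub>q\<in>S. F q) \<in> carrier ?B"
        using insert by (intro B.finsum_closed) auto
      ultimately show ?case
        using insert by (simp add: c_add)
    qed (simp add: c_zero)
    have "neg_coeff A (apply_mat ?B (map_mat (cyc_const A) ?r) v) $ p
        = ?c (apply_mat ?B (map_mat (cyc_const A) ?r) v $ p)"
      using dim_free_module[OF av] p by (simp add: neg_coeff_def)
    also have "apply_mat ?B (map_mat (cyc_const A) ?r) v $ p
        = (\<Oplus>\<^bsub>?B\<^esub>q\<in>{..<D}. cyc_const A (?r $$ (p, q)) \<otimes>\<^bsub>?B\<^esub> v $ q)"
      unfolding B.index_apply_mat[OF rB_closed p] using p r vq
      by (intro B.finsum_cong') auto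
    also have "?c \<dots> = (\<Oplus>\<^bsub>A\<^esub>q\<in>{..<D}. ?c (cyc_const A (?r $$ (p, q)) \<otimes>\<^bsub>?B\<^esub> v $ q))"
      using r vq by (intro c_sum) auto
    also have "\<dots> = (\<Oplus>\<^bsub>A\<^esub>q\<in>{..<D}. ?r $$ (p, q) \<otimes>\<^bsub>A\<^esub> neg_coeff A v $ q)"
    proof (rule A.finsum_cong'[OF refl])
      fix q assume "q \<in> {..<D}"
      hence q: "q < D" by simp
      show "?c (cyc_const A (?r $$ (p, q)) \<otimes>\<^bsub>?B\<^esub> v $ q) = ?r $$ (p, q) \<otimes>\<^bsub>A\<^esub> neg_coeff A v $ q"
        using q v r[OF q] vq[OF q] N_pos cyc_coeff_const_mult[OF A r(1)[OF q] vq[OF q] N_pos]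
        by (simp add: neg_coeff_def free_module_iff A.r_minus)
    qed (use r nv in \<open>auto simp: free_module_iff\<close>)
    also have "\<dots> = apply_mat A ?r (neg_coeff A v) $ p"
      by (simp add: A.index_apply_mat[OF rg p])
    finally show "neg_coeff A (apply_mat ?B (map_mat (cyc_const A) ?r) v) $ p = apply_mat A ?r (neg_coeff A v) $ p" .
  qed
qed

lemma neg_coeff_z_act:
  assumes v: "v \<in> free_module A D"
  shows "neg_coeff A (act_at (cyc_algebra N A) (z A) (map_vec (cyc_const A) v)) = \<zero>\<^bsub>module_at A\<^esub>"
proof -
  let ?B = "cyc_algebra N A"
  have r: "rep_mat V ?B (z A) \<in> carrier (Mat ?B D)"
    by (rule rep_closed[OF algebra_cyc_algebra[OF A] z_closed[OF A]])
  have "act_at ?B (z A) (map_vec (cyc_const A) v) $ p = cyc_monom A m \<otimes>\<^bsub>?B\<^esub> cyc_const A (v $ p)" if p: "p < D" for p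
  proof -
    have vq: "v $ q \<in> carrier A" if "q < D" for q
      using v that by (simp add: free_module_iff)
    have "act_at ?B (z A) (map_vec (cyc_const A) v) $ p
        = (\<Oplus>\<^bsub>?B\<^esub>q\<in>{..<D}. rep_mat V ?B (z A) $$ (p, q) \<otimes>\<^bsub>?B\<^esub> map_vec (cyc_const A) v $ q)"
      by (rule B.index_apply_mat[OF r p])
    also have "\<dots> = rep_mat V ?B (z A) $$ (p, p) \<otimes>\<^bsub>?B\<^esub> map_vec (cyc_const A) v $ p"
      using p v vq unfolding z_rep[OF A]
      by (intro B.finsum_eq_single) (auto simp: free_module_iff cyc_monom_closed[OF A])
    also have "\<dots> = cyc_monom A m \<otimes>\<^bsub>?B\<^esub> cyc_const A (v $ p)"
      using p v by (simp add: z_rep[OF A] free_module_iff)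
    finally show ?thesis .
  qed
  moreover have "dim_vec (act_at ?B (z A) (map_vec (cyc_const A) v)) = D"
    by (simp add: apply_mat_def z_rep[OF A])
  ultimately show ?thesis
    using v m by (intro eq_vecI)
      (auto simp: neg_coeff_def vec_module_simps free_module_iff cyc_coeff_monom_mult_const[OF A])
qed

end

lemma neg_coeff_natural:
  assumes AB: "algebra K A" "algebra K B" "h \<in> algebra_hom K A B"
    and v: "v \<in> free_module (cyc_algebra N A) D"
  shows "neg_coeff B (map_vec (cyc_map h) v) = map_vec h (neg_coeff A v)"
proof -
  interpret ring_hom_cring A B h by (rule algebra_hom_ring_hom_cring[OF AB])
  show ?thesis
    using v N_pos by (intro eq_vecI) (auto simp: neg_coeff_def free_module_iff)
qed

text \<open>
  The candidate for a cochain with coboundary \<open>f\<close>, of degree one less than \<open>f\<close>.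
\<close>

definition homotopy_at :: "nat \<Rightarrow> ('k alg \<times> 'g list \<Rightarrow> 'k list vec) \<Rightarrow> 'k alg \<Rightarrow> 'g list \<Rightarrow> 'k list vec" where
  "homotopy_at i f A s = neg_coeff A (insert_sum (module_at (cyc_algebra N A)) (z A)
    (cochain_at i f (cyc_algebra N A)) (map (base_change G (cyc_const A)) s))"

context
  fixes i f
  assumes f: "f \<in> cochains K G V i"
begin

lemma insert_sum_at_closed:
  assumes A: "algebra K A" and s: "s \<in> lists (carrier (points G (cyc_algebra N A)))"
  shows "insert_sum (module_at (cyc_algebra N A)) (z A) (cochain_at i f (cyc_algebra N A)) s
    \<in> carrier (module_at (cyc_algebra N A))"
proof -
  note B = algebra_cyc_algebra[OF A]
  interpret GB: group_module "points G (cyc_algebra N A)" "module_at (cyc_algebra N A)" "act_at (cyc_algebra N A)"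
    by (rule group_module_at[OF B])
  show ?thesis
    using cochain_at_closed[OF f B] z_closed[OF A] s by (rule GB.insert_sum_closed)
qed

lemma homotopy_at_closed:
  assumes A: "algebra K A" and s: "s \<in> lists (carrier (points G A))"
  shows "homotopy_at i f A s \<in> free_module A D"
proof -
  interpret nc: abelian_group_hom "module_at (cyc_algebra N A)" "module_at A" "neg_coeff A"
    by (rule neg_coeff_hom[OF A])
  show ?thesis
    unfolding homotopy_at_def
    using nc.hom_closed[OF insert_sum_at_closed[OF A
      base_change_lists[OF A algebra_cyc_algebra[OF A] cyc_const_hom[OF A] s]]]
    by (simp add: vec_module_simps)
qed

lemma homotopy_at_natural:
  assumes AB: "algebra K A" "algebra K B" "h \<in> algebra_hom K A B" and s: "s \<in> lists (carrier (points G A))"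
  shows "homotopy_at i f B (map (base_change G h) s) = map_vec h (homotopy_at i f A s)"
proof -
  note cA = algebra_cyc_algebra[OF AB(1)] and cB = algebra_cyc_algebra[OF AB(2)]
    and ch = cyc_map_hom[OF AB]
  note s' = base_change_lists[OF AB(1) cA cyc_const_hom[OF AB(1)] s]
  interpret GA: group_module "points G (cyc_algebra N A)" "module_at (cyc_algebra N A)" "act_at (cyc_algebra N A)"
    by (rule group_module_at[OF cA])
  have "map (base_change G (cyc_const B)) (map (base_change G h) s)
      = map (base_change G (cyc_map h)) (map (base_change G (cyc_const A)) s)"
    using s by (auto simp: base_change_const[OF AB])
  moreover have "insert_sum (module_at (cyc_algebra N B)) (base_change G (cyc_map h) (z A))
        (cochain_at i f (cyc_algebra N B)) (map (base_change G (cyc_map h)) (map (base_change G (cyc_const A)) s))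
      = map_vec (cyc_map h) (insert_sum (module_at (cyc_algebra N A)) (z A)
        (cochain_at i f (cyc_algebra N A)) (map (base_change G (cyc_const A)) s))"
    by (intro GA.insert_sum_hom[OF map_vec_hom_at[OF cA cB ch] z_closed[OF AB(1)]
        cochain_at_closed[OF f cA] _ s'] cochain_at_natural[OF f cA cB ch])
  ultimately show ?thesis
    using neg_coeff_natural[OF AB] insert_sum_at_closed[OF AB(1) s']
    by (simp add: homotopy_at_def z_natural[OF AB] vec_module_simps(1) del: map_map)
qed

text \<open>
  Since minus the constant coefficient is \<open>A\<close>-linear, it may be taken after forming the coboundary
  over \<open>A[\<int>/N]\<close>.  There the homotopy formula for the cocycle \<open>f\<close> gives \<open>z f - f\<close>.  On the empty tuple
  the coboundary is zero by convention, so that for \<open>i = 0\<close> the statement says \<open>f = 0\<close>.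
\<close>

lemma bar_cob_homotopy_at:
  assumes A: "algebra K A" and s: "s \<in> lists (carrier (points G A))" "length s = i"
    and cocycle: "coboundary K G V i f = \<one>\<^bsub>cochain_group K G V (Suc i)\<^esub>"
  shows "bar_cob A (homotopy_at i f A) s = f (A, s)"
proof -
  let ?B = "cyc_algebra N A" and ?\<iota> = "base_change G (cyc_const A)"
  let ?fB = "cochain_at i f ?B"
  let ?I = "insert_sum (module_at ?B) (z A) ?fB"
  note B = algebra_cyc_algebra[OF A] and \<iota> = cyc_const_hom[OF A]
  note \<iota>s = base_change_lists[OF A B \<iota> s(1)]
  interpret GA: group_module "points G A" "module_at A" "act_at A" by (rule group_module_at[OF A])
  interpret GB: group_module "points G ?B" "module_at ?B" "act_at ?B" by (rule group_module_at[OF B])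
  interpret nc: abelian_group_hom "module_at ?B" "module_at A" "neg_coeff A" by (rule neg_coeff_hom[OF A])
  interpret mixed: bar_complex "points G A" "module_at ?B" ..
  note fB = cochain_at_closed[OF f B]
  have I_closed: "\<forall>t\<in>lists (carrier (points G ?B)). ?I t \<in> carrier (module_at ?B)"
    using insert_sum_at_closed[OF A] by blast
  have I\<iota>_closed: "\<forall>t\<in>lists (carrier (points G A)). ?I (map ?\<iota> t) \<in> carrier (module_at ?B)"
    using I_closed base_change_lists[OF A B \<iota>] by blast
  have fs: "f (A, s) \<in> free_module A D"
    using f A s by (intro cochain_closed)
  have fB_s: "?fB (map ?\<iota> s) = map_vec (cyc_const A) (f (A, s))"
    using cochain_at_natural[OF f A B \<iota> s(1)] s(2) by (simp add: cochain_at_def)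
  have fB_s_closed: "?fB (map ?\<iota> s) \<in> carrier (module_at ?B)"
    using fB \<iota>s by blast
  have "bar_cob A (homotopy_at i f A) s = neg_coeff A (bar_cob ?B ?I (map ?\<iota> s))"
  proof (cases s)
    case (Cons g t)
    have mem: "g \<in> carrier (points G A)" "t \<in> lists (carrier (points G A))"
      using s Cons by auto
    have "bar_diff (module_at A) (points G A) (homotopy_at i f A) s
        = neg_coeff A (bar_diff (module_at ?B) (points G A) (\<lambda>t. ?I (map ?\<iota> t)) s)"
      using mixed.bar_diff_hom[OF nc.is_abelian_group_hom, of id "points G A" "\<lambda>t. ?I (map ?\<iota> t)"
          "homotopy_at i f A" s] I\<iota>_closed s(1)
      by (simp add: homotopy_at_def)
    also have "bar_diff (module_at ?B) (points G A) (\<lambda>t. ?I (map ?\<iota> t)) s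
        = bar_diff (module_at ?B) (points G ?B) ?I (map ?\<iota> s)"
    proof -
      have "abelian_group_hom (module_at ?B) (module_at ?B) (\<lambda>v. v)"
        by (intro abelian_group_homI module_at_abelian B group_hom.intro group_hom_axioms.intro
            abelian_group.a_group) (auto simp: hom_def)
      from mixed.bar_diff_hom[OF this, of ?\<iota> "points G ?B" "\<lambda>t. ?I (map ?\<iota> t)" ?I s]
      show ?thesis
        using I\<iota>_closed s(1) hom_mult[OF base_change_hom[OF A B \<iota>]] by simp
    qed
    finally have diff: "bar_diff (module_at A) (points G A) (homotopy_at i f A) s
        = neg_coeff A (bar_diff (module_at ?B) (points G ?B) ?I (map ?\<iota> s))" .
    have It: "?I (map ?\<iota> t) \<in> carrier (module_at ?B)"
      using I\<iota>_closed mem by blast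
    have \<iota>g: "?\<iota> g \<in> carrier (points G ?B)"
      by (rule hom_in_carrier[OF base_change_hom[OF A B \<iota>] mem(1)])
    have act: "act_at A g (homotopy_at i f A t) = neg_coeff A (act_at ?B (?\<iota> g) (?I (map ?\<iota> t)))"
      using neg_coeff_act[OF A mem(1), of "?I (map ?\<iota> t)"] It by (simp add: homotopy_at_def vec_module_simps(1))
    have "bar_diff (module_at ?B) (points G ?B) ?I (map ?\<iota> s) \<in> carrier (module_at ?B)"
      by (rule GB.bar_diff_closed[OF I_closed \<iota>s])
    moreover have "act_at ?B (?\<iota> g) (?I (map ?\<iota> t)) \<in> carrier (module_at ?B)"
      by (rule GB.act_closed[OF \<iota>g It])
    ultimately show ?thesis
      using diff act Cons by simp
  qed simp
  also have "bar_cob ?B ?I (map ?\<iota> s) = act_at ?B (z A) (?fB (map ?\<iota> s)) \<oplus>\<^bsub>module_at ?B\<^esub> \<ominus>\<^bsub>module_at ?B\<^esub> ?fB (map ?\<iota> s)"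
  proof -
    have "insert_sum (module_at ?B) (z A) (bar_cob ?B ?fB) (map ?\<iota> s)
        = insert_sum (module_at ?B) (z A) (\<lambda>t. \<zero>\<^bsub>module_at ?B\<^esub>) (map ?\<iota> s)"
    proof (rule GB.insert_sum_cong[OF _ z_closed[OF A] \<iota>s])
      fix t assume t: "t \<in> lists (carrier (points G ?B))" "length t = Suc (length (map ?\<iota> s))"
      hence "coboundary K G V i f (?B, t) = \<zero>\<^bsub>module_at ?B\<^esub>"
        using cocycle B s(2) by (simp add: cochain_group_simps tuples_iff)
      thus "bar_cob ?B ?fB t = \<zero>\<^bsub>module_at ?B\<^esub>"
        using coboundary_eq_bar_cob[OF f B t(1)] t(2) s(2) by simp
    qed
    also have "\<dots> = \<zero>\<^bsub>module_at ?B\<^esub>"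
    proof -
      have "insert_sum (module_at ?B) (z A) (\<lambda>t. \<zero>\<^bsub>module_at ?B\<^esub>) t = \<zero>\<^bsub>module_at ?B\<^esub>" for t :: "'g list"
        by (induction t) (auto simp: GB.minus_zero_eq)
      thus ?thesis .
    qed
    finally have "bar_cob ?B ?I (map ?\<iota> s)
        = insert_sum (module_at ?B) (z A) (bar_cob ?B ?fB) (map ?\<iota> s) \<oplus>\<^bsub>module_at ?B\<^esub> bar_cob ?B ?I (map ?\<iota> s)"
      using GB.bar_coboundary_closed[OF I_closed \<iota>s] by simp
    also have "\<dots> = act_at ?B (z A) (?fB (map ?\<iota> s)) \<oplus>\<^bsub>module_at ?B\<^esub> \<ominus>\<^bsub>module_at ?B\<^esub> ?fB (map ?\<iota> s)"
      using fB z_closed[OF A] \<iota>s z_central[OF A] by (rule GB.insert_sum_homotopy)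
    finally show ?thesis .
  qed
  also have "neg_coeff A \<dots> = neg_coeff A (act_at ?B (z A) (?fB (map ?\<iota> s)))
      \<oplus>\<^bsub>module_at A\<^esub> \<ominus>\<^bsub>module_at A\<^esub> neg_coeff A (?fB (map ?\<iota> s))"
    using fB_s_closed GB.act_closed[OF z_closed[OF A] fB_s_closed] by simp
  also have "\<dots> = f (A, s)"
    using fs by (simp add: fB_s neg_coeff_z_act[OF A] neg_coeff_const[OF A] vec_module_simps(1))
  finally show ?thesis .
qed

end

theorem cocycle_is_coboundary:
  assumes "f \<in> cocycles K G V i"
  shows "f \<in> coboundaries K G V i"
proof -
  have f: "f \<in> cochains K G V i" and cocycle: "coboundary K G V i f = \<one>\<^bsub>cochain_group K G V (Suc i)\<^esub>"
    using assms by (simp_all add: cocycles_iff)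
  show ?thesis
  proof (cases i)
    case 0
    have "f = \<one>\<^bsub>cochain_group K G V 0\<^esub>"
    proof (rule cochain_eqI[of _ 0])
      fix A and s :: "'g list" assume A: "algebra K A" and s: "length s = 0" "s \<in> lists (carrier (points G A))"
      show "f (A, s) = \<one>\<^bsub>cochain_group K G V 0\<^esub> (A, s)"
        using bar_cob_homotopy_at[OF f A s(2) _ cocycle] A s 0 by (simp add: cochain_group_simps tuples_iff)
    qed (use cochain_ext[OF f] 0 in \<open>simp_all add: cochain_group_simps\<close>)
    thus ?thesis
      using 0 by (simp add: coboundaries_def)
  next
    case (Suc j)
    define e where "e = restrict (\<lambda>x. homotopy_at i f (fst x) (snd x)) (tuples j)"
    have e: "e \<in> cochains K G V j"
      unfolding e_def using homotopy_at_closed[OF f] homotopy_at_natural[OF f] by (intro restrict_cochain) auto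
    have "coboundary K G V j e = f"
    proof (rule cochain_eqI[of _ i])
      fix A s assume A: "algebra K A" and s: "length s = i" "s \<in> lists (carrier (points G A))"
      interpret GA: group_module "points G A" "module_at A" "act_at A" by (rule group_module_at[OF A])
      have "coboundary K G V j e (A, s) = bar_cob A (cochain_at j e A) s"
        using s Suc by (intro coboundary_eq_bar_cob[OF e A]) auto
      also have "\<dots> = bar_cob A (homotopy_at i f A) s"
        using A s Suc by (intro GA.bar_coboundary_cong) (auto simp: cochain_at_def e_def tuples_iff)
      also have "\<dots> = f (A, s)"
        using A s cocycle by (intro bar_cob_homotopy_at[OF f])
      finally show "coboundary K G V j e (A, s) = f (A, s)" .
    qed (use cochain_ext[OF f] Suc in \<open>simp_all add: coboundary_def\<close>)
    thus ?thesis
      using e Suc by (auto simp: coboundaries_def)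
  qed
qed

theorem trivial_cohomology: "trivial_group (hochschild_cohomology K G V i)"
  by (rule trivial_cohomologyI[OF cocycle_is_coboundary])

end

section \<open>Products of general linear groups acting on monomial expressions\<close>

context cring
begin

lemma tensor_mat_one_right:
  assumes "g \<in> carrier (Mat R d)"
  shows "tensor_mat R g \<one>\<^bsub>Mat R 1\<^esub> = g"
  using assms by (intro eq_matI) (auto simp: tensor_mat_def carrier_matrix_monoid_iff index_matrix_monoid_one)

text \<open>
  A scalar matrix is the tensor product of the identity with a \<open>1 \<times> 1\<close> matrix, while \<open>g\<close> is the tensor
  product of \<open>g\<close> with the \<open>1 \<times> 1\<close> identity; such tensor products commute.
\<close>

lemma scalar_commute:
  assumes g: "g \<in> carrier (Mat R d)" and l: "l \<in> carrier (Mat R 1)"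
  shows "tensor_mat R \<one>\<^bsub>Mat R d\<^esub> l \<otimes>\<^bsub>Mat R d\<^esub> g
    = g \<otimes>\<^bsub>Mat R d\<^esub> tensor_mat R \<one>\<^bsub>Mat R d\<^esub> l"
proof -
  interpret D: Group.monoid "Mat R d" by (rule matrix_monoid_monoid)
  interpret L: Group.monoid "Mat R 1" by (rule matrix_monoid_monoid)
  have "tensor_mat R \<one>\<^bsub>Mat R d\<^esub> l \<otimes>\<^bsub>Mat R (d * 1)\<^esub> tensor_mat R g \<one>\<^bsub>Mat R 1\<^esub>
      = tensor_mat R g \<one>\<^bsub>Mat R 1\<^esub> \<otimes>\<^bsub>Mat R (d * 1)\<^esub> tensor_mat R \<one>\<^bsub>Mat R d\<^esub> l"
    using g l by (simp only: D.one_closed L.one_closed D.l_one D.r_one L.l_one L.r_one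
        flip: tensor_mat_mult)
  thus ?thesis
    by (simp add: tensor_mat_one_right[OF g, unfolded One_nat_def])
qed

lemma one_by_one_hom: "(\<lambda>c. mat 1 1 (\<lambda>_. c)) \<in> hom R (Mat R 1)"
proof (rule homI)
  fix c c' assume c: "c \<in> carrier R" "c' \<in> carrier R"
  have "(\<Oplus>l\<in>{..<1::nat}. c \<otimes> c') = c \<otimes> c'"
    using c finsum_eq_single[of "{..<1::nat}" 0 "\<lambda>_. c \<otimes> c'"] by simp
  moreover have "(\<Oplus>l\<in>{..<1::nat}. mat 1 1 (\<lambda>_. c) $$ (0, l) \<otimes> mat 1 1 (\<lambda>_. c') $$ (l, 0)) = (\<Oplus>l\<in>{..<1::nat}. c \<otimes> c')"
    using c by (intro finsum_cong') auto
  ultimately show "mat 1 1 (\<lambda>_. c \<otimes> c') = mat 1 1 (\<lambda>_. c) \<otimes>\<^bsub>Mat R 1\<^esub> mat 1 1 (\<lambda>_. c')"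
    by (intro eq_matI) (auto simp: index_matrix_monoid_mult)
qed (auto simp: carrier_matrix_monoid_iff)

lemma one_by_one_one: "mat 1 1 (\<lambda>_. \<one>) = \<one>\<^bsub>Mat R 1\<^esub>"
  by (rule eq_matI) (auto simp: index_matrix_monoid_one)

lemma one_by_one_GL: "c \<in> Units R \<Longrightarrow> mat 1 1 (\<lambda>_. c) \<in> carrier (GL R 1)"
  unfolding carrier_GL by (rule monoid_hom_Units[OF one_by_one_hom one_by_one_one])

lemma one_by_one_pow:
  assumes "c \<in> carrier R"
  shows "mat 1 1 (\<lambda>_. c) [^]\<^bsub>GL R 1\<^esub> (m::nat) = mat 1 1 (\<lambda>_. c [^] m)"
proof (induction m)
  case 0
  show ?case
    by (simp add: GL_one one_by_one_one[unfolded One_nat_def])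
next
  case (Suc m)
  thus ?case
    using assms hom_mult[OF one_by_one_hom, of "c [^] m" c] by (simp add: GL_mult)
qed

lemma GL_1_comm_group: "comm_group (GL R 1)"
proof -
  interpret L: Group.monoid "Mat R 1" by (rule matrix_monoid_monoid)
  have "comm_monoid (Mat R 1)"
  proof (rule L.monoid_comm_monoidI)
    fix g h assume gh: "g \<in> carrier (Mat R 1)" "h \<in> carrier (Mat R 1)"
    have "g = mat 1 1 (\<lambda>_. g $$ (0, 0))" "h = mat 1 1 (\<lambda>_. h $$ (0, 0))"
      using gh by (auto simp: carrier_matrix_monoid_iff intro!: eq_matI)
    moreover have "g $$ (0, 0) \<in> carrier R" "h $$ (0, 0) \<in> carrier R"
      using gh by (auto simp: carrier_matrix_monoid_iff)
    ultimately show "g \<otimes>\<^bsub>Mat R 1\<^esub> h = h \<otimes>\<^bsub>Mat R 1\<^esub> g"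
      using hom_mult[OF one_by_one_hom] m_comm by metis
  qed
  thus ?thesis
    unfolding GL_def by (rule comm_monoid.units_comm_group)
qed

end

lemma map2_map_same: "map2 f (map g xs) (map h xs) = map (\<lambda>x. f (g x) (h x)) xs"
  by (induction xs) auto

lemma points_GL_product: "points (GL_product n d) A = product_group {..<n} (\<lambda>j. GL A (d j))"
  by (simp add: GL_product_def)

lemma GL_list_points:
  "g \<in> carrier (points (GL_product n d) A) \<Longrightarrow> GL_list A (map d [0..<n]) (map g [0..<n])"
  by (auto simp: points_GL_product GL_list_iff_nth)

lemma functor_rep_GL_product:
  fixes K :: "('k, 'b) ring_scheme"
  assumes E: "vb_functorial K n E"
  shows "functor_rep K (GL_product n d) (monomial_rep n d E)"
proof (rule functor_rep.intro)
  fix A :: "'k alg" assume A: "algebra K A"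
  interpret cring A by (rule algebra_cring[OF A])
  show "Group.group (points (GL_product n d) A)"
    by (simp add: points_GL_product GL_group)
next
  fix A B :: "'k alg" and h assume AB: "algebra K A" "algebra K B" "h \<in> algebra_hom K A B"
  interpret ring_hom_cring A B h by (rule algebra_hom_ring_hom_cring[OF AB])
  show "base_change (GL_product n d) h \<in> hom (points (GL_product n d) A) (points (GL_product n d) B)"
    using hom_in_carrier[OF map_mat_hom_GL] Group.hom_mult[OF map_mat_hom_GL]
    by (auto simp: points_GL_product hom_def GL_product_def PiE_iff intro!: restrict_ext)
next
  fix A :: "'k alg" and g assume A: "algebra K A" and g: "g \<in> carrier (points (GL_product n d) A)"
  show "rep_mat (monomial_rep n d E) A g \<in> carrier (Mat A (rep_dim (monomial_rep n d E)))"
    using vb_iso_GL[OF E A _ GL_list_points[OF g]] GL_subset_matrix_monoid by (simp add: monomial_rep_def)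
next
  fix A :: "'k alg" and g g' assume A: "algebra K A" and g: "g \<in> carrier (points (GL_product n d) A)"
    and g': "g' \<in> carrier (points (GL_product n d) A)"
  have "dim_row (g k) = d k" if "k < n" for k
    using g that by (auto simp: points_GL_product PiE_iff intro!: dim_GL(1))
  hence "map (g \<otimes>\<^bsub>points (GL_product n d) A\<^esub> g') [0..<n] = map2 (square_mult A) (map g [0..<n]) (map g' [0..<n])"
    by (auto simp: points_GL_product map2_map_same GL_mult)
  thus "rep_mat (monomial_rep n d E) A (g \<otimes>\<^bsub>points (GL_product n d) A\<^esub> g')
      = rep_mat (monomial_rep n d E) A g \<otimes>\<^bsub>Mat A (rep_dim (monomial_rep n d E))\<^esub>
        rep_mat (monomial_rep n d E) A g'"
    using vb_iso_mult[OF E A _ GL_list_points[OF g] GL_list_points[OF g']]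
    by (simp add: monomial_rep_def GL_mult)
next
  fix A B :: "'k alg" and h g assume AB: "algebra K A" "algebra K B" "h \<in> algebra_hom K A B"
    and g: "g \<in> carrier (points (GL_product n d) A)"
  have "map (base_change (GL_product n d) h g) [0..<n] = map (map_mat h) (map g [0..<n])"
    by (auto simp: GL_product_def)
  thus "rep_mat (monomial_rep n d E) B (base_change (GL_product n d) h g)
      = map_mat h (rep_mat (monomial_rep n d E) A g)"
    using vb_iso_base_change[OF E AB(1) _ GL_list_points[OF g] AB(2,3)]
    by (simp add: monomial_rep_def del: map_map map_eq_conv)
qed

text \<open>
  The homogeneity of \<open>E\<close>, applied to the identity automorphisms of the \<open>V\<^sub>k\<close> and the automorphism \<open>l\<close> of
  the \<open>j\<close>-th line bundle.
\<close>

lemma vb_iso_scalar: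
  assumes E: "vb_functorial K n E" and deg: "has_degree K n E a" and A: "algebra K A" and j: "j < n"
    and l: "l \<in> carrier (GL A 1)"
  shows "vb_iso E A (map (\<lambda>k. tensor_mat A \<one>\<^bsub>GL A (d k)\<^esub> (if k = j then l else \<one>\<^bsub>GL A 1\<^esub>)) [0..<n])
    = tensor_mat A \<one>\<^bsub>GL A (vb_rank E (map d [0..<n]))\<^esub> (l [^]\<^bsub>GL A 1\<^esub> a j)"
proof -
  interpret cring A by (rule algebra_cring[OF A])
  interpret L: comm_group "GL A 1" by (rule GL_1_comm_group)
  let ?ds = "map d [0..<n]"
  interpret V: Group.group "GL A (vb_rank E ?ds)" by (rule GL_group)
  define gs where "gs = map (\<lambda>k. \<one>\<^bsub>GL A (d k)\<^esub>) [0..<n]"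
  define ls where "ls = map (\<lambda>k. if k = j then l else \<one>\<^bsub>GL A 1\<^esub>) [0..<n]"
  have one: "\<one>\<^bsub>GL A e\<^esub> \<in> carrier (GL A e)" for e
    by (rule Group.monoid.one_closed[OF Group.group.is_monoid[OF GL_group]])
  have gs: "GL_list A ?ds gs"
    using one by (simp add: GL_list_iff_nth gs_def)
  have w: "vb_iso E A gs \<in> carrier (GL A (vb_rank E ?ds))"
    by (rule vb_iso_GL[OF E A _ gs]) simp
  have "map2 (square_mult A) gs gs = gs"
    using Group.monoid.l_one[OF matrix_monoid_monoid matrix_monoid_one_closed]
    by (simp add: gs_def map2_map_same GL_one)
  hence "vb_iso E A gs \<otimes>\<^bsub>GL A (vb_rank E ?ds)\<^esub> vb_iso E A gs = vb_iso E A gs"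
    using vb_iso_mult[OF E A _ gs gs] by simp
  hence w_one: "vb_iso E A gs = \<one>\<^bsub>GL A (vb_rank E ?ds)\<^esub>"
    using w V.r_cancel_one by blast
  have "map (\<lambda>k. tensor_mat A \<one>\<^bsub>GL A (d k)\<^esub> (if k = j then l else \<one>\<^bsub>GL A 1\<^esub>)) [0..<n] = map2 (tensor_mat A) gs ls"
    by (simp add: gs_def ls_def map2_map_same)
  also have "vb_iso E A \<dots> = tensor_mat A (vb_iso E A gs) (\<Otimes>\<^bsub>GL A 1\<^esub>k\<in>{..<n}. (ls ! k) [^]\<^bsub>GL A 1\<^esub> (a k))"
    using deg A l one unfolding has_degree_def
    by (elim allE[of _ A] allE[of _ ?ds] allE[of _ gs] allE[of _ ls]) (auto simp: gs_def ls_def)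
  also have "(\<Otimes>\<^bsub>GL A 1\<^esub>k\<in>{..<n}. (ls ! k) [^]\<^bsub>GL A 1\<^esub> (a k))
      = (\<Otimes>\<^bsub>GL A 1\<^esub>k\<in>{..<n}. if j = k then l [^]\<^bsub>GL A 1\<^esub> (a k) else \<one>\<^bsub>GL A 1\<^esub>)"
    using l by (intro L.finprod_cong') (auto simp: ls_def simp del: One_nat_def)
  also have "\<dots> = l [^]\<^bsub>GL A 1\<^esub> a j"
    using l j by (intro L.finprod_singleton) (auto simp del: One_nat_def)
  finally show ?thesis
    by (simp add: w_one)
qed

context cyclic_group_algebra
begin

text \<open>
  The matrix of a generator of the cyclic group, or of its inverse if the weight is negative, so that
  its \<open>e\<close>-th power is the basis element of index \<open>\<bar>e\<bar>\<close> of the group algebra.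
\<close>

definition generator_mat :: "'k alg \<Rightarrow> int \<Rightarrow> 'k list mat" where
  "generator_mat A e = (let x = mat 1 1 (\<lambda>_. cyc_monom A 1) in
    if e \<ge> 0 then x else inv\<^bsub>GL (cyc_algebra N A) 1\<^esub> x)"

context
  assumes N: "1 < N"
begin

lemma generator_GL:
  assumes "algebra K A"
  shows "mat 1 1 (\<lambda>_. cyc_monom A 1) \<in> carrier (GL (cyc_algebra N A) 1)"
  by (rule cring.one_by_one_GL[OF algebra_cring[OF algebra_cyc_algebra[OF assms]] cyc_monom_Unit[OF assms N]])

lemma generator_mat_GL:
  assumes "algebra K A"
  shows "generator_mat A e \<in> carrier (GL (cyc_algebra N A) 1)"
proof -
  interpret cring "cyc_algebra N A" by (rule algebra_cring[OF algebra_cyc_algebra[OF assms]])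
  interpret Group.group "GL (cyc_algebra N A) 1" by (rule GL_group)
  show ?thesis
    using generator_GL[OF assms] inv_closed unfolding generator_mat_def Let_def by simp
qed

lemma generator_mat_pow:
  assumes A: "algebra K A" and e: "nat \<bar>e\<bar> < N"
  shows "generator_mat A e [^]\<^bsub>GL (cyc_algebra N A) 1\<^esub> e = mat 1 1 (\<lambda>_. cyc_monom A (nat \<bar>e\<bar>))"
proof -
  let ?B = "cyc_algebra N A" and ?x = "mat 1 1 (\<lambda>_. cyc_monom A 1)"
  interpret cring ?B by (rule algebra_cring[OF algebra_cyc_algebra[OF A]])
  interpret L: Group.group "GL ?B 1" by (rule GL_group)
  note x = generator_GL[OF A]
  have "generator_mat A e [^]\<^bsub>GL ?B 1\<^esub> e = ?x [^]\<^bsub>GL ?B 1\<^esub> nat \<bar>e\<bar>"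
  proof (cases "e \<ge> 0")
    case True
    obtain k where k: "e = int k"
      using True by (cases e rule: int_cases2) auto
    have "generator_mat A e = ?x"
      unfolding generator_mat_def Let_def using True by simp
    thus ?thesis
      unfolding k by (simp only: int_pow_int abs_of_nat nat_int)
  next
    case False
    obtain k where k: "e = - int k"
      using False by (cases e rule: int_cases2) auto
    have "generator_mat A e = inv\<^bsub>GL ?B 1\<^esub> ?x"
      unfolding generator_mat_def Let_def using False by simp
    hence "generator_mat A e [^]\<^bsub>GL ?B 1\<^esub> e
        = inv\<^bsub>GL ?B 1\<^esub> ((inv\<^bsub>GL ?B 1\<^esub> ?x) [^]\<^bsub>GL ?B 1\<^esub> k)"
      unfolding k by (simp only: L.int_pow_neg_int[OF L.inv_closed[OF x]])
    also have "\<dots> = ?x [^]\<^bsub>GL ?B 1\<^esub> k"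
      by (simp only: L.nat_pow_inv[OF x] L.inv_inv[OF L.nat_pow_closed[OF x]])
    also have "k = nat \<bar>e\<bar>"
      by (simp add: k)
    finally show ?thesis .
  qed
  also have "\<dots> = mat 1 1 (\<lambda>_. cyc_monom A 1 [^]\<^bsub>?B\<^esub> nat \<bar>e\<bar>)"
    by (rule one_by_one_pow[OF cyc_monom_closed[OF A]])
  also have "\<dots> = mat 1 1 (\<lambda>_. cyc_monom A (nat \<bar>e\<bar>))"
    using cyc_monom_pow[OF A e] by simp
  finally show ?thesis .
qed

lemma generator_mat_natural:
  assumes AB: "algebra K A" "algebra K B" "h \<in> algebra_hom K A B"
  shows "map_mat (cyc_map h) (generator_mat A e) = generator_mat B e"
proof -
  interpret ring_hom_cring "cyc_algebra N A" "cyc_algebra N B" "cyc_map h"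
    by (rule algebra_hom_ring_hom_cring[OF algebra_cyc_algebra[OF AB(1)] algebra_cyc_algebra[OF AB(2)] cyc_map_hom[OF AB]])
  have "map_mat (cyc_map h) (mat 1 1 (\<lambda>_. cyc_monom A 1)) = mat 1 1 (\<lambda>_. cyc_monom B 1)"
    using cyc_map_monom[OF algebra_hom_ring_hom_cring[OF AB]] by (intro eq_matI) auto
  thus ?thesis
    using map_mat_GL_inv[OF generator_GL[OF AB(1)]] by (simp add: generator_mat_def Let_def)
qed

end

end

theorem lemma7p3:
  fixes K :: "('k, 'b) ring_scheme"
    and n i :: nat
    and d :: "nat \<Rightarrow> nat"
    and E :: "'k vb_functor"
    and a :: "nat \<Rightarrow> int"
  assumes "field K"
    and "n \<ge> 2"
    and "\<And>j. j < n \<Longrightarrow> d j \<ge> 1"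
    and "monomial_expression K n E"
    and "has_degree K n E a"
    and "\<exists>j<n. a j \<noteq> 0"
  shows "trivial_group (hochschild_cohomology K (GL_product n d) (monomial_rep n d E) i)"
proof -
  obtain j where j: "j < n" "a j \<noteq> 0"
    using assms(6) by blast
  define m where "m = nat \<bar>a j\<bar>"
  \<comment> \<open>With this choice \<open>x\<^sup>m \<noteq> 1\<close> in the group algebra of \<open>\<int>/N\<close>.\<close>
  define N where "N = Suc m"
  have m: "0 < m" "m < N" "1 < N"
    using j by (auto simp: m_def N_def)
  have E: "vb_functorial K n E"
    using assms(4) by (rule monomial_expression_functorial)
  let ?G = "GL_product n d" and ?V = "monomial_rep n d E"
  interpret functor_rep K ?G ?V
    by (rule functor_rep_GL_product[OF E])
  interpret cyclic_group_algebra K N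
    using assms(1) m by (intro cyclic_group_algebra.intro) auto
  define ls where "ls A k = (if k = j then generator_mat A (a j) else \<one>\<^bsub>GL (cyc_algebra N A) 1\<^esub>)" for A k
  define z where "z A = (\<lambda>k\<in>{..<n}. tensor_mat (cyc_algebra N A) \<one>\<^bsub>GL (cyc_algebra N A) (d k)\<^esub> (ls A k))" for A
  have ls: "ls A k \<in> carrier (GL (cyc_algebra N A) 1)" if "algebra K A" for A k
  proof -
    interpret cring "cyc_algebra N A" by (rule algebra_cring[OF algebra_cyc_algebra[OF that]])
    show ?thesis
      using generator_mat_GL[OF m(3) that] Group.monoid.one_closed[OF Group.group.is_monoid[OF GL_group, of 1]]
      by (simp add: ls_def)
  qed
  interpret functor_rep_central K ?G ?V N m z
  proof
    show "0 < m" "m < N"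
      by (rule m)+
  next
    fix A :: "'k alg" assume A: "algebra K A"
    let ?B = "cyc_algebra N A"
    interpret B: cring ?B by (rule algebra_cring[OF algebra_cyc_algebra[OF A]])
    have one: "\<one>\<^bsub>GL ?B e\<^esub> \<in> carrier (GL ?B e)" for e
      by (rule Group.monoid.one_closed[OF Group.group.is_monoid[OF B.GL_group]])
    show "z A \<in> carrier (points ?G ?B)"
      using B.tensor_mat_GL[OF one ls[OF A]] by (auto simp: z_def points_GL_product)
    show "z A \<otimes>\<^bsub>points ?G ?B\<^esub> g = g \<otimes>\<^bsub>points ?G ?B\<^esub> z A" if g: "g \<in> carrier (points ?G ?B)" for g
      using g B.scalar_commute[OF GL_subset_matrix_monoid GL_subset_matrix_monoid[OF ls[OF A]]]
      by (auto simp: points_GL_product z_def GL_mult GL_one PiE_iff intro!: restrict_ext)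
    have "rep_mat ?V ?B (z A) = vb_iso E ?B (map (\<lambda>k. tensor_mat ?B \<one>\<^bsub>GL ?B (d k)\<^esub> (ls A k)) [0..<n])"
      by (auto simp: monomial_rep_def z_def intro!: arg_cong[where f = "vb_iso E ?B"])
    also have "\<dots> = tensor_mat ?B \<one>\<^bsub>GL ?B (vb_rank E (map d [0..<n]))\<^esub>
        (generator_mat A (a j) [^]\<^bsub>GL ?B 1\<^esub> a j)"
      unfolding ls_def
      by (rule vb_iso_scalar[OF E assms(5) algebra_cyc_algebra[OF A] j(1) generator_mat_GL[OF m(3) A]])
    also have "generator_mat A (a j) [^]\<^bsub>GL ?B 1\<^esub> a j = mat 1 1 (\<lambda>_. cyc_monom A m)"
      using generator_mat_pow[OF m(3) A, of "a j"] m by (simp add: m_def)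
    finally show "rep_mat ?V ?B (z A) = mat (rep_dim ?V) (rep_dim ?V)
        (\<lambda>(p, q). if p = q then cyc_monom A m else \<zero>\<^bsub>?B\<^esub>)"
      using cyc_monom_closed[OF A, of m]
      by (intro eq_matI) (auto simp: tensor_mat_def monomial_rep_def GL_one index_matrix_monoid_one)
  next
    fix A B :: "'k alg" and h assume AB: "algebra K A" "algebra K B" "h \<in> algebra_hom K A B"
    interpret h: ring_hom_cring "cyc_algebra N A" "cyc_algebra N B" "cyc_map h"
      by (rule algebra_hom_ring_hom_cring[OF algebra_cyc_algebra[OF AB(1)] algebra_cyc_algebra[OF AB(2)] cyc_map_hom[OF AB]])
    have "map_mat (cyc_map h) (ls A k) = ls B k" for k
      using generator_mat_natural[OF m(3) AB] h.map_mat_matrix_monoid_one by (simp add: ls_def GL_one)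
    hence "map_mat (cyc_map h) (tensor_mat (cyc_algebra N A) \<one>\<^bsub>GL (cyc_algebra N A) e\<^esub> (ls A k))
        = tensor_mat (cyc_algebra N B) \<one>\<^bsub>GL (cyc_algebra N B) e\<^esub> (ls B k)" for e k
      using h.map_mat_tensor_mat[OF h.R.matrix_monoid_one_closed GL_subset_matrix_monoid[OF ls[OF AB(1)]]]
        h.map_mat_matrix_monoid_one by (simp add: GL_one)
    thus "base_change ?G (cyc_map h) (z A) = z B"
      by (auto simp: GL_product_def z_def intro!: restrict_ext)
    show "base_change ?G (cyc_map h) (base_change ?G (cyc_const A) g) = base_change ?G (cyc_const B) (base_change ?G h g)"
      for g
      using cyc_map_const[OF algebra_hom_ring_hom_cring[OF AB]]
      by (auto simp: GL_product_def intro!: restrict_ext eq_matI)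
  qed
  show ?thesis
    by (rule trivial_cohomology)
qed

end
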